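(* Let $K$ be a field, $S=K[t_1,\dots,t_s]$, and let $(0)\ne I\subset S$ be an unmixed graded ideal. If $\dim(S/I)\ge2$, then $$\delta_I(d)>\deg(S/I)-H_I(d)+1\quad\text{for some } d\ge1.$$
   Context: $S=\bigoplus_{d\ge0}S_d$ has the standard grading; $K$ is arbitrary. An ideal is unmixed if it is proper and all its associated primes have the same height. $H_I(d)=\dim_K(S_d/I_d)$. With $k=\dim(S/I)$, $\deg(S/I)=(k-1)!\lim_{d\to\infty}H_I(d)/d^{k-1}$ if $k\ge1$ and $\dim_K(S/I)$ if $k=0$. For $d\ge1$ let $\mathcal F_d$ be the set of $f\in S_d\setminus I$ with $(I:f)\ne I$. The minimum distance function is $\delta_I(d)=\deg(S/I)-\max\{\deg(S/(I,f)): f\in\mathcal F_d\}$ if $\mathcal F_d\neq\emptyset$, and $\delta_I(d)=\deg(S/I)$ if $\mathcal F_d=\emptyset$. *)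

theory Defs
  imports
    Complex_Main
    "HOL-Library.Poly_Mapping"
    "HOL-Library.Extended_Nat"
    "HOL-Algebra.QuotRing"
    "HOL-Algebra.Embedded_Algebras"
begin

section \<open>Commutative rings: heights, dimension, associated primes\<close>

definition prime_chain :: "('a, 'b) ring_scheme \<Rightarrow> nat \<Rightarrow> (nat \<Rightarrow> 'a set) \<Rightarrow> bool" where
  "prime_chain R n P \<longleftrightarrow> (\<forall>i\<le>n. primeideal (P i) R) \<and> (\<forall>i<n. P i \<subset> P (Suc i))"

definition height :: "('a, 'b) ring_scheme \<Rightarrow> 'a set \<Rightarrow> enat" where
  "height R p = Sup {enat n | n. \<exists>P. prime_chain R n P \<and> P n = p}"

text \<open>The zero ring gets dimension 0, because the supremum is taken in \<^typ>\<open>enat\<close>.\<close>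

definition krull_dim :: "('a, 'b) ring_scheme \<Rightarrow> enat" where
  "krull_dim R = Sup {enat n | n. \<exists>P. prime_chain R n P}"

definition colon :: "('a, 'b) ring_scheme \<Rightarrow> 'a set \<Rightarrow> 'a \<Rightarrow> 'a set" where
  "colon R I f = {g \<in> carrier R. g \<otimes>\<^bsub>R\<^esub> f \<in> I}"

text \<open>The associated primes of \<open>I\<close> are those of the module \<open>R/I\<close>; the annihilator of the
  class of \<open>f\<close> in \<open>R/I\<close> is \<open>(I : f)\<close>.\<close>

definition associated_primes :: "('a, 'b) ring_scheme \<Rightarrow> 'a set \<Rightarrow> 'a set set" where
  "associated_primes R I = {p. primeideal p R \<and> (\<exists>f\<in>carrier R. p = colon R I f)}"

definition unmixed :: "('a, 'b) ring_scheme \<Rightarrow> 'a set \<Rightarrow> bool" where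
  "unmixed R I \<longleftrightarrow> ideal I R \<and> I \<noteq> carrier R \<and>
     (\<forall>p\<in>associated_primes R I. \<forall>q\<in>associated_primes R I. height R p = height R q)"


section \<open>The graded polynomial ring\<close>

text \<open>A monomial is its exponent vector, and a polynomial maps monomials to coefficients. The
  variables are numbered \<open>0, ..., s - 1\<close>.\<close>

type_synonym 'k mpoly = "(nat \<Rightarrow>\<^sub>0 nat) \<Rightarrow>\<^sub>0 'k"

definition poly_ring :: "nat \<Rightarrow> 'k::field mpoly ring" where
  "poly_ring s = \<lparr>carrier = {f. \<forall>m\<in>Poly_Mapping.keys f. Poly_Mapping.keys m \<subseteq> {..<s}},
     mult = (*), one = 1, zero = 0, add = (+)\<rparr>"

definition mon_deg :: "(nat \<Rightarrow>\<^sub>0 nat) \<Rightarrow> nat" where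
  "mon_deg m = (\<Sum>i\<in>Poly_Mapping.keys m. Poly_Mapping.lookup m i)"

definition homog_part :: "nat \<Rightarrow> nat \<Rightarrow> 'k::field mpoly set" where
  "homog_part s d = {f \<in> carrier (poly_ring s). \<forall>m\<in>Poly_Mapping.keys f. mon_deg m = d}"

definition homog_component :: "nat \<Rightarrow> 'k::field mpoly \<Rightarrow> 'k mpoly" where
  "homog_component d f =
     (\<Sum>m\<in>{m \<in> Poly_Mapping.keys f. mon_deg m = d}. Poly_Mapping.single m (Poly_Mapping.lookup f m))"

definition graded_ideal :: "nat \<Rightarrow> 'k::field mpoly set \<Rightarrow> bool" where
  "graded_ideal s I \<longleftrightarrow> ideal I (poly_ring s) \<and> (\<forall>f\<in>I. \<forall>d. homog_component d f \<in> I)"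

lemma cring_poly_ring: "cring (poly_ring s :: 'k::field mpoly ring)"
proof -
  have mult_closed: "f * g \<in> carrier (poly_ring s)"
    if "f \<in> carrier (poly_ring s)" "g \<in> carrier (poly_ring s)" for f g :: "'k mpoly"
    unfolding poly_ring_def
  proof (clarsimp, rule ccontr)
    fix m x assume m: "m \<in> Poly_Mapping.keys (f * g)" and x: "x \<in> Poly_Mapping.keys m" "\<not> x < s"
    obtain a b where "a \<in> Poly_Mapping.keys f" "b \<in> Poly_Mapping.keys g" "m = a + b"
      using m keys_mult[of f g] by blast
    moreover from this x have "x \<in> Poly_Mapping.keys a \<or> x \<in> Poly_Mapping.keys b"
      using Poly_Mapping.keys_add[of a b] by blast
    ultimately show False
      using that x(2) by (auto simp: poly_ring_def)
  qed
  have add_closed: "f + g \<in> carrier (poly_ring s)"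
    if "f \<in> carrier (poly_ring s)" "g \<in> carrier (poly_ring s)" for f g :: "'k mpoly"
    using that Poly_Mapping.keys_add[of f g] unfolding poly_ring_def by simp blast
  have neg: "- f \<in> carrier (poly_ring s)"
    if "f \<in> carrier (poly_ring s)" for f :: "'k mpoly"
    using that by (simp add: poly_ring_def in_keys_iff)
  have ops: "x \<otimes>\<^bsub>poly_ring s\<^esub> y = x * y" "x \<oplus>\<^bsub>poly_ring s\<^esub> y = x + y"
    "\<one>\<^bsub>poly_ring s\<^esub> = 1" "\<zero>\<^bsub>poly_ring s\<^esub> = 0" for x y :: "'k mpoly"
    by (simp_all add: poly_ring_def)
  have zero_one: "(0 :: 'k mpoly) \<in> carrier (poly_ring s)" "(1 :: 'k mpoly) \<in> carrier (poly_ring s)"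
    by (simp_all add: poly_ring_def)
  show ?thesis
  proof (rule cringI)
    show "abelian_group (poly_ring s :: 'k mpoly ring)"
    proof (rule abelian_groupI, unfold ops)
      fix f :: "'k mpoly" assume "f \<in> carrier (poly_ring s)"
      then show "\<exists>g\<in>carrier (poly_ring s). g + f = 0"
        using neg by (intro bexI[of _ "- f"]) simp_all
    qed (rule add_closed zero_one add.assoc add.commute add_0_left; assumption?)+
    show "comm_monoid (poly_ring s :: 'k mpoly ring)"
      by (rule comm_monoidI, unfold ops)
        (rule mult_closed zero_one mult.assoc mult.commute mult_1_left; assumption?)+
  qed (unfold ops, rule distrib_right)
qed


section \<open>Hilbert function, degree and minimum distance function\<close>

text \<open>The copy of \<open>K\<close> in \<open>S/I\<close>: a subfield as soon as \<open>I\<close> is a proper ideal, so that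
  \<^const>\<open>ring.dim\<close> over it is the dimension over \<open>K\<close>.\<close>

definition scalars :: "nat \<Rightarrow> 'k::field mpoly set \<Rightarrow> 'k mpoly set set" where
  "scalars s I = (\<lambda>c. I +>\<^bsub>poly_ring s\<^esub> Poly_Mapping.single 0 c) ` UNIV"

text \<open>The quotient \<open>S\<^sub>d/I\<^sub>d\<close>, where \<open>I\<^sub>d = I \<inter> S\<^sub>d\<close>, is taken as the image of \<open>S\<^sub>d\<close> in \<open>S/I\<close>.\<close>

definition hilbert_fun :: "nat \<Rightarrow> 'k::field mpoly set \<Rightarrow> nat \<Rightarrow> nat" where
  "hilbert_fun s I d = ring.dim (poly_ring s Quot I) (scalars s I)
     ((\<lambda>f. I +>\<^bsub>poly_ring s\<^esub> f) ` homog_part s d)"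

definition degree_quot :: "nat \<Rightarrow> 'k::field mpoly set \<Rightarrow> real" where
  "degree_quot s I =
     (let k = the_enat (krull_dim (poly_ring s Quot I)) in
      if k = 0
      then real (ring.dim (poly_ring s Quot I) (scalars s I) (carrier (poly_ring s Quot I)))
      else fact (k - 1) * lim (\<lambda>d. real (hilbert_fun s I d) / real d ^ (k - 1)))"

definition zero_divisor_forms :: "nat \<Rightarrow> 'k::field mpoly set \<Rightarrow> nat \<Rightarrow> 'k mpoly set" where
  "zero_divisor_forms s I d = {f \<in> homog_part s d - I. colon (poly_ring s) I f \<noteq> I}"

definition min_dist_fun :: "nat \<Rightarrow> 'k::field mpoly set \<Rightarrow> nat \<Rightarrow> real" where
  "min_dist_fun s I d =
     (if zero_divisor_forms s I d = {} then degree_quot s I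
      else degree_quot s I -
        Max ((\<lambda>f. degree_quot s (Idl\<^bsub>poly_ring s\<^esub> (insert f I))) ` zero_divisor_forms s I d))"

end

theory Submission
  imports Defs "HOL-Library.Product_Lexorder"
begin

text \<open>Every zero divisor \<open>f\<close> modulo \<open>I\<close> lies in an associated prime of \<open>I\<close>, and all of these have the
  same height, so \<open>S/(I, f)\<close> has the same dimension \<open>k\<close> as \<open>S/I\<close>. As the Hilbert function of \<open>(I, f)\<close> is
  bounded by that of \<open>I\<close>, the degree of \<open>S/(I, f)\<close> is a natural number not exceeding \<open>deg(S/I)\<close>; hence only
  finitely many degrees occur, and their maximum is at most \<open>deg(S/I)\<close>. On the other hand \<open>H\<^sub>I\<close> is
  unbounded, since \<open>k \<ge> 2\<close>.

  Dimensions are computed by sets of variables that are independent modulo an ideal. Dickson's lemma splits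
  the standard monomials of a graded ideal into finitely many disjoint cones \<open>m + \<nat>\<^sup>u\<close> with \<open>u\<close> independent, so that
  the normalised limit of the Hilbert function exists and is the number of cones of top dimension.
  The largest size of an independent set drops along strict inclusions of primes, by counting monomials. It
  drops by at most one on adding a variable to a graded prime, and the primes generated by
  \<open>P \<inter> K[V]\<close>, for \<open>V\<close> shrinking to a maximal independent set, give a chain of the expected length below a prime
  \<open>P\<close>. Hence it is the dimension of the quotient, and complementary to the height.\<close>

section \<open>Ideals of the polynomial ring\<close>

text \<open>Three notions have to be tied together: Krull dimension and height count prime chains,
  the degree is a limit of a counting function, and unmixedness speaks of heights only. Independent
  sets of variables mediate, since their sizes can be compared both with monomial counts and with
  chains. Using the given variables avoids coordinates in general position, which a finite field may
  not supply. The height formula covers all primes, so it applies to the associated primes of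
  \<open>I\<close> without showing that these are graded. Gradedness enters where chains are
  extended upwards, because the bound on the drop of dimension counts forms degree by degree.
  Maximal colon ideals \<open>(I : h)\<close> take the place of primary decomposition. One choice
  gives an associated prime around a zero divisor, another an associated prime of full dimension;
  unmixedness carries the full dimension from the latter to the former.\<close>

abbreviation lookup :: "('a \<Rightarrow>\<^sub>0 'b::zero) \<Rightarrow> 'a \<Rightarrow> 'b" where "lookup \<equiv> Poly_Mapping.lookup"
abbreviation keys :: "('a \<Rightarrow>\<^sub>0 'b::zero) \<Rightarrow> 'a set" where "keys \<equiv> Poly_Mapping.keys"
abbreviation single :: "'a \<Rightarrow> 'b \<Rightarrow> ('a \<Rightarrow>\<^sub>0 'b::zero)" where "single \<equiv> Poly_Mapping.single"

type_synonym mon = "nat \<Rightarrow>\<^sub>0 nat"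

definition mons :: "nat set \<Rightarrow> mon set" where
  "mons u = {m. keys m \<subseteq> u}"

text \<open>The polynomial ring \<open>K[u]\<close> inside the common type, so that intersections
  such as \<open>pol u \<inter> J\<close> make sense directly.\<close>

definition pol :: "nat set \<Rightarrow> 'k::field mpoly set" where
  "pol u = {f. keys f \<subseteq> mons u}"

lemma carrier_poly_ring: "carrier (poly_ring s) = (pol {..<s} :: 'k::field mpoly set)"
  by (auto simp: poly_ring_def pol_def mons_def)

lemma poly_ring_simps [simp]:
  "x \<otimes>\<^bsub>poly_ring s\<^esub> y = x * y" "x \<oplus>\<^bsub>poly_ring s\<^esub> y = x + y"
  "\<one>\<^bsub>poly_ring s\<^esub> = 1" "\<zero>\<^bsub>poly_ring s\<^esub> = 0"
  by (simp_all add: poly_ring_def)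

lemma keys_mon_add: "keys (m + n :: mon) = keys m \<union> keys n"
  by (auto simp: in_keys_iff lookup_add)

lemma mons_add_iff: "m + n \<in> mons u \<longleftrightarrow> m \<in> mons u \<and> n \<in> mons u"
  by (auto simp: mons_def keys_mon_add)

lemma mons_zero [simp]: "0 \<in> mons u" by (simp add: mons_def)

lemma mons_mono: "u \<subseteq> v \<Longrightarrow> mons u \<subseteq> mons v" by (auto simp: mons_def)

lemma pol_mono: "u \<subseteq> v \<Longrightarrow> pol u \<subseteq> pol v" using mons_mono[of u v] by (auto simp: pol_def)

lemma single_mons: "i \<in> u \<Longrightarrow> single i j \<in> mons u" by (simp add: mons_def)

lemma pol_zero [simp]: "0 \<in> pol u" by (simp add: pol_def)
lemma pol_one [simp]: "1 \<in> pol u" by (simp add: pol_def)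
lemma pol_single: "m \<in> mons u \<Longrightarrow> single m c \<in> pol u" by (simp add: pol_def)
lemma pol_const [simp]: "single 0 c \<in> pol u" by (simp add: pol_def)
lemma pol_add: "f \<in> pol u \<Longrightarrow> g \<in> pol u \<Longrightarrow> f + g \<in> pol u"
  using keys_add[of f g] by (auto simp: pol_def)
lemma pol_uminus: "f \<in> pol u \<Longrightarrow> - f \<in> pol u"
  by (auto simp: pol_def in_keys_iff subset_iff)
lemma pol_diff: "f \<in> pol u \<Longrightarrow> g \<in> pol u \<Longrightarrow> f - g \<in> pol u"
  using pol_add[of f u "- g"] pol_uminus[of g u] by simp
lemma pol_mult: "f \<in> pol u \<Longrightarrow> g \<in> pol u \<Longrightarrow> f * g \<in> pol u"
  using keys_mult[of f g] by (fastforce simp: pol_def mons_add_iff)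
lemma pol_sum: "(\<And>i. i \<in> A \<Longrightarrow> f i \<in> pol u) \<Longrightarrow> sum f A \<in> pol u"
  by (induction A rule: infinite_finite_induct) (auto intro: pol_add)
lemma pol_power: "f \<in> pol u \<Longrightarrow> f ^ n \<in> pol u"
  by (induction n) (auto intro: pol_mult)
lemmas pol_intros = pol_add pol_uminus pol_diff pol_mult pol_sum pol_single pol_power

text \<open>The ideal property in terms of the type's own \<open>+\<close> and \<open>*\<close>, so
  that ordinary ring arithmetic applies. Closure under negation comes from multiplying by
  \<open>- 1\<close>.\<close>

definition idl :: "nat \<Rightarrow> 'k::field mpoly set \<Rightarrow> bool" where
  "idl s I \<longleftrightarrow> I \<subseteq> pol {..<s} \<and> 0 \<in> I \<and> (\<forall>f\<in>I. \<forall>g\<in>I. f + g \<in> I) \<and>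
     (\<forall>f\<in>I. \<forall>r\<in>pol {..<s}. r * f \<in> I)"

lemma minus_poly_ring: 
  assumes "f \<in> pol {..<s}"
  shows "\<ominus>\<^bsub>poly_ring s\<^esub> f = - f"
proof -
  interpret cring "poly_ring s" by (rule cring_poly_ring)
  have "f \<in> carrier (poly_ring s)" "- f \<in> carrier (poly_ring s)"
    using assms pol_uminus by (auto simp: carrier_poly_ring)
  then show ?thesis by (intro minus_equality) auto
qed

lemma ideal_iff_idl:
  fixes I :: "'a::field mpoly set"
  shows "ideal I (poly_ring s) \<longleftrightarrow> idl s I"
proof
  assume I: "ideal I (poly_ring s)"
  note sub = ideal.axioms(1)[OF I]
  show "idl s I"
    unfolding idl_def
  proof (intro conjI ballI subsetI)
    show "f \<in> pol {..<s}" if "f \<in> I" for f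
      using additive_subgroup.a_Hcarr[OF sub that] by (simp add: carrier_poly_ring)
    show "0 \<in> I" using additive_subgroup.zero_closed[OF sub] by simp
    show "f + g \<in> I" if "f \<in> I" "g \<in> I" for f g
      using additive_subgroup.a_closed[OF sub that] by simp
    show "r * f \<in> I" if "f \<in> I" "r \<in> pol {..<s}" for f r
      using ideal.I_l_closed[OF I that(1), of r] that(2) by (simp add: carrier_poly_ring)
  qed
next
  assume I: "idl s I"
  have pol: "f \<in> pol {..<s}" if "f \<in> I" for f
    using that I unfolding idl_def by blast
  have mult: "r * f \<in> I" if "f \<in> I" "r \<in> pol {..<s}" for f r
    using that I unfolding idl_def by blast
  have ring: "ring (poly_ring s :: 'a mpoly ring)"
    using cring_poly_ring by (rule cring.axioms)
  then have grp: "group (add_monoid (poly_ring s :: 'a mpoly ring))"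
    using abelian_group.a_group ring.is_abelian_group by blast
  show "ideal I (poly_ring s)"
  proof (rule idealI)
    show "ring (poly_ring s :: 'a mpoly ring)" by (rule ring)
    show "subgroup I (add_monoid (poly_ring s))"
    proof (rule group.subgroupI[OF grp])
      show "I \<subseteq> carrier (add_monoid (poly_ring s))" using pol by (auto simp: carrier_poly_ring)
      show "I \<noteq> {}" using I by (auto simp: idl_def)
      show "inv\<^bsub>add_monoid (poly_ring s)\<^esub> a \<in> I" if "a \<in> I" for a
        using mult[OF that pol_uminus[OF pol_one]] minus_poly_ring[OF pol[OF that]]
        unfolding a_inv_def by simp
      show "a \<otimes>\<^bsub>add_monoid (poly_ring s)\<^esub> b \<in> I" if "a \<in> I" "b \<in> I" for a b
        using that I unfolding idl_def by simp
    qed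
    show "x \<otimes>\<^bsub>poly_ring s\<^esub> a \<in> I" "a \<otimes>\<^bsub>poly_ring s\<^esub> x \<in> I"
      if "a \<in> I" "x \<in> carrier (poly_ring s)" for a x
      using mult[of a x] that by (simp_all add: carrier_poly_ring mult.commute)
  qed
qed

lemma
  assumes "idl s I"
  shows idl_pol: "f \<in> I \<Longrightarrow> f \<in> pol {..<s}"
    and idl_zero: "0 \<in> I"
    and idl_add: "f \<in> I \<Longrightarrow> g \<in> I \<Longrightarrow> f + g \<in> I"
    and idl_mult: "f \<in> I \<Longrightarrow> r \<in> pol {..<s} \<Longrightarrow> r * f \<in> I"
    and idl_mult': "f \<in> I \<Longrightarrow> r \<in> pol {..<s} \<Longrightarrow> f * r \<in> I"
  using assms by (auto simp: idl_def mult.commute)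

lemma idl_uminus: "idl s I \<Longrightarrow> f \<in> I \<Longrightarrow> - f \<in> I"
  using idl_mult[of s I f "- 1"] pol_uminus[OF pol_one] by fastforce
lemma idl_diff: "idl s I \<Longrightarrow> f \<in> I \<Longrightarrow> g \<in> I \<Longrightarrow> f - g \<in> I"
  using idl_add[of s I f "- g"] idl_uminus[of s I g] by simp
lemma idl_sum: "idl s I \<Longrightarrow> (\<And>i. i \<in> A \<Longrightarrow> f i \<in> I) \<Longrightarrow> sum f A \<in> I"
  by (induction A rule: infinite_finite_induct) (auto intro: idl_add idl_zero)
lemma idl_mem_cong: "idl s I \<Longrightarrow> f - g \<in> I \<Longrightarrow> f \<in> I \<longleftrightarrow> g \<in> I"
  using idl_add[of s I "f - g" g] idl_diff[of s I f "f - g"] by auto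

definition prm :: "nat \<Rightarrow> 'k::field mpoly set \<Rightarrow> bool" where
  "prm s P \<longleftrightarrow> idl s P \<and> 1 \<notin> P \<and>
     (\<forall>f\<in>pol {..<s}. \<forall>g\<in>pol {..<s}. f * g \<in> P \<longrightarrow> f \<in> P \<or> g \<in> P)"

lemma idl_eq_pol: "idl s I \<Longrightarrow> I = pol {..<s} \<longleftrightarrow> 1 \<in> I"
  using idl_mult'[of s I 1] idl_pol[of s I] by fastforce

lemma primeideal_iff_prm: "primeideal P (poly_ring s) \<longleftrightarrow> prm s P"
proof
  assume "primeideal P (poly_ring s)"
  then interpret primeideal P "poly_ring s" .
  show "prm s P"
    using ideal_axioms I_notcarr I_prime idl_eq_pol[of s P]
    by (auto simp: prm_def ideal_iff_idl carrier_poly_ring)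
next
  assume "prm s P"
  then show "primeideal P (poly_ring s)"
    by (intro primeidealI cring_poly_ring) (auto simp: prm_def ideal_iff_idl carrier_poly_ring idl_eq_pol)
qed

lemma prm_idl: "prm s P \<Longrightarrow> idl s P" by (simp add: prm_def)

lemma prm_cancel:
  "prm s P \<Longrightarrow> f \<in> pol {..<s} \<Longrightarrow> g \<in> pol {..<s} \<Longrightarrow> f * g \<in> P \<Longrightarrow> f \<notin> P \<Longrightarrow> g \<in> P"
  by (auto simp: prm_def)

lemma prm_power: "prm s P \<Longrightarrow> f \<in> pol {..<s} \<Longrightarrow> f ^ n \<in> P \<Longrightarrow> f \<in> P"
proof (induction n)
  case (Suc n)
  then have "f \<in> P \<or> f ^ n \<in> P" by (auto simp: prm_def intro: pol_power)
  then show ?case using Suc by blast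
qed (simp add: prm_def)

section \<open>Coefficients and supports of products with a monomial\<close>

lemma poly_mapping_sum_single: "f = (\<Sum>m\<in>keys f. single m (lookup f m))"
proof (rule poly_mapping_eqI)
  fix k
  have "lookup (\<Sum>m\<in>keys f. single m (lookup f m)) k = (\<Sum>m\<in>keys f. lookup f m when m = k)"
    by (simp add: lookup_sum lookup_single)
  also have "\<dots> = (\<Sum>m\<in>keys f. if m = k then lookup f m else 0)"
    by (intro sum.cong) auto
  also have "\<dots> = lookup f k" by (simp add: sum.delta' in_keys_iff)
  finally show "lookup f k = lookup (\<Sum>m\<in>keys f. single m (lookup f m)) k" ..
qed

lemma lookup_single_mult:
  fixes f :: "'k::field mpoly"
  shows "lookup (single m c * f) (m + n) = c * lookup f n"
proof -
  have "lookup (single m c * f) (m + n) = Sum_any (\<lambda>l. lookup (single m c) l * Sum_any (\<lambda>q. lookup f q when m + n = l + q))"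
    by (rule lookup_mult)
  also have "\<dots> = Sum_any (\<lambda>l. (c * Sum_any (\<lambda>q. lookup f q when m + n = m + q)) when m = l)"
    by (intro Sum_any.cong) (auto simp: lookup_single when_def)
  also have "\<dots> = c * Sum_any (\<lambda>q. lookup f q when n = q)" by simp
  finally show ?thesis by simp
qed

lemma keys_single_mult:
  fixes f :: "'k::field mpoly"
  assumes "c \<noteq> 0"
  shows "keys (single m c * f) = (+) m ` keys f"
proof
  show "keys (single m c * f) \<subseteq> (+) m ` keys f"
    using keys_mult[of "single m c" f] assms by auto
  show "(+) m ` keys f \<subseteq> keys (single m c * f)"
    using assms by (auto simp: in_keys_iff lookup_single_mult)
qed

lemma keys_const_mult:
  fixes f :: "'k::field mpoly"
  shows "keys (single 0 c * f) \<subseteq> keys f"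
  using keys_single_mult[of c 0 f] by (cases "c = 0") auto

lemma lookup_const_mult:
  fixes f :: "'k::field mpoly"
  shows "lookup (single 0 c * f) m = c * lookup f m"
  using lookup_single_mult[of 0 c f m] by simp

section \<open>Degrees\<close>

lemma mon_deg_eq_sum: "finite A \<Longrightarrow> keys m \<subseteq> A \<Longrightarrow> mon_deg m = (\<Sum>i\<in>A. lookup m i)"
  unfolding mon_deg_def by (rule sum.mono_neutral_left) (auto simp: in_keys_iff)

lemma mon_deg_add: "mon_deg (m + n) = mon_deg m + mon_deg n"
proof -
  let ?A = "keys m \<union> keys n"
  have "mon_deg (m + n) = (\<Sum>i\<in>?A. lookup (m + n) i)"
    by (rule mon_deg_eq_sum) (auto simp: keys_mon_add)
  also have "\<dots> = mon_deg m + mon_deg n"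
    by (simp add: lookup_add sum.distrib mon_deg_eq_sum[symmetric])
  finally show ?thesis .
qed

lemma mon_deg_zero [simp]: "mon_deg 0 = 0" by (simp add: mon_deg_def)
lemma mon_deg_single [simp]: "mon_deg (single i j) = j" by (simp add: mon_deg_def)

lemma lookup_le_mon_deg: "lookup m i \<le> mon_deg m"
  by (cases "i \<in> keys m") (auto simp: mon_deg_def in_keys_iff intro: member_le_sum)

lemma finite_mons_bounded: 
  assumes "finite u"
  shows "finite {m \<in> mons u. \<forall>i. lookup m i \<le> n}"
proof -
  let ?F = "{f. (\<forall>i. (i \<in> u \<longrightarrow> f i \<in> {..n}) \<and> (i \<notin> u \<longrightarrow> f i = 0))}"
  have fin: "finite ?F" by (rule finite_set_of_finite_funs[OF assms]) simp
  have sub: "lookup ` {m \<in> mons u. \<forall>i. lookup m i \<le> n} \<subseteq> ?F"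
    by (auto simp: mons_def subset_iff in_keys_iff)
  have inj: "inj_on lookup {m \<in> mons u. \<forall>i. lookup m i \<le> n}"
    by (rule inj_onI) (erule poly_mapping_eq_iff[THEN iffD2])
  show ?thesis by (rule finite_imageD[OF finite_subset[OF sub fin] inj])
qed

lemma finite_mons_deg_le: "finite u \<Longrightarrow> finite {m \<in> mons u. mon_deg m \<le> n}"
  by (rule finite_subset[OF _ finite_mons_bounded[of u n]]) (use lookup_le_mon_deg le_trans in blast)+

lemma finite_mons_deg: "finite u \<Longrightarrow> A \<subseteq> mons u \<Longrightarrow> finite {m \<in> A. mon_deg m = n}"
  by (rule finite_subset[OF _ finite_mons_deg_le[of u n]]) auto

lemma lookup_homog_component: "lookup (homog_component d f) m = (lookup f m when mon_deg m = d)"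
proof -
  have "lookup (homog_component d f) m = 
      (\<Sum>k\<in>{k \<in> keys f. mon_deg k = d}. if k = m then lookup f m else 0)"
    unfolding homog_component_def lookup_sum
    by (intro sum.cong) (auto simp: lookup_single when_def)
  then show ?thesis by (auto simp: in_keys_iff)
qed

lemma keys_homog_component: "keys (homog_component d f) = {m \<in> keys f. mon_deg m = d}"
  by (auto simp: in_keys_iff lookup_homog_component)

lemma homog_component_add: "homog_component d (f + g) = homog_component d f + homog_component d g"
  by (rule poly_mapping_eqI) (simp add: lookup_homog_component lookup_add when_add_distrib)

lemma homog_component_diff: "homog_component d (f - g) = homog_component d f - homog_component d g"
  by (rule poly_mapping_eqI) (simp add: lookup_homog_component lookup_minus when_diff_distrib)

lemma homog_component_pol: "f \<in> pol u \<Longrightarrow> homog_component d f \<in> pol u"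
  by (auto simp: pol_def keys_homog_component)

lemma homog_part_eq: "homog_part s d = {f \<in> pol {..<s}. \<forall>m\<in>keys f. mon_deg m = d}"
  by (simp add: homog_part_def carrier_poly_ring)

section \<open>Leading monomials\<close>

text \<open>A monomial order that compares degrees first, so that reduction by leading monomials
  never raises the degree. Ties are broken by the order on \<open>poly_mapping\<close>.\<close>

definition dlex :: "mon \<Rightarrow> nat \<times> mon" where
  "dlex m = (mon_deg m, m)"

definition lead_mon :: "'k::field mpoly \<Rightarrow> mon" where
  "lead_mon f = snd (Max (dlex ` keys f))"

lemma dlex_inj: "dlex m = dlex n \<longleftrightarrow> m = n"
  by (auto simp: dlex_def)

lemma dlex_add_less: "dlex (m + a) < dlex (m + b) \<longleftrightarrow> dlex a < dlex b"
  by (auto simp: dlex_def mon_deg_add less_prod_def')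

lemma dlex_add_le: "dlex (m + a) \<le> dlex (m + b) \<longleftrightarrow> dlex a \<le> dlex b"
  using dlex_add_less[of m b a] by (meson not_le)

lemma dlex_deg: "dlex m \<le> dlex n \<Longrightarrow> mon_deg m \<le> mon_deg n"
  by (auto simp: dlex_def less_eq_prod_def)

lemma dlex_lead_mon:
  assumes "f \<noteq> 0"
  shows "dlex (lead_mon f) = Max (dlex ` keys f)" and "lead_mon f \<in> keys f"
proof -
  have "dlex ` keys f \<noteq> {}"
    using assms by (metis (no_types) image_is_empty poly_mapping_sum_single sum.empty)
  then have "Max (dlex ` keys f) \<in> dlex ` keys f" by (intro Max_in) auto
  then show "dlex (lead_mon f) = Max (dlex ` keys f)" "lead_mon f \<in> keys f" 
    by (auto simp: lead_mon_def dlex_def)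
qed

lemma lead_mon_ge: "m \<in> keys f \<Longrightarrow> dlex m \<le> dlex (lead_mon f)"
  by (subst dlex_lead_mon) auto

lemma lead_mon_unique: 
  assumes "m \<in> keys f" "\<And>n. n \<in> keys f \<Longrightarrow> dlex n \<le> dlex m"
  shows "lead_mon f = m"
proof -
  have "f \<noteq> 0" using assms by auto
  from dlex_lead_mon(2)[OF this] have "dlex (lead_mon f) \<le> dlex m" by (rule assms)
  with lead_mon_ge[OF assms(1)] show ?thesis by (simp add: dlex_inj[symmetric])
qed

lemma lead_mon_single_mult:
  fixes f :: "'k::field mpoly"
  assumes "f \<noteq> 0"
  shows "lead_mon (single m 1 * f) = m + lead_mon f"
  using dlex_lead_mon(2)[OF assms] lead_mon_ge[of _ f]
  by (intro lead_mon_unique) (auto simp: keys_single_mult dlex_add_le)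

definition lead_mons :: "'k::field mpoly set \<Rightarrow> mon set" where
  "lead_mons J = lead_mon ` (J - {0})"

lemma lead_mons_add: 
  assumes "idl s J" "m \<in> lead_mons J" "n \<in> mons {..<s}"
  shows "n + m \<in> lead_mons J"
proof -
  obtain f where f: "f \<in> J" "f \<noteq> 0" "m = lead_mon f" using assms by (auto simp: lead_mons_def)
  have "single n 1 * f \<in> J" using assms f by (intro idl_mult) (auto intro: pol_single)
  moreover have "single n 1 * f \<noteq> 0" 
    using f(2) keys_single_mult[of 1 n f] dlex_lead_mon(2)[of f] by auto
  ultimately show ?thesis using lead_mon_single_mult[of f n] f by (auto simp: lead_mons_def image_iff intro!: bexI)
qed

lemma lead_mons_mons: "idl s J \<Longrightarrow> lead_mons J \<subseteq> mons {..<s}"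
  using idl_pol dlex_lead_mon(2) by (fastforce simp: lead_mons_def pol_def)

section \<open>Standard monomials and normal forms\<close>

definition std :: "nat \<Rightarrow> 'k::field mpoly set \<Rightarrow> mon set" where
  "std s J = mons {..<s} - lead_mons J"

text \<open>Taking for \<open>A\<close> the monomials of degree \<open>d\<close>, or of degree at most \<open>d\<close>, gives the homogeneous and
  the filtered version.\<close>
lemma normal_form_aux:
  fixes J :: "'k::field mpoly set"
  assumes J: "idl s J" and A: "finite A"
    and good: "\<And>m. m \<in> A \<inter> lead_mons J \<Longrightarrow> \<exists>f\<in>J. f \<noteq> 0 \<and> lead_mon f = m \<and> keys f \<subseteq> A"
    and g: "keys g \<subseteq> A" "\<And>m. m \<in> keys g \<inter> lead_mons J \<Longrightarrow> card {a\<in>A. dlex a < dlex m} < n"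
  shows "\<exists>r. keys r \<subseteq> A - lead_mons J \<and> g - r \<in> J"
  using g
proof (induction n arbitrary: g)
  case 0
  then have "keys g \<inter> lead_mons J = {}" by blast
  then show ?case using 0 idl_zero[OF J] by (intro exI[of _ g]) auto
next
  case (Suc n)
  \<comment> \<open>The rank of a monomial in \<open>A\<close>. The induction bounds the ranks of
    the reducible monomials of \<open>g\<close>; each round removes the one of rank
    \<open>n\<close>, if present.\<close>
  let ?rk = "\<lambda>m. card {a\<in>A. dlex a < dlex m}"
  have mono: "?rk a < ?rk b" if "a \<in> A" "dlex a < dlex b" for a b
  proof (rule psubset_card_mono)
    show "finite {x \<in> A. dlex x < dlex b}" using A by simp
    have "{x \<in> A. dlex x < dlex a} \<subseteq> {x \<in> A. dlex x < dlex b}"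
      using less_trans[OF _ that(2)] by blast
    moreover have "a \<in> {x \<in> A. dlex x < dlex b}" "a \<notin> {x \<in> A. dlex x < dlex a}" using that by simp_all
    ultimately show "{x \<in> A. dlex x < dlex a} \<subset> {x \<in> A. dlex x < dlex b}" by blast
  qed
  have inj: "a = b" if "a \<in> A" "b \<in> A" "?rk a = ?rk b" for a b
  proof (rule linorder_cases[of "dlex a" "dlex b"])
    show "a = b" if "dlex a < dlex b" using mono[OF _ that] \<open>a \<in> A\<close> \<open>?rk a = ?rk b\<close> by simp
    show "a = b" if "dlex b < dlex a" using mono[OF _ that] \<open>b \<in> A\<close> \<open>?rk a = ?rk b\<close> by simp
  qed (simp add: dlex_inj)
  show ?case
  proof (cases "\<exists>m\<in>keys g \<inter> lead_mons J. ?rk m = n")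
    case False
    then show ?thesis using Suc.prems by (intro Suc.IH) (auto simp: less_Suc_eq)
  next
    case True
    then obtain m where m: "m \<in> keys g" "m \<in> lead_mons J" "?rk m = n" by blast
    then obtain f where f: "f \<in> J" "f \<noteq> 0" "lead_mon f = m" "keys f \<subseteq> A" using good Suc.prems by blast
    have fm: "lookup f m \<noteq> 0" using dlex_lead_mon(2)[OF f(2)] f(3) by (simp add: in_keys_iff)
    \<comment> \<open>Subtracting \<open>h\<close> cancels \<open>m\<close>; the other monomials of
      \<open>f\<close> lie below \<open>m\<close> in \<open>dlex\<close> and so have smaller
      rank.\<close>
    define c where "c = lookup g m / lookup f m"
    define h where "h = single 0 c * f"
    have h: "h \<in> J" unfolding h_def using J f by (intro idl_mult) auto
    have kh: "keys h \<subseteq> keys f" unfolding h_def by (rule keys_const_mult)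
    have "lookup (g - h) m = 0" using fm by (simp add: h_def lookup_minus lookup_const_mult c_def)
    then have nm: "m \<notin> keys (g - h)" by (simp add: in_keys_iff)
    have kgh: "keys (g - h) \<subseteq> keys g \<union> keys h" by (auto simp: in_keys_iff lookup_minus)
    have "?rk k < n" if k: "k \<in> keys (g - h) \<inter> lead_mons J" for k
    proof (cases "k \<in> keys f")
      case True
      then have "dlex k \<le> dlex m" using lead_mon_ge f by auto
      moreover have "dlex k \<noteq> dlex m" using k nm by (auto simp: dlex_inj)
      ultimately have "dlex k < dlex m" by simp
      then show ?thesis using mono[of k m] True f m by auto
    next
      case False
      then have "k \<in> keys g" using kh kgh k by blast
      then have "?rk k < Suc n" "k \<in> A" using Suc.prems k by auto
      moreover have "m \<in> A" using m Suc.prems by blast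
      ultimately show ?thesis using inj[of k m] nm k m by (auto simp: less_Suc_eq)
    qed
    then obtain r where r: "keys r \<subseteq> A - lead_mons J" "g - h - r \<in> J"
      using Suc.IH[of "g - h"] kgh kh f Suc.prems by blast
    have "g - r = (g - h - r) + h" by simp
    then have "g - r \<in> J" using idl_add[OF J r(2) h] by simp
    then show ?thesis using r by blast
  qed
qed

lemma normal_form:
  fixes J :: "'k::field mpoly set"
  assumes J: "idl s J" and A: "finite A"
    and good: "\<And>m. m \<in> A \<inter> lead_mons J \<Longrightarrow> \<exists>f\<in>J. f \<noteq> 0 \<and> lead_mon f = m \<and> keys f \<subseteq> A"
    and g: "keys g \<subseteq> A"
  shows "\<exists>r. keys r \<subseteq> A - lead_mons J \<and> g - r \<in> J"
proof (rule normal_form_aux[OF J A good g])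
  show "card {a \<in> A. dlex a < dlex m} < Suc (card A)" for m
    using card_mono[of A "{a \<in> A. dlex a < dlex m}"] A by (auto simp: less_Suc_eq_le)
qed auto

lemma normal_form_deg_le:
  fixes J :: "'k::field mpoly set"
  assumes J: "idl s J" and g: "g \<in> pol {..<s}" "\<And>m. m \<in> keys g \<Longrightarrow> mon_deg m \<le> n"
  shows "\<exists>r. keys r \<subseteq> {m \<in> std s J. mon_deg m \<le> n} \<and> g - r \<in> J"
proof -
  let ?A = "{m \<in> mons {..<s}. mon_deg m \<le> n}"
  have "\<exists>r. keys r \<subseteq> ?A - lead_mons J \<and> g - r \<in> J"
  proof (rule normal_form[OF J])
    show "finite ?A" by (intro finite_mons_deg_le) simp
    show "keys g \<subseteq> ?A" using g by (auto simp: pol_def)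
    fix m assume m: "m \<in> ?A \<inter> lead_mons J"
    then obtain f where f: "f \<in> J" "f \<noteq> 0" "lead_mon f = m" by (auto simp: lead_mons_def)
    have "keys f \<subseteq> ?A"
      using idl_pol[OF J f(1)] lead_mon_ge[of _ f] dlex_deg m f(3) by (fastforce simp: pol_def)
    then show "\<exists>f\<in>J. f \<noteq> 0 \<and> lead_mon f = m \<and> keys f \<subseteq> ?A" using f by blast
  qed
  moreover have "?A - lead_mons J = {m \<in> std s J. mon_deg m \<le> n}" by (auto simp: std_def)
  ultimately show ?thesis by simp
qed

definition graded :: "'k::field mpoly set \<Rightarrow> bool" where
  "graded J \<longleftrightarrow> (\<forall>f\<in>J. \<forall>d. homog_component d f \<in> J)"

text \<open>The component of top degree keeps the leading monomial, because \<open>dlex\<close> puts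
  the degree first.\<close>

lemma lead_mons_homog:
  assumes "graded J" "m \<in> lead_mons J"
  shows "\<exists>f\<in>J. f \<noteq> 0 \<and> lead_mon f = m \<and> (\<forall>k\<in>keys f. mon_deg k = mon_deg m)"
proof -
  obtain f where f: "f \<in> J" "f \<noteq> 0" "lead_mon f = m" using assms by (auto simp: lead_mons_def)
  let ?h = "homog_component (mon_deg m) f"
  have m: "m \<in> keys ?h" using dlex_lead_mon(2)[OF f(2)] f(3) by (simp add: keys_homog_component)
  moreover have "lead_mon ?h = m"
    using m lead_mon_ge[of _ f] f(3) by (intro lead_mon_unique) (auto simp: keys_homog_component)
  moreover have "?h \<in> J" using assms f by (auto simp: graded_def)
  moreover have "?h \<noteq> 0" using m by (metis empty_iff keys_zero)
  ultimately show ?thesis by (intro bexI[of _ ?h]) (auto simp: keys_homog_component)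
qed

lemma normal_form_homog:
  fixes J :: "'k::field mpoly set"
  assumes J: "idl s J" "graded J" and g: "g \<in> homog_part s d"
  shows "\<exists>r. keys r \<subseteq> {m \<in> std s J. mon_deg m = d} \<and> g - r \<in> J"
proof -
  let ?A = "{m \<in> mons {..<s}. mon_deg m = d}"
  have "\<exists>r. keys r \<subseteq> ?A - lead_mons J \<and> g - r \<in> J"
  proof (rule normal_form[OF J(1)])
    show "finite ?A" by (intro finite_mons_deg[of "{..<s}"]) auto
    show "keys g \<subseteq> ?A" using g by (auto simp: pol_def homog_part_eq)
    fix m assume m: "m \<in> ?A \<inter> lead_mons J"
    then obtain f where f: "f \<in> J" "f \<noteq> 0" "lead_mon f = m" "\<forall>k\<in>keys f. mon_deg k = mon_deg m" 
      using lead_mons_homog[OF J(2)] by blast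
    have "keys f \<subseteq> ?A" using idl_pol[OF J(1) f(1)] f(4) m by (auto simp: pol_def)
    then show "\<exists>f\<in>J. f \<noteq> 0 \<and> lead_mon f = m \<and> keys f \<subseteq> ?A" using f by blast
  qed
  moreover have "?A - lead_mons J = {m \<in> std s J. mon_deg m = d}" by (auto simp: std_def)
  ultimately show ?thesis by simp
qed

text \<open>The leading monomial of a nonzero element of \<open>J\<close> is not standard. Together
  with the normal forms this makes the standard monomials a basis of \<open>S/J\<close>.\<close>

lemma std_indep:
  assumes "keys r \<subseteq> std s J" "r \<in> J" 
  shows "r = 0"
proof (rule ccontr)
  assume "r \<noteq> 0"
  then have "lead_mon r \<in> keys r" "lead_mon r \<in> lead_mons J" using assms dlex_lead_mon(2) by (auto simp: lead_mons_def)
  then show False using assms by (auto simp: std_def)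
qed

text \<open>The normal form modulo \<open>J\<close> of an element of \<open>J'\<close> lies in
  \<open>J'\<close> and is standard for \<open>J'\<close> as well, hence is zero. Chains of ideals
  can thus be followed through their leading monomials.\<close>

lemma idl_eqI_lead_mons:
  assumes "idl s J" "idl s J'" "J \<subseteq> J'" "lead_mons J' \<subseteq> lead_mons J"
  shows "J = J'"
proof (intro equalityI subsetI)
  fix g assume g: "g \<in> J'"
  obtain n where n: "\<And>m. m \<in> keys g \<Longrightarrow> mon_deg m \<le> n"
    using finite_keys[of g] by (metis finite_imageI finite_nat_set_iff_bounded_le imageI)
  obtain r where r: "keys r \<subseteq> {m \<in> std s J. mon_deg m \<le> n}" "g - r \<in> J"
    using normal_form_deg_le[OF assms(1) idl_pol[OF assms(2) g] n] by blast
  have "r \<in> J'" using idl_mem_cong[OF assms(2), of g r] g r assms(3) by blast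
  moreover have "keys r \<subseteq> std s J'" using r assms(4) by (auto simp: std_def)
  ultimately have "r = 0" by (intro std_indep)
  then show "g \<in> J" using r by simp
qed (use assms in auto)

section \<open>Noetherianity\<close>

text \<open>Refine the subsequence one coordinate at a time; passing to a subsequence preserves
  monotonicity in the earlier coordinates.\<close>

lemma dickson_subseq:
  fixes f :: "nat \<Rightarrow> nat \<Rightarrow> nat"
  shows "\<exists>r::nat \<Rightarrow> nat. strict_mono r \<and> (\<forall>k<s. \<forall>i j. i \<le> j \<longrightarrow> f (r i) k \<le> f (r j) k)"
proof (induction s)
  case 0
  show ?case by (intro exI[of _ id]) (auto simp: strict_mono_def)
next
  case (Suc s)
  then obtain r :: "nat \<Rightarrow> nat" where r: "strict_mono r" "\<And>k i j. k < s \<Longrightarrow> i \<le> j \<Longrightarrow> f (r i) k \<le> f (r j) k" by blast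
  have "\<exists>q::nat \<Rightarrow> nat. strict_mono q \<and> (\<forall>i j. i \<le> j \<longrightarrow> f (r (q i)) s \<le> f (r (q j)) s)"
  proof -
    let ?g = "\<lambda>n. f (r n) s"
    obtain q where q: "strict_mono q" "monoseq (\<lambda>n. ?g (q n))" using seq_monosub[of ?g] by blast
    show ?thesis
    proof (cases "\<forall>i j. i \<le> j \<longrightarrow> ?g (q i) \<le> ?g (q j)")
      case True then show ?thesis using q by blast
    next
      case False
      then have dec: "\<And>i j. i \<le> j \<Longrightarrow> ?g (q j) \<le> ?g (q i)" using q by (auto simp: monoseq_def)
      \<comment> \<open>A decreasing sequence of naturals is constant from the index of its minimum
        on.\<close>
      define N where "N = (ARG_MIN (\<lambda>i. ?g (q i)) i. True)"
      have N: "?g (q N) \<le> ?g (q i)" for i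
        unfolding N_def by (rule arg_min_nat_le) simp
      have "strict_mono (\<lambda>i. q (N + i))" using q by (auto simp: strict_mono_def)
      moreover have "?g (q (N + i)) \<le> ?g (q (N + j))" for i j
        using dec[of N "N + i"] N[of "N + j"] by (meson le_add1 le_trans)
      ultimately show ?thesis by blast
    qed
  qed
  then obtain q :: "nat \<Rightarrow> nat" where q: "strict_mono q" "\<And>i j. i \<le> j \<Longrightarrow> f (r (q i)) s \<le> f (r (q j)) s" by blast
  have "strict_mono (r \<circ> q)" using r q by (simp add: strict_mono_def)
  moreover have "f ((r \<circ> q) i) k \<le> f ((r \<circ> q) j) k" if "k < Suc s" "i \<le> j" for i j k
    using that r(2)[of k "q i" "q j"] q by (auto simp: less_Suc_eq strict_mono_less_eq)
  ultimately show ?case by blast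
qed

lemma dickson:
  fixes m :: "nat \<Rightarrow> mon"
  assumes "\<And>i. m i \<in> mons {..<s}"
  shows "\<exists>i j n. i < j \<and> n \<in> mons {..<s} \<and> m j = n + m i"
proof -
  obtain r :: "nat \<Rightarrow> nat" where r: "strict_mono r" "\<And>k i j. k < s \<Longrightarrow> i \<le> j \<Longrightarrow> lookup (m (r i)) k \<le> lookup (m (r j)) k"
    using dickson_subseq[of s "\<lambda>i. lookup (m i)"] by blast
  have le: "lookup (m (r 0)) k \<le> lookup (m (r 1)) k" for k
  proof (cases "k < s")
    case False
    then have "k \<notin> keys (m (r 0))" using assms[of "r 0"] by (auto simp: mons_def)
    then show ?thesis by (simp add: in_keys_iff)
  qed (use r(2)[of k 0 1] in simp)
  define n where "n = m (r 1) - m (r 0)"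
  have eq: "m (r 1) = n + m (r 0)"
    using le by (intro poly_mapping_eqI) (simp add: n_def lookup_add lookup_minus)
  moreover have "n \<in> mons {..<s}" using assms[of "r 1"] unfolding eq by (simp add: mons_add_iff)
  moreover have "r 0 < r 1" using r(1) by (simp add: strict_mono_def)
  ultimately show ?thesis by blast
qed

text \<open>If the chain kept growing, pick a new monomial at each stage. By Dickson's lemma some
  later one is a multiple of an earlier one and was therefore already present. Both Noetherianity
  and the conic decomposition rest on this.\<close>

lemma upset_stable:
  fixes N :: "nat \<Rightarrow> mon set"
  assumes mons: "\<And>j. N j \<subseteq> mons {..<s}"
    and up: "\<And>j m n. m \<in> N j \<Longrightarrow> n \<in> mons {..<s} \<Longrightarrow> n + m \<in> N j"
    and mono: "\<And>i j. i \<le> j \<Longrightarrow> N i \<subseteq> N j"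
  shows "\<exists>j0. \<forall>j\<ge>j0. N j = N j0"
proof (rule ccontr)
  assume "\<not> ?thesis"
  then have "\<forall>j0. \<exists>j x. j0 \<le> j \<and> x \<in> N j - N j0" using mono by blast
  then obtain h x where h: "\<And>j. j \<le> h j" "\<And>j. x j \<in> N (h j) - N j" by metis
  define q where "q i = (h ^^ i) 0" for i
  have q: "q i \<le> q j" if "i \<le> j" for i j
    by (rule lift_Suc_mono_le[OF _ that]) (simp add: q_def h)
  obtain i j n where ij: "i < j" "n \<in> mons {..<s}" "x (q j) = n + x (q i)"
    using dickson[of "\<lambda>i. x (q i)" s] h(2) mons by blast
  have "x (q i) \<in> N (q (Suc i))" using h(2)[of "q i"] by (simp add: q_def)
  then have "x (q i) \<in> N (q j)" using mono[OF q[of "Suc i" j]] ij by auto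
  then have "x (q j) \<in> N (q j)" using up ij by simp
  then show False using h(2) by blast
qed

text \<open>Without a maximal member there is an infinite strict chain. Its sets of leading
  monomials become constant, and then so do the ideals.\<close>

lemma noetherian:
  assumes "F \<noteq> {}" "\<And>J. J \<in> F \<Longrightarrow> idl s J"
  shows "\<exists>J\<in>F. \<forall>J'\<in>F. J \<subseteq> J' \<longrightarrow> J' = J"
proof (rule ccontr)
  assume "\<not> ?thesis"
  then have "\<forall>J. \<exists>J'. J \<in> F \<longrightarrow> J' \<in> F \<and> J \<subset> J'" by blast
  then obtain h where h: "\<And>J. J \<in> F \<Longrightarrow> h J \<in> F \<and> J \<subset> h J" by metis
  obtain J0 where J0: "J0 \<in> F" using assms by blast
  define q where "q i = (h ^^ i) J0" for i
  have qF: "q i \<in> F" for i by (induction i) (simp_all add: q_def J0 h)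
  have qS: "q i \<subset> q (Suc i)" for i using h[OF qF[of i]] by (simp add: q_def)
  have qm: "q i \<subseteq> q j" if "i \<le> j" for i j
    by (rule lift_Suc_mono_le[OF _ that]) (use qS in blast)
  have "\<exists>j0. \<forall>j\<ge>j0. lead_mons (q j) = lead_mons (q j0)"
  proof (rule upset_stable[where s = s])
    show "lead_mons (q i) \<subseteq> lead_mons (q j)" if "i \<le> j" for i j using qm[OF that] by (auto simp: lead_mons_def)
  qed (use lead_mons_mons lead_mons_add assms(2) qF in blast)+
  then obtain j where "lead_mons (q (Suc j)) = lead_mons (q j)" by (metis le_SucI order_refl)
  then have "q j = q (Suc j)" using idl_eqI_lead_mons[of s "q j" "q (Suc j)"] assms(2) qF qS by blast
  then show False using qS by blast
qed

lemma noetherian_above: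
  assumes "J0 \<in> F" "\<And>J. J \<in> F \<Longrightarrow> idl s J"
  shows "\<exists>J\<in>F. J0 \<subseteq> J \<and> (\<forall>J'\<in>F. J \<subseteq> J' \<longrightarrow> J' = J)"
proof -
  let ?G = "{J \<in> F. J0 \<subseteq> J}"
  have "\<exists>J\<in>?G. \<forall>J'\<in>?G. J \<subseteq> J' \<longrightarrow> J' = J"
  proof (rule noetherian)
    show "?G \<noteq> {}" using assms(1) by blast
    show "idl s J" if "J \<in> ?G" for J using that by (intro assms(2)) simp
  qed
  then obtain J where J: "J \<in> ?G" "\<forall>J'\<in>?G. J \<subseteq> J' \<longrightarrow> J' = J" by (rule bexE)
  have "J' = J" if "J' \<in> F" "J \<subseteq> J'" for J'
    using J that order_trans[of J0 J J'] by simp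
  moreover have "J \<in> F" "J0 \<subseteq> J" using J(1) by simp_all
  ultimately show ?thesis by (intro bexI[of _ J] conjI ballI impI)
qed

section \<open>Adjoining an element, and primes avoiding a multiplicative set\<close>

definition idl_insert :: "nat \<Rightarrow> 'k::field mpoly \<Rightarrow> 'k mpoly set \<Rightarrow> 'k mpoly set" where
  "idl_insert s a J = {x + r * a | x r. x \<in> J \<and> r \<in> pol {..<s}}"

lemma idl_insertI: "x \<in> J \<Longrightarrow> r \<in> pol {..<s} \<Longrightarrow> x + r * a \<in> idl_insert s a J"
  by (auto simp: idl_insert_def)

lemma idl_idl_insert:
  assumes J: "idl s J" and a: "a \<in> pol {..<s}"
  shows "idl s (idl_insert s a J)"
  unfolding idl_def
proof (intro conjI ballI subsetI)
  show "f \<in> pol {..<s}" if "f \<in> idl_insert s a J" for f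
    using that a idl_pol[OF J] by (auto simp: idl_insert_def intro!: pol_intros)
  show "0 \<in> idl_insert s a J" using idl_insertI[OF idl_zero[OF J] pol_zero[of "{..<s}"], of a] by simp
  show "f + g \<in> idl_insert s a J" if "f \<in> idl_insert s a J" "g \<in> idl_insert s a J" for f g
  proof -
    obtain x r y q where "f = x + r * a" "g = y + q * a" "x \<in> J" "y \<in> J" "r \<in> pol {..<s}" "q \<in> pol {..<s}"
      using \<open>f \<in> _\<close> \<open>g \<in> _\<close> by (auto simp: idl_insert_def)
    then show ?thesis using idl_insertI[of "x + y" J "r + q" s a] idl_add[OF J] pol_add[of r _ q]
      by (simp add: algebra_simps)
  qed
  show "q * f \<in> idl_insert s a J" if "f \<in> idl_insert s a J" "q \<in> pol {..<s}" for f q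
  proof -
    obtain x r where "f = x + r * a" "x \<in> J" "r \<in> pol {..<s}"
      using \<open>f \<in> _\<close> by (auto simp: idl_insert_def)
    then show ?thesis using idl_insertI[of "q * x" J "q * r" s a] idl_mult[OF J] pol_mult[of q _ r] that
      by (simp add: algebra_simps)
  qed
qed

lemma idl_insert_super: "idl s J \<Longrightarrow> J \<subseteq> idl_insert s a J"
  using idl_insertI[of _ J 0 s a] by auto

lemma idl_insert_mem: "idl s J \<Longrightarrow> a \<in> idl_insert s a J"
  using idl_insertI[of 0 J 1 s a] idl_zero by auto

lemma genideal_insert:
  assumes J: "idl s J" and a: "a \<in> pol {..<s}"
  shows "Idl\<^bsub>poly_ring s\<^esub> (insert a J) = idl_insert s a J"
proof
  show "Idl\<^bsub>poly_ring s\<^esub> (insert a J) \<subseteq> idl_insert s a J"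
    unfolding genideal_def using idl_idl_insert[OF J a] idl_insert_super[OF J] idl_insert_mem[OF J]
    by (auto simp: ideal_iff_idl)
  show "idl_insert s a J \<subseteq> Idl\<^bsub>poly_ring s\<^esub> (insert a J)"
    unfolding genideal_def idl_insert_def ideal_iff_idl
    by (auto intro!: idl_add idl_mult)
qed

text \<open>An ideal \<open>P\<close> maximal among those missing \<open>T\<close> is prime: if
  \<open>f\<close> and \<open>g\<close> lie outside it, both \<open>(P, f)\<close> and
  \<open>(P, g)\<close> meet \<open>T\<close>, and the product of the two elements would lie in
  \<open>P\<close> if \<open>f * g\<close> did.\<close>

lemma exists_prime_avoiding:
  assumes J: "idl s J" and T: "T \<subseteq> pol {..<s}" "1 \<in> T" "\<And>a b. a \<in> T \<Longrightarrow> b \<in> T \<Longrightarrow> a * b \<in> T"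
    and dis: "J \<inter> T = {}"
  shows "\<exists>P. prm s P \<and> J \<subseteq> P \<and> P \<inter> T = {}"
proof -
  let ?F = "{P. idl s P \<and> P \<inter> T = {}}"
  have "\<exists>P\<in>?F. J \<subseteq> P \<and> (\<forall>P'\<in>?F. P \<subseteq> P' \<longrightarrow> P' = P)"
    by (rule noetherian_above[where s = s]) (simp_all add: J dis)
  then obtain P where P': "P \<in> ?F" "J \<subseteq> P \<and> (\<forall>P'\<in>?F. P \<subseteq> P' \<longrightarrow> P' = P)" by (rule bexE)
  then have P: "idl s P" "P \<inter> T = {}" "J \<subseteq> P" by simp_all
  have max: "P' = P" if "idl s P'" "P' \<inter> T = {}" "P \<subseteq> P'" for P'
    using that P' by simp
  have meet: "\<exists>x\<in>P. \<exists>r\<in>pol {..<s}. x + r * a \<in> T" if a: "a \<in> pol {..<s}" "a \<notin> P" for a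
  proof (rule ccontr)
    assume "\<not> ?thesis"
    then have "idl_insert s a P \<inter> T = {}" by (auto simp: idl_insert_def)
    then have "idl_insert s a P = P" 
      using max[OF idl_idl_insert[OF P(1) a(1)] _ idl_insert_super[OF P(1)]] by simp
    then show False using idl_insert_mem[OF P(1)] a by blast
  qed
  have "prm s P"
    unfolding prm_def
  proof (intro conjI ballI impI P)
    show "1 \<notin> P" using P T by blast
    fix f g assume fg: "f \<in> pol {..<s}" "g \<in> pol {..<s}" "f * g \<in> P"
    show "f \<in> P \<or> g \<in> P"
    proof (rule ccontr)
      assume "\<not> ?thesis"
      then obtain x r y q where xr: "x \<in> P" "r \<in> pol {..<s}" "x + r * f \<in> T" "y \<in> P" "q \<in> pol {..<s}" "y + q * g \<in> T"
        using meet fg by meson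
      have "(x + r * f) * (y + q * g) = (y + q * g) * x + (r * f) * y + (r * q) * (f * g)"
        by (simp add: algebra_simps)
      also have "\<dots> \<in> P"
      proof (intro idl_add[OF P(1)])
        show "(y + q * g) * x \<in> P" using xr T(1) by (intro idl_mult[OF P(1)]) auto
        show "(r * f) * y \<in> P" using xr fg by (intro idl_mult[OF P(1)] pol_mult)
        show "(r * q) * (f * g) \<in> P" by (rule idl_mult[OF P(1) fg(3) pol_mult[OF xr(2,5)]])
      qed
      finally show False using T(3)[OF xr(3,6)] P(2) by blast
    qed
  qed
  then show ?thesis using P by blast
qed

section \<open>Counting monomials\<close>

lemma mon_split:
  fixes m :: mon
  shows "(m - single x (lookup m x)) + single x (lookup m x) = m"
    and "keys (m - single x (lookup m x)) = keys m - {x}"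
proof -
  show "(m - single x (lookup m x)) + single x (lookup m x) = m"
    by (rule poly_mapping_eqI) (auto simp: lookup_add lookup_minus lookup_single when_def)
  show "keys (m - single x (lookup m x)) = keys m - {x}"
    by (auto simp: in_keys_iff lookup_minus lookup_single when_def split: if_splits)
qed

lemma mons_insert: "mons (insert x u) = {b + single x i | b i. b \<in> mons u}"
proof (intro equalityI subsetI)
  fix m assume m: "m \<in> mons (insert x u)"
  then have "m - single x (lookup m x) \<in> mons u" by (auto simp: mons_def mon_split)
  then show "m \<in> {b + single x i | b i. b \<in> mons u}" 
    using mon_split(1)[of m x] by (metis (mono_tags, lifting) mem_Collect_eq)
next
  fix m assume "m \<in> {b + single x i | b i. b \<in> mons u}"
  then show "m \<in> mons (insert x u)" by (auto simp: mons_def keys_mon_add split: if_splits)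
qed

lemma mon_add_single_eq_iff:
  assumes "a \<in> mons u" "b \<in> mons u" "x \<notin> u"
  shows "a + single x i = b + single x j \<longleftrightarrow> a = b \<and> i = j"
proof
  assume eq: "a + single x i = b + single x j"
  have "lookup a x = 0" "lookup b x = 0" using assms by (auto simp: mons_def in_keys_iff)
  then have "i = j" using arg_cong[OF eq, of "\<lambda>m. lookup m x"] by (simp add: lookup_add)
  then show "a = b \<and> i = j" using eq by simp
qed simp

lemma card_mons_insert:
  assumes "finite I" "\<And>i. i \<in> I \<Longrightarrow> finite (B i)" "\<And>i. i \<in> I \<Longrightarrow> B i \<subseteq> mons u" "x \<notin> u"
  shows "card {b + single x i | b i. i \<in> I \<and> b \<in> B i} = (\<Sum>i\<in>I. card (B i))"
proof -
  have "{b + single x i | b i. i \<in> I \<and> b \<in> B i} = (\<lambda>(i, b). b + single x i) ` Sigma I B"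
    by (auto simp: image_iff)
  moreover have "inj_on (\<lambda>(i, b). b + single x i) (Sigma I B)"
  proof (rule inj_onI, clarify)
    fix i b j c assume *: "i \<in> I" "b \<in> B i" "j \<in> I" "c \<in> B j" "b + single x i = c + single x j"
    then show "i = j \<and> b = c"
      using mon_add_single_eq_iff[of b u c x i j] assms(3)[of i] assms(3)[of j] assms(4) by auto
  qed
  ultimately show ?thesis using assms by (simp add: card_image)
qed

lemma mons_empty: "mons {} = {0}"
  by (auto simp: mons_def)

lemma card_mons_box:
  assumes "finite u"
  shows "card {m \<in> mons u. \<forall>i. lookup m i \<le> n} = (n + 1) ^ card u"
  using assms
proof (induction u rule: finite_induct)
  case empty
  have "{m \<in> mons {}. \<forall>i. lookup m i \<le> n} = {0}" by (auto simp: mons_empty)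
  then show ?case by simp
next
  case (insert x u)
  have "{m \<in> mons (insert x u). \<forall>i. lookup m i \<le> n} =
      {b + single x i | b i. i \<in> {..n} \<and> b \<in> {m \<in> mons u. \<forall>i. lookup m i \<le> n}}"
    (is "?L = ?R")
  proof (intro equalityI subsetI)
    fix m assume m: "m \<in> ?L"
    let ?b = "m - single x (lookup m x)"
    have "?b \<in> mons u" using m by (auto simp: mons_def mon_split)
    moreover have "lookup ?b i \<le> n" for i using m by (simp add: lookup_minus le_diff_conv trans_le_add1)
    ultimately show "m \<in> ?R" using mon_split(1)[of m x] m
      by (intro CollectI exI[of _ ?b] exI[of _ "lookup m x"]) auto
  next
    fix m assume "m \<in> ?R"
    then obtain b i where bi: "m = b + single x i" "i \<le> n" "b \<in> mons u" "\<And>i. lookup b i \<le> n" by auto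
    have "x \<notin> keys b" using bi(3) insert.hyps by (auto simp: mons_def)
    then show "m \<in> ?L" using bi
      by (auto simp: mons_insert lookup_add lookup_single when_def in_keys_iff)
  qed
  also have "card \<dots> = (\<Sum>i\<in>{..n}. card {m \<in> mons u. \<forall>i. lookup m i \<le> n})"
    using insert.hyps by (intro card_mons_insert[where u = u] finite_mons_bounded) auto
  finally show ?case using insert by simp
qed

text \<open>Summing over the exponent of a new variable gives a hockey-stick sum. For
  \<open>u = {}\<close> the truncated subtraction yields 1 at \<open>d = 0\<close> and 0 otherwise,
  as it should.\<close>

lemma card_mons_deg:
  assumes "finite u"
  shows "card {m \<in> mons u. mon_deg m = d} = (card u + d - 1) choose d"
  using assms
proof (induction u arbitrary: d rule: finite_induct)
  case empty
  have "{m \<in> mons {}. mon_deg m = d} = (if d = 0 then {0} else {})" by (auto simp: mons_empty)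
  then show ?case by simp
next
  case (insert x u)
  let ?B = "\<lambda>i. {m \<in> mons u. mon_deg m = d - i}"
  have "{m \<in> mons (insert x u). mon_deg m = d} = {b + single x i | b i. i \<in> {..d} \<and> b \<in> ?B i}"
    by (auto simp: mons_insert mon_deg_add) force
  also have "card \<dots> = (\<Sum>i\<in>{..d}. card (?B i))"
    using insert.hyps by (intro card_mons_insert[where u = u] finite_mons_deg[where u = u]) auto
  also have "\<dots> = (\<Sum>i\<in>{..d}. (card u + (d - i) - 1) choose (d - i))"
    using insert.IH by simp
  also have "\<dots> = (\<Sum>i\<in>{..d}. (card u + i - 1) choose i)"
    by (rule sum.reindex_bij_witness[of _ "\<lambda>i. d - i" "\<lambda>i. d - i"]) auto
  also have "\<dots> = (card u + d) choose d"
  proof (cases "card u")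
    case 0
    have "(\<Sum>i\<in>{..d}. (i - 1) choose i) = (\<Sum>i\<in>{..d}. if i = 0 then 1 else 0)"
      by (intro sum.cong) (auto simp: not0_implies_Suc)
    then show ?thesis using 0 by simp
  next
    case (Suc r)
    then show ?thesis using sum_choose_lower[of r d] by simp
  qed
  finally show ?case using insert by simp
qed

text \<open>The binomial coefficient counts monomials of degree \<open>d\<close> in \<open>r\<close>
  variables; the shift \<open>e\<close> will be the degree of the apex of a cone.\<close>

lemma binomial_limit:
  assumes "r \<le> k" "2 \<le> k"
  shows "(\<lambda>d. real ((r + d - 1) choose d) / real (d + e) ^ (k - 1)) \<longlonglongrightarrow> (if r = k then 1 else 0) / fact (k - 1)"
proof (cases "r = 0")
  case True
  have "\<forall>\<^sub>F d in sequentially. real ((r + d - 1) choose d) / real (d + e) ^ (k - 1) = 0"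
    using True by (intro eventually_sequentiallyI[of 1]) simp
  from tendsto_eventually[OF this] show ?thesis using True assms by simp
next
  case False
  then obtain q where q: "r = Suc q" using not0_implies_Suc by blast
  have b: "real ((q + d) choose d) = (\<Prod>i=1..q. (real d + real i) / real i)" for d
  proof (induction q)
    case (Suc q)
    have "Suc q * ((Suc q + d) choose Suc q) = (Suc q + d) * ((q + d) choose q)"
      using Suc_times_binomial_eq[of "q + d" q] by simp
    then have "real (Suc q) * real ((Suc q + d) choose Suc q) = real (Suc q + d) * real ((q + d) choose q)"
      by (metis of_nat_mult)
    then have "real ((Suc q + d) choose Suc q) = real ((q + d) choose q) * ((real d + real (Suc q)) / real (Suc q))"
      by (simp add: field_simps)
    moreover have "(Suc q + d) choose d = (Suc q + d) choose Suc q" "(q + d) choose d = (q + d) choose q"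
      using binomial_symmetric[of d "Suc q + d"] binomial_symmetric[of d "q + d"] by simp_all
    ultimately show ?case using Suc by simp
  qed simp
  \<comment> \<open>Of the \<open>k - 1\<close> factors of the denominator, \<open>q = r - 1\<close>
    are paired with factors of the binomial coefficient; each of the remaining \<open>k - r\<close>
    contributes a factor tending to 0.\<close>
  have eq: "real ((r + d - 1) choose d) / real (d + e) ^ (k - 1) = 
      (\<Prod>i=1..q. (real d + real i) / real (d + e) / real i) * (1 / real (d + e)) ^ (k - r)" for d
  proof -
    have "(\<Prod>i=1..q. (real d + real i) / real (d + e) / real i) = 
        (\<Prod>i=1..q. (real d + real i) / real i * (1 / real (d + e)))"
      by (intro prod.cong) auto
    also have "\<dots> = (\<Prod>i=1..q. (real d + real i) / real i) * (1 / real (d + e)) ^ q"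
      by (subst prod.distrib) simp
    finally have "(\<Prod>i=1..q. (real d + real i) / real (d + e) / real i) * (1 / real (d + e)) ^ (k - r) =
        real ((q + d) choose d) * ((1 / real (d + e)) ^ q * (1 / real (d + e)) ^ (k - r))"
      by (simp add: b)
    also have "(1 / real (d + e)) ^ q * (1 / real (d + e)) ^ (k - r) = (1 / real (d + e)) ^ (k - 1)"
      using assms q by (simp add: power_add[symmetric])
    finally show ?thesis by (simp add: q power_inverse divide_inverse)
  qed
  have lim2: "(\<lambda>d. 1 / real (d + e)) \<longlonglongrightarrow> 0"
    using LIMSEQ_ignore_initial_segment[OF lim_const_over_n[of 1], of e] by simp
  have limi: "(\<lambda>d. (real d + real i) / real (d + e)) \<longlonglongrightarrow> 1" for i
  proof (rule Lim_transform_eventually)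
    show "(\<lambda>d. 1 + (real i - real e) * (1 / real (d + e))) \<longlonglongrightarrow> 1"
      using tendsto_add[OF tendsto_const[of 1] tendsto_mult[OF tendsto_const[of "real i - real e"] lim2]] by simp
    show "\<forall>\<^sub>F d in sequentially. 1 + (real i - real e) * (1 / real (d + e)) = (real d + real i) / real (d + e)"
      by (intro eventually_sequentiallyI[of 1]) (simp add: field_simps)
  qed
  have lim1: "(\<lambda>d. (real d + real i) / real (d + e) / real i) \<longlonglongrightarrow> 1 / real i" for i
    by (cases "i = 0") (simp, rule tendsto_divide[OF limi tendsto_const], simp)
  have "(\<lambda>d. (\<Prod>i=1..q. (real d + real i) / real (d + e) / real i) * (1 / real (d + e)) ^ (k - r)) 
     \<longlonglongrightarrow> (\<Prod>i=1..q. 1 / real i) * 0 ^ (k - r)"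
    by (intro tendsto_mult tendsto_prod tendsto_power lim1 lim2)
  \<comment> \<open>\<open>0 ^ (k - r)\<close> is 1 exactly for \<open>r = k\<close>, which produces
    the case distinction.\<close>
  moreover have "(\<Prod>i=1..q. 1 / real i) * 0 ^ (k - r) = (if r = k then 1 else 0) / fact (k - 1)"
    using q assms by (auto simp: fact_prod prod_dividef)
  ultimately show ?thesis unfolding eq by simp
qed

section \<open>Conic decompositions\<close>

definition cone :: "mon \<Rightarrow> nat set \<Rightarrow> mon set" where
  "cone m u = (+) m ` mons u"

text \<open>Finite disjoint unions of cones, the combinatorial form of a Stanley decomposition.
  Disjointness makes counts additive.\<close>

inductive conic :: "mon set \<Rightarrow> bool" where
  conic_empty: "conic {}"
| conic_cone: "finite u \<Longrightarrow> conic (cone m u)"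
| conic_Un: "conic A \<Longrightarrow> conic B \<Longrightarrow> A \<inter> B = {} \<Longrightarrow> conic (A \<union> B)"

lemma conic_shift: "conic A \<Longrightarrow> conic ((+) e ` A)"
proof (induction rule: conic.induct)
  case (conic_cone u m)
  have "(+) e ` cone m u = cone (e + m) u" by (auto simp: cone_def image_image add.assoc)
  then show ?case using conic_cone by (simp add: conic.conic_cone)
next
  case (conic_Un A B)
  then show ?case unfolding image_Un by (intro conic.conic_Un) auto
qed (simp add: conic_empty)

text \<open>Multiplying a cone by all powers of a new variable from \<open>j0\<close> on gives a
  cone with one more direction and shifted apex. This handles the constant tail of the
  slices.\<close>

lemma conic_extend:
  assumes "conic A" "A \<subseteq> mons v" "x \<notin> v"
  shows "conic {a + single x j | a j. a \<in> A \<and> j0 \<le> j}"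
  using assms
proof (induction rule: conic.induct)
  case (conic_cone u m)
  have "{a + single x j | a j. a \<in> cone m u \<and> j0 \<le> j} = cone (m + single x j0) (insert x u)"
    (is "?L = ?R")
  proof (intro equalityI subsetI)
    fix y assume "y \<in> ?L"
    then obtain b j where b: "b \<in> mons u" "j0 \<le> j" "y = m + b + single x j" by (auto simp: cone_def)
    have "single x j = single x j0 + single x (j - j0)" using b(2) by (simp add: single_add[symmetric])
    then have "y = (m + single x j0) + (b + single x (j - j0))" using b(3) by (simp add: algebra_simps)
    then show "y \<in> ?R" using b(1) by (auto simp: cone_def mons_insert)
  next
    fix y assume "y \<in> ?R"
    then obtain b i where b: "b \<in> mons u" "y = (m + single x j0) + (b + single x i)"
      by (auto simp: cone_def mons_insert)
    then have "y = (m + b) + single x (j0 + i)" by (simp add: single_add algebra_simps)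
    then show "y \<in> ?L" using b(1) le_add1 unfolding cone_def by blast
  qed
  then show ?case using conic_cone by (simp add: conic.conic_cone)
next
  case (conic_Un A B)
  let ?E = "\<lambda>A. {a + single x j | a j. a \<in> A \<and> j0 \<le> j}"
  have "?E (A \<union> B) = ?E A \<union> ?E B" by blast
  moreover have "?E A \<inter> ?E B = {}"
  proof -
    have "a + single x i \<noteq> b + single x j" if "a \<in> A" "b \<in> B" for a b i j
      using that conic_Un.hyps(3) conic_Un.prems mon_add_single_eq_iff[of a v b x i j] by blast
    then show ?thesis by blast
  qed
  ultimately show ?case using conic_Un by (auto intro: conic.conic_Un)
qed (simp add: conic_empty)

lemma conic_UN:
  fixes n :: nat
  assumes "\<And>i. i < n \<Longrightarrow> conic (A i)" "\<And>i j. i < j \<Longrightarrow> j < n \<Longrightarrow> A i \<inter> A j = {}"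
  shows "conic (\<Union>i<n. A i)"
  using assms
proof (induction n)
  case (Suc n)
  have "conic (A n \<union> (\<Union>i<n. A i))" using Suc by (intro conic_Un) (auto simp: Int_commute)
  then show ?case by (simp add: lessThan_Suc)
qed (simp add: conic_empty)

text \<open>Slice by the exponent of the last variable; by Dickson's lemma the slices are eventually constant.\<close>
lemma conic_downset:
  assumes "A \<subseteq> mons {..<s}" "\<And>m n. n + m \<in> A \<Longrightarrow> m \<in> A"
  shows "conic A"
  using assms
proof (induction s arbitrary: A)
  case 0
  then have "A = {} \<or> A = cone 0 {}" by (auto simp: mons_empty cone_def)
  then show ?case using conic_empty conic_cone[of "{}" 0] by auto
next
  case (Suc s)
  define S where "S j = {a \<in> mons {..<s}. a + single s j \<in> A}" for j
  have dec: "S j \<subseteq> S i" if "i \<le> j" for i j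
  proof
    fix a assume a: "a \<in> S j"
    have "a + single s j = single s (j - i) + (a + single s i)"
      using that by (simp add: add.left_commute single_add[symmetric])
    then show "a \<in> S i" using a Suc.prems(2) by (auto simp: S_def)
  qed
  have down: "m \<in> S j" if "n + m \<in> S j" for m n j
  proof -
    have "n + m + single s j \<in> A" "m \<in> mons {..<s}" using that by (simp_all add: S_def mons_add_iff)
    then show ?thesis using Suc.prems(2)[of n "m + single s j"] by (simp add: S_def add.assoc)
  qed
  have conicS: "conic (S j)" for j
  proof (rule Suc.IH)
    show "S j \<subseteq> mons {..<s}" by (auto simp: S_def)
    show "m \<in> S j" if "n + m \<in> S j" for m n using that by (rule down)
  qed
  \<comment> \<open>The slices are decreasing down-sets; stabilisation applies to their complements,
    which are increasing up-sets.\<close>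
  have "\<exists>j0. \<forall>j\<ge>j0. mons {..<s} - S j = mons {..<s} - S j0"
  proof (rule upset_stable[where s = s])
    show "n + m \<in> mons {..<s} - S j" if "m \<in> mons {..<s} - S j" "n \<in> mons {..<s}" for j m n
      using that down[of n m j] by (auto simp: mons_add_iff)
    show "mons {..<s} - S i \<subseteq> mons {..<s} - S j" if "i \<le> j" for i j
      using dec[OF that] by blast
  qed blast
  then obtain j0 where "\<And>j. j0 \<le> j \<Longrightarrow> mons {..<s} - S j = mons {..<s} - S j0" by blast
  then have j0: "S j = S j0" if "j0 \<le> j" for j using that unfolding S_def by blast
  let ?T = "{a + single s j | a j. a \<in> S j0 \<and> j0 \<le> j}"
  let ?U = "\<Union>j<j0. (+) (single s j) ` S j"
  have eq: "a = b \<and> i = j" if "a \<in> S i'" "b \<in> S j'" "a + single s i = b + single s j" for a b i j i' j'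
    using that mon_add_single_eq_iff[of a "{..<s}" b s i j] by (auto simp: S_def)
  have eqA: "A = ?U \<union> ?T"
  proof (intro equalityI subsetI)
    fix m assume m: "m \<in> A"
    then have "m \<in> mons (insert s {..<s})" using Suc.prems(1) by (auto simp: lessThan_Suc)
    then obtain a j where a: "m = a + single s j" "a \<in> mons {..<s}" by (auto simp: mons_insert)
    then have "a \<in> S j" using m by (simp add: S_def)
    show "m \<in> ?U \<union> ?T"
    proof (cases "j < j0")
      case True
      have "m = single s j + a" using a by (simp add: add.commute)
      then show ?thesis using True \<open>a \<in> S j\<close> by blast
    next
      case False
      then have j: "j0 \<le> j" by simp
      moreover have "a \<in> S j0" using j0[OF j] \<open>a \<in> S j\<close> by simp
      ultimately have "m \<in> ?T" using a(1) by blast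
      then show ?thesis by blast
    qed
  next
    fix m assume "m \<in> ?U \<union> ?T"
    then have "\<exists>a j. m = a + single s j \<and> a \<in> S j"
    proof
      assume "m \<in> ?U"
      then obtain a j where "m = single s j + a" "a \<in> S j" by blast
      then show ?thesis by (metis add.commute)
    next
      assume "m \<in> ?T"
      then show ?thesis using j0 by blast
    qed
    then show "m \<in> A" by (auto simp: S_def)
  qed
  have cU: "conic ?U"
  proof (rule conic_UN)
    show "conic ((+) (single s i) ` S i)" for i by (intro conic_shift conicS)
    show "(+) (single s i) ` S i \<inter> (+) (single s j) ` S j = {}" if "i < j" for i j
      using eq[of _ i _ j i j] that by (auto simp: add.commute)
  qed
  have cT: "conic ?T"
    by (rule conic_extend[OF conicS, of _ "{..<s}"]) (auto simp: S_def)
  have dis: "?U \<inter> ?T = {}"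
  proof -
    have False if "j < j0" "a \<in> S j" "single s j + a = b + single s i" "b \<in> S j0" "j0 \<le> i" for a b i j
      using eq[of a j b j0 j i] that by (auto simp: add.commute)
    then show ?thesis by blast
  qed
  show ?case unfolding eqA by (rule conic_Un[OF cU cT dis])
qed

lemma conic_finite_vars: "conic A \<Longrightarrow> \<exists>u. finite u \<and> A \<subseteq> mons u"
proof (induction rule: conic.induct)
  case conic_empty
  show ?case by blast
next
  case (conic_cone u m)
  have "cone m u \<subseteq> mons (u \<union> keys m)" by (auto simp: cone_def mons_def keys_mon_add)
  then show ?case using conic_cone by (meson finite_UnI finite_keys)
next
  case (conic_Un A B)
  then obtain u v where "finite u" "A \<subseteq> mons u" "finite v" "B \<subseteq> mons v" by blast
  then have "A \<union> B \<subseteq> mons (u \<union> v)" "finite (u \<union> v)" using mons_mono[of u "u \<union> v"] mons_mono[of v "u \<union> v"] by auto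
  then show ?case by blast
qed

section \<open>Counting the monomials of a conic set by degree\<close>

definition mon_count :: "mon set \<Rightarrow> nat \<Rightarrow> nat" where
  "mon_count A d = card {m \<in> A. mon_deg m = d}"

lemma mon_count_Un:
  assumes "conic A" "conic B" "A \<inter> B = {}"
  shows "mon_count (A \<union> B) d = mon_count A d + mon_count B d"
proof -
  have "finite {m \<in> A. mon_deg m = d}" "finite {m \<in> B. mon_deg m = d}"
    using assms(1,2) conic_finite_vars finite_mons_deg by meson+
  moreover have "{m \<in> A \<union> B. mon_deg m = d} = {m \<in> A. mon_deg m = d} \<union> {m \<in> B. mon_deg m = d}" by blast
  moreover have "{m \<in> A. mon_deg m = d} \<inter> {m \<in> B. mon_deg m = d} = {}" using assms by blast
  ultimately show ?thesis by (simp add: mon_count_def card_Un_disjoint)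
qed

lemma mon_count_cone:
  assumes "finite u"
  shows "mon_count (cone m u) (d + mon_deg m) = (card u + d - 1) choose d"
proof -
  have "{x \<in> cone m u. mon_deg x = d + mon_deg m} = (+) m ` {x \<in> mons u. mon_deg x = d}"
    by (auto simp: cone_def mon_deg_add)
  moreover have "inj_on ((+) m) {x \<in> mons u. mon_deg x = d}" by (auto intro: inj_onI)
  ultimately show ?thesis by (simp add: mon_count_def card_image card_mons_deg[OF assms])
qed

text \<open>The bound is imposed on every cone inside \<open>A\<close>, so it passes to both parts
  of a disjoint union. A cone with \<open>k\<close> directions contributes
  \<open>1 / fact (k - 1)\<close> to the limit, a smaller one contributes 0.\<close>

lemma conic_mon_count_limit:
  assumes "conic A" "2 \<le> k" "\<And>m u. finite u \<Longrightarrow> cone m u \<subseteq> A \<Longrightarrow> card u \<le> k"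
  shows "\<exists>n::nat. (\<lambda>d. real (mon_count A d) / real d ^ (k - 1)) \<longlonglongrightarrow> real n / fact (k - 1)"
  using assms(1,3)
proof (induction rule: conic.induct)
  case conic_empty
  show ?case by (rule exI[of _ 0]) (simp add: mon_count_def)
next
  case (conic_cone u m)
  then have "card u \<le> k" by blast
  from binomial_limit[OF this assms(2), of "mon_deg m"]
  have "(\<lambda>d. real (mon_count (cone m u) (d + mon_deg m)) / real (d + mon_deg m) ^ (k - 1)) 
      \<longlonglongrightarrow> real (if card u = k then 1 else 0) / fact (k - 1)"
    by (simp add: mon_count_cone[OF conic_cone.hyps] split: if_splits)
  from LIMSEQ_offset[OF this] show ?case by blast
next
  case (conic_Un A B)
  from conic_Un.IH(1) obtain a :: nat where a: "(\<lambda>d. real (mon_count A d) / real d ^ (k - 1)) \<longlonglongrightarrow> real a / fact (k - 1)"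
    using conic_Un.prems by blast
  from conic_Un.IH(2) obtain b :: nat where b: "(\<lambda>d. real (mon_count B d) / real d ^ (k - 1)) \<longlonglongrightarrow> real b / fact (k - 1)"
    using conic_Un.prems by blast
  show ?case using tendsto_add[OF a b] mon_count_Un[OF conic_Un.hyps]
    by (intro exI[of _ "a + b"]) (simp add: add_divide_distrib)
qed

text \<open>Growth of order \<open>n^(k-1)\<close>. The factor \<open>n + 1\<close> on the left
  avoids the exponent \<open>k - 1\<close>, so that \<open>k = 0\<close>, where \<open>A\<close>
  contains no cone, is treated uniformly.\<close>

lemma conic_card_bound:
  assumes "conic A" "\<And>m u. finite u \<Longrightarrow> cone m u \<subseteq> A \<Longrightarrow> card u < k"
  shows "\<exists>c. \<forall>n. card {m \<in> A. mon_deg m \<le> n} * (n + 1) \<le> c * (n + 1) ^ k"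
  using assms
proof (induction rule: conic.induct)
  case conic_empty
  show ?case by simp
next
  case (conic_cone u m)
  have k: "Suc (card u) \<le> k" using conic_cone.prems[OF conic_cone.hyps subset_refl] by simp
  have "card {x \<in> cone m u. mon_deg x \<le> n} * (n + 1) \<le> 1 * (n + 1) ^ k" for n
  proof -
    have "{x \<in> cone m u. mon_deg x \<le> n} \<subseteq> (+) m ` {b \<in> mons u. \<forall>i. lookup b i \<le> n}"
    proof
      fix x assume "x \<in> {x \<in> cone m u. mon_deg x \<le> n}"
      then obtain b where b: "x = m + b" "b \<in> mons u" "mon_deg b \<le> n" by (auto simp: cone_def mon_deg_add)
      then have "lookup b i \<le> n" for i using lookup_le_mon_deg[of b i] by simp
      then show "x \<in> (+) m ` {b \<in> mons u. \<forall>i. lookup b i \<le> n}" using b by blast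
    qed
    then have "card {x \<in> cone m u. mon_deg x \<le> n} \<le> card {b \<in> mons u. \<forall>i. lookup b i \<le> n}"
      using finite_mons_bounded[OF conic_cone.hyps, of n] by (rule surj_card_le[rotated])
    then have "card {x \<in> cone m u. mon_deg x \<le> n} * (n + 1) \<le> (n + 1) ^ card u * (n + 1)"
      unfolding card_mons_box[OF conic_cone.hyps] by (rule mult_le_mono1)
    also have "\<dots> = (n + 1) ^ Suc (card u)" by simp
    also have "\<dots> \<le> (n + 1) ^ k" using k by (intro power_increasing) auto
    finally show ?thesis by simp
  qed
  then show ?case by blast
next
  case (conic_Un A B)
  obtain a where a: "\<And>n. card {m \<in> A. mon_deg m \<le> n} * (n + 1) \<le> a * (n + 1) ^ k"
    using conic_Un.IH(1) conic_Un.prems by blast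
  obtain b where b: "\<And>n. card {m \<in> B. mon_deg m \<le> n} * (n + 1) \<le> b * (n + 1) ^ k"
    using conic_Un.IH(2) conic_Un.prems by blast
  have "card {m \<in> A \<union> B. mon_deg m \<le> n} * (n + 1) \<le> (a + b) * (n + 1) ^ k" for n
  proof -
    have "{m \<in> A \<union> B. mon_deg m \<le> n} = {m \<in> A. mon_deg m \<le> n} \<union> {m \<in> B. mon_deg m \<le> n}" by blast
    then have "card {m \<in> A \<union> B. mon_deg m \<le> n} \<le> card {m \<in> A. mon_deg m \<le> n} + card {m \<in> B. mon_deg m \<le> n}"
      using card_Un_le[of "{m \<in> A. mon_deg m \<le> n}" "{m \<in> B. mon_deg m \<le> n}"] by simp
    from mult_le_mono1[OF this, of "n + 1"] show ?thesis
      using add_mono[OF a[of n] b[of n]] by (simp only: add_mult_distrib)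
  qed
  then show ?case by blast
qed

section \<open>Linear algebra\<close>

text \<open>Induction on the equations: one with a nonzero coefficient eliminates an unknown
  \<open>x0\<close>, and the unknowns still outnumber the equations.\<close>

lemma homogeneous_system:
  fixes M :: "'a \<Rightarrow> 'b \<Rightarrow> 'k::field"
  assumes "finite Y" "finite X" "card Y < card X"
  shows "\<exists>c. (\<exists>x\<in>X. c x \<noteq> 0) \<and> (\<forall>y\<in>Y. (\<Sum>x\<in>X. c x * M x y) = 0)"
  using assms
proof (induction Y arbitrary: X M rule: finite_induct)
  case empty
  then obtain x where "x \<in> X" by fastforce
  then show ?case by (intro exI[of _ "\<lambda>_. 1"]) auto
next
  case (insert y Y)
  show ?case
  proof (cases "\<exists>x0\<in>X. M x0 y \<noteq> 0")
    case False
    have "card Y < card X" using insert by simp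
    then obtain c where "\<exists>x\<in>X. c x \<noteq> 0" "\<forall>y\<in>Y. (\<Sum>x\<in>X. c x * M x y) = 0"
      using insert.IH[of X M] insert.prems by blast
    then show ?thesis using False by (intro exI[of _ c]) auto
  next
    case True
    then obtain x0 where x0: "x0 \<in> X" "M x0 y \<noteq> 0" by blast
    define N where "N x z = M x z - M x y / M x0 y * M x0 z" for x z
    have "card Y < card (X - {x0})" using insert x0 by simp
    then obtain c where c: "\<exists>x\<in>X - {x0}. c x \<noteq> 0" "\<And>z. z \<in> Y \<Longrightarrow> (\<Sum>x\<in>X - {x0}. c x * N x z) = 0"
      using insert.IH[of "X - {x0}" N] insert.prems by auto
    \<comment> \<open>The value that equation \<open>y\<close> forces on the eliminated
      unknown.\<close>
    define c0 where "c0 = - (\<Sum>x\<in>X - {x0}. c x * (M x y / M x0 y))"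
    define c' where "c' = c(x0 := c0)"
    have sum: "(\<Sum>x\<in>X. c' x * M x z) = (\<Sum>x\<in>X - {x0}. c x * N x z)" for z
    proof -
      have "(\<Sum>x\<in>X. c' x * M x z) = c0 * M x0 z + (\<Sum>x\<in>X - {x0}. c' x * M x z)"
        using x0 insert.prems by (simp add: sum.remove c'_def)
      also have "(\<Sum>x\<in>X - {x0}. c' x * M x z) = (\<Sum>x\<in>X - {x0}. c x * M x z)"
        by (intro sum.cong) (auto simp: c'_def)
      also have "c0 * M x0 z + \<dots> = (\<Sum>x\<in>X - {x0}. c x * N x z)"
        by (simp add: c0_def N_def sum_distrib_right right_diff_distrib sum_subtractf mult.assoc)
      finally show ?thesis .
    qed
    have "N x y = 0" for x using x0 by (simp add: N_def)
    then have "\<forall>z\<in>insert y Y. (\<Sum>x\<in>X. c' x * M x z) = 0" using c(2) by (auto simp: sum)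
    moreover have "\<exists>x\<in>X. c' x \<noteq> 0" using c(1) by (auto simp: c'_def)
    ultimately show ?thesis by blast
  qed
qed

text \<open>Modulo \<open>J\<close> all \<open>F x\<close> lie in a space spanned by fewer than
  \<open>card X\<close> monomials. This is how counts of standard monomials are turned into elements
  of \<open>J\<close>.\<close>

lemma linear_dependence:
  fixes F :: "'a \<Rightarrow> 'k::field mpoly"
  assumes J: "idl s J" and X: "finite X" and B: "finite B" "card B < card X"
    and r: "\<And>x. x \<in> X \<Longrightarrow> F x - r x \<in> J" "\<And>x. x \<in> X \<Longrightarrow> keys (r x) \<subseteq> B"
  shows "\<exists>c. (\<exists>x\<in>X. c x \<noteq> 0) \<and> (\<Sum>x\<in>X. single 0 (c x) * F x) \<in> J"
proof -
  obtain c where c: "\<exists>x\<in>X. c x \<noteq> 0" "\<And>m. m \<in> B \<Longrightarrow> (\<Sum>x\<in>X. c x * lookup (r x) m) = 0"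
    using homogeneous_system[OF B(1) X B(2), of "\<lambda>x. lookup (r x)"] by blast
  have zero: "(\<Sum>x\<in>X. single 0 (c x) * r x) = 0"
  proof (rule poly_mapping_eqI)
    fix m
    have "lookup (\<Sum>x\<in>X. single 0 (c x) * r x) m = (\<Sum>x\<in>X. c x * lookup (r x) m)"
      by (simp add: lookup_sum lookup_const_mult)
    also have "\<dots> = 0"
    proof (cases "m \<in> B")
      case False
      then have "lookup (r x) m = 0" if "x \<in> X" for x using r(2)[OF that] by (auto simp: in_keys_iff)
      then show ?thesis by simp
    qed (rule c)
    finally show "lookup (\<Sum>x\<in>X. single 0 (c x) * r x) m = lookup 0 m" by simp
  qed
  have "(\<Sum>x\<in>X. single 0 (c x) * F x) = (\<Sum>x\<in>X. single 0 (c x) * (F x - r x))"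
    using zero by (simp add: right_diff_distrib sum_subtractf)
  also have "\<dots> \<in> J" using r(1) by (intro idl_sum[OF J] idl_mult[OF J]) auto
  finally show ?thesis using c(1) by blast
qed

section \<open>Independent sets of variables\<close>

text \<open>Equivalently, \<open>K[u]\<close> embeds in \<open>S/J\<close>.\<close>

definition indep :: "nat \<Rightarrow> 'k::field mpoly set \<Rightarrow> nat set \<Rightarrow> bool" where
  "indep s J u \<longleftrightarrow> u \<subseteq> {..<s} \<and> pol u \<inter> J \<subseteq> {0}"

text \<open>Meaningful for proper \<open>J\<close> only: then \<open>{}\<close> is independent,
  whereas modulo the whole ring no set is. For proper graded \<open>J\<close> it will turn out to be
  the Krull dimension of the quotient.\<close>

definition indep_dim :: "nat \<Rightarrow> 'k::field mpoly set \<Rightarrow> nat" where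
  "indep_dim s J = Max (card ` {u. indep s J u})"

lemma indepD: "indep s J u \<Longrightarrow> f \<in> pol u \<Longrightarrow> f \<in> J \<Longrightarrow> f = 0"
  by (auto simp: indep_def)

lemma indep_finite: "indep s J u \<Longrightarrow> finite u"
  by (auto simp: indep_def intro: finite_subset)

lemma indep_antimono: "J \<subseteq> J' \<Longrightarrow> indep s J' u \<Longrightarrow> indep s J u"
  by (auto simp: indep_def)

lemma finite_indep: "finite {u. indep s J u}"
  by (rule finite_subset[of _ "Pow {..<s}"]) (auto simp: indep_def)

lemma card_le_indep_dim: "indep s J u \<Longrightarrow> card u \<le> indep_dim s J"
  unfolding indep_dim_def using finite_indep by (intro Max_ge) auto

lemma pol_empty: "f \<in> pol {} \<Longrightarrow> f = single 0 (lookup f 0)"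
  by (rule poly_mapping_eqI) (auto simp: pol_def mons_empty lookup_single when_def in_keys_iff subset_iff)

lemma const_in_idl:
  assumes "idl s J" "1 \<notin> J" "single 0 c \<in> J"
  shows "c = 0"
proof (rule ccontr)
  assume "c \<noteq> 0"
  then have "single 0 (inverse c) * single 0 c = (1 :: 'a mpoly)" by (simp add: mult_single)
  then show False using idl_mult[OF assms(1,3), of "single 0 (inverse c)"] assms(2) by simp
qed

lemma indep_empty:
  assumes "idl s J" "1 \<notin> J"
  shows "indep s J {}"
  unfolding indep_def
proof (intro conjI subsetI)
  fix f assume f: "f \<in> pol {} \<inter> J"
  then have eq: "f = single 0 (lookup f 0)" using pol_empty by blast
  then have "single 0 (lookup f 0) \<in> J" using f by simp
  from const_in_idl[OF assms this] show "f \<in> {0}" using eq by simp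
qed simp

lemma indep_dim_witness:
  assumes "idl s J" "1 \<notin> J"
  obtains u where "indep s J u" "card u = indep_dim s J"
proof -
  have "indep_dim s J \<in> card ` {u. indep s J u}"
    unfolding indep_dim_def using indep_empty[OF assms] finite_indep by (intro Max_in) auto
  then show ?thesis using that by auto
qed

lemma indep_dim_mono:
  assumes "idl s J'" "1 \<notin> J'" "J \<subseteq> J'"
  shows "indep_dim s J' \<le> indep_dim s J"
  using indep_dim_witness[OF assms(1,2)] card_le_indep_dim indep_antimono[OF assms(3)] by metis

lemma indep_dim_le: 
  assumes "idl s J" "1 \<notin> J"
  shows "indep_dim s J \<le> s"
proof -
  obtain u where "indep s J u" "card u = indep_dim s J" using indep_dim_witness[OF assms] .
  then show ?thesis using card_mono[of "{..<s}" u] by (auto simp: indep_def)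
qed

text \<open>The nonzero polynomials in \<open>K[u]\<close> form a multiplicative set that misses
  \<open>J\<close>; a prime avoiding it keeps \<open>u\<close> independent.\<close>

lemma indep_prime:
  assumes J: "idl s J" and u: "indep s J u"
  obtains P where "prm s P" "J \<subseteq> P" "indep s P u"
proof -
  have "\<exists>P. prm s P \<and> J \<subseteq> P \<and> P \<inter> (pol u - {0}) = {}"
  proof (rule exists_prime_avoiding[OF J])
    show "pol u - {0} \<subseteq> pol {..<s}" using pol_mono[of u "{..<s}"] u by (auto simp: indep_def)
    show "J \<inter> (pol u - {0}) = {}" using u by (auto simp: indep_def)
  qed (auto simp: pol_mult)
  then obtain P where P: "prm s P" "J \<subseteq> P" "P \<inter> (pol u - {0}) = {}" by blast
  then have "indep s P u" using u by (auto simp: indep_def)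
  then show ?thesis using that P by blast
qed

lemma conic_std: "idl s J \<Longrightarrow> conic (std s J)"
proof (rule conic_downset)
  assume J: "idl s J"
  show "std s J \<subseteq> mons {..<s}" by (auto simp: std_def)
  show "m \<in> std s J" if "n + m \<in> std s J" for m n
    using that lead_mons_add[OF J, of m n] by (auto simp: std_def mons_add_iff)
qed

text \<open>A nonzero element of \<open>K[u] \<inter> J\<close> has its leading monomial in
  \<open>mons u\<close>; adding \<open>m\<close> gives a monomial of the cone that is not
  standard.\<close>

lemma cone_std_indep:
  assumes J: "idl s J" and cone: "cone m u \<subseteq> std s J"
  shows "indep s J u"
  unfolding indep_def
proof
  have *: "m + a \<in> std s J" if "a \<in> mons u" for a using cone that by (auto simp: cone_def)
  show "u \<subseteq> {..<s}"
  proof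
    fix i assume "i \<in> u"
    then have "m + single i 1 \<in> mons {..<s}" using *[of "single i 1"] by (auto simp: single_mons std_def)
    then show "i \<in> {..<s}" by (auto simp: mons_def keys_mon_add)
  qed
  show "pol u \<inter> J \<subseteq> {0}"
  proof
    fix f assume f: "f \<in> pol u \<inter> J"
    show "f \<in> {0}"
    proof (rule ccontr)
      assume "f \<notin> {0}"
      then have 1: "lead_mon f \<in> lead_mons J" "lead_mon f \<in> mons u" using f dlex_lead_mon(2)[of f] by (auto simp: lead_mons_def pol_def)
      have "m \<in> mons {..<s}" using *[of 0] by (auto simp: std_def)
      then have "m + lead_mon f \<in> lead_mons J" using lead_mons_add[OF J 1(1)] by blast
      then show False using *[OF 1(2)] by (auto simp: std_def)
    qed
  qed
qed

lemma cone_std_card: "idl s J \<Longrightarrow> cone m u \<subseteq> std s J \<Longrightarrow> card u \<le> indep_dim s J"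
  using cone_std_indep card_le_indep_dim by blast

section \<open>Strictly increasing primes have decreasing dimension\<close>

definition deg_le :: "'k::field mpoly \<Rightarrow> nat \<Rightarrow> bool" where
  "deg_le f n \<longleftrightarrow> (\<forall>m\<in>keys f. mon_deg m \<le> n)"

lemma deg_le_mult: "deg_le f a \<Longrightarrow> deg_le g b \<Longrightarrow> deg_le (f * g) (a + b)"
  using keys_mult[of f g] by (fastforce simp: deg_le_def mon_deg_add intro: add_mono)

lemma deg_le_power: "deg_le f a \<Longrightarrow> deg_le (f ^ n) (n * a)"
proof (induction n)
  case 0 then show ?case by (simp add: deg_le_def)
next
  case (Suc n) then show ?case using deg_le_mult[of f a "f ^ n" "n * a"] by simp
qed

lemma deg_le_exists: "\<exists>n. deg_le f n"
  unfolding deg_le_def using finite_keys[of f] by (metis finite_imageI finite_nat_set_iff_bounded_le imageI)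

lemma mon_deg_box:
  assumes "finite u" "m \<in> mons u" "\<And>i. lookup m i \<le> d"
  shows "mon_deg m \<le> card u * d"
  using sum_bounded_above[of u "lookup m" d] mon_deg_eq_sum[of u m] assms by (simp add: mons_def)

lemma std_card_bound:
  assumes J: "idl s J" and k: "\<And>u. indep s J u \<Longrightarrow> card u < k"
  shows "\<exists>c. \<forall>n. card {m \<in> std s J. mon_deg m \<le> n} * (n + 1) \<le> c * (n + 1) ^ k"
  using conic_card_bound[OF conic_std[OF J], of k] cone_std_indep[OF J] k by blast

text \<open>Products of monomials in \<open>u\<close> with powers of \<open>f\<close> grow in number
  with exponent \<open>card u + 1\<close>, while their residues modulo \<open>P\<close> lie in
  spaces growing with exponent at most \<open>card u\<close>. The coefficients \<open>A i\<close>
  are not all zero as polynomials; they may all vanish modulo \<open>P\<close>.\<close>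

lemma algebraic_relation:
  assumes P: "prm s P" and u: "u \<subseteq> {..<s}" "indep_dim s P \<le> card u" and f: "f \<in> pol {..<s}"
  shows "\<exists>d A. (\<forall>i\<le>d. A i \<in> pol u) \<and> (\<exists>i\<le>d. A i \<noteq> 0) \<and> (\<Sum>i\<le>d. A i * f ^ i) \<in> P"
proof -
  note J = prm_idl[OF P]
  define D where "D = card u"
  have fin: "finite u" using u(1) finite_subset by blast
  obtain e where e: "deg_le f e" using deg_le_exists by blast
  have "\<exists>c. \<forall>n. card {m \<in> std s P. mon_deg m \<le> n} * (n + 1) \<le> c * (n + 1) ^ Suc D"
    by (rule std_card_bound[OF J]) (use card_le_indep_dim u(2) in \<open>fastforce simp: D_def\<close>)
  then obtain c where c: "\<And>n. card {m \<in> std s P. mon_deg m \<le> n} * (n + 1) \<le> c * (n + 1) ^ Suc D" by blast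
  \<comment> \<open>\<open>n\<close> bounds the degrees of the products \<open>m * f ^ i\<close>
    with \<open>(m, i)\<close> in \<open>X\<close>. Since
    \<open>n + 1 \<le> (D + e + 1) * (d + 1)\<close>, this \<open>d\<close> leaves at most
    \<open>d * (d + 1) ^ D\<close> standard monomials up to degree \<open>n\<close>, fewer than the
    \<open>(d + 1) ^ Suc D\<close> elements of \<open>X\<close>.\<close>
  define d where "d = c * (D + e + 1) ^ D"
  define n where "n = D * d + e * d"
  define X where "X = {m \<in> mons u. \<forall>i. lookup m i \<le> d} \<times> {..d}"
  define B where "B = {m \<in> std s P. mon_deg m \<le> n}"
  define F where "F = (\<lambda>(m, i). single m 1 * f ^ i)"
  have finX: "finite X" using finite_mons_bounded[OF fin, of d] by (simp add: X_def)
  have cardX: "card X = (d + 1) ^ Suc D"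
    by (simp add: X_def card_cartesian_product card_mons_box[OF fin, of d, simplified] D_def)
  have finB: "finite B" unfolding B_def
    by (rule finite_subset[OF _ finite_mons_deg_le[of "{..<s}" n]]) (auto simp: std_def)
  have "card B * (n + 1) \<le> (c * (n + 1) ^ D) * (n + 1)"
    using c[of n] by (simp add: B_def algebra_simps)
  then have "card B \<le> c * (n + 1) ^ D" by (simp only: mult_le_cancel2)
  also have "\<dots> \<le> c * ((D + e + 1) * (d + 1)) ^ D"
    by (intro mult_left_mono power_mono) (auto simp: n_def algebra_simps)
  also have "\<dots> = d * (d + 1) ^ D" unfolding power_mult_distrib d_def by (simp only: mult.assoc)
  also have "\<dots> < card X" by (simp add: cardX)
  finally have less: "card B < card X" .
  have polF: "F x \<in> pol {..<s}" if "x \<in> X" for x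
    using that f pol_mono[OF u(1)] mons_mono[OF u(1)] by (auto simp: F_def X_def intro!: pol_mult pol_power pol_single)
  have degF: "mon_deg k \<le> n" if "x \<in> X" "k \<in> keys (F x)" for x k
  proof -
    obtain m i where x: "x = (m, i)" "m \<in> mons u" "\<And>j. lookup m j \<le> d" "i \<le> d" 
      using \<open>x \<in> X\<close> by (auto simp: X_def)
    have "deg_le (single m 1 :: 'a mpoly) (D * d)" 
      using mon_deg_box[OF fin x(2,3)] by (simp add: deg_le_def D_def)
    then have "deg_le (F x) (D * d + i * e)"
      using deg_le_mult[OF _ deg_le_power[OF e, of i]] by (simp add: F_def x)
    then show ?thesis using that(2) x(4) mult_le_mono1[OF x(4), of e] 
      by (fastforce simp: deg_le_def n_def mult.commute intro: le_trans)
  qed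
  have "\<forall>x\<in>X. \<exists>r. keys r \<subseteq> B \<and> F x - r \<in> P"
    using normal_form_deg_le[OF J polF degF] by (auto simp: B_def)
  then obtain r where r: "\<And>x. x \<in> X \<Longrightarrow> F x - r x \<in> P" "\<And>x. x \<in> X \<Longrightarrow> keys (r x) \<subseteq> B" by metis
  have "\<exists>a. (\<exists>x\<in>X. a x \<noteq> 0) \<and> (\<Sum>x\<in>X. single 0 (a x) * F x) \<in> P"
    by (rule linear_dependence[OF J finX finB less]) (fact r)+
  then obtain a where a: "\<exists>x\<in>X. a x \<noteq> 0" "(\<Sum>x\<in>X. single 0 (a x) * F x) \<in> P" by blast
  define Y where "Y = {m \<in> mons u. \<forall>i. lookup m i \<le> d}"
  have finY: "finite Y" unfolding Y_def by (rule finite_mons_bounded[OF fin])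
  define A where "A i = (\<Sum>m\<in>Y. single m (a (m, i)))" for i
  have lookupA: "lookup (A i) m = a (m, i)" if "m \<in> Y" for i m
    using that finY by (simp add: A_def lookup_sum lookup_single when_def)
  have "(\<Sum>x\<in>X. single 0 (a x) * F x) = (\<Sum>m\<in>Y. \<Sum>i\<le>d. single m (a (m, i)) * f ^ i)"
    unfolding X_def Y_def[symmetric] F_def
    by (simp add: sum.cartesian_product mult.assoc[symmetric] mult_single case_prod_beta)
  also have "\<dots> = (\<Sum>i\<le>d. A i * f ^ i)"
    by (subst sum.swap) (simp add: A_def sum_distrib_right)
  finally have "(\<Sum>i\<le>d. A i * f ^ i) \<in> P" using a(2) by simp
  moreover have "A i \<in> pol u" for i unfolding A_def by (intro pol_sum pol_single) (auto simp: Y_def)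
  moreover have "\<exists>i\<le>d. A i \<noteq> 0"
  proof -
    obtain m i where "m \<in> Y" "i \<le> d" "a (m, i) \<noteq> 0" using a(1) by (auto simp: X_def Y_def)
    then show ?thesis using lookupA[of m i] by (intro exI[of _ i]) auto
  qed
  ultimately show ?thesis by blast
qed

text \<open>The lowest coefficient of an algebraic relation modulo \<open>P\<close> for \<open>f \<in> Q - P\<close> lies in \<open>Q\<close>.\<close>
lemma indep_dim_less:
  assumes P: "prm s P" and Q: "prm s Q" and PQ: "P \<subset> Q"
  shows "indep_dim s Q < indep_dim s P"
proof (rule ccontr)
  assume neg: "\<not> ?thesis"
  obtain u where u: "indep s Q u" "card u = indep_dim s Q"
    using indep_dim_witness[of s Q] Q by (auto simp: prm_def)
  obtain f where f: "f \<in> Q" "f \<notin> P" using PQ by blast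
  have fp: "f \<in> pol {..<s}" using idl_pol[OF prm_idl[OF Q] f(1)] .
  have us: "u \<subseteq> {..<s}" using u(1) by (simp add: indep_def)
  have "indep_dim s P \<le> card u" using u neg by simp
  from algebraic_relation[OF P us this fp]
  obtain d A where A: "\<And>i. i \<le> d \<Longrightarrow> A i \<in> pol u" "\<exists>i\<le>d. A i \<noteq> 0" "(\<Sum>i\<le>d. A i * f ^ i) \<in> P" by blast
  define i0 where "i0 = (LEAST i. i \<le> d \<and> A i \<noteq> 0)"
  have i0: "i0 \<le> d" "A i0 \<noteq> 0" using LeastI_ex[OF A(2)] by (auto simp: i0_def)
  have less: "A i = 0" if "i < i0" for i using not_less_Least[of i "\<lambda>i. i \<le> d \<and> A i \<noteq> 0"] that i0 
    by (auto simp: i0_def)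
  have Ap: "A i \<in> pol {..<s}" if "i \<le> d" for i using A(1)[OF that] pol_mono[OF us] by blast
  define h where "h = (\<Sum>i\<in>{Suc i0..d}. A i * f ^ (i - Suc i0))"
  have hp: "h \<in> pol {..<s}" unfolding h_def using Ap fp by (intro pol_sum pol_mult pol_power) auto
  have "(\<Sum>i\<le>d. A i * f ^ i) = (\<Sum>i\<in>{i0..d}. A i * f ^ i)"
    by (rule sum.mono_neutral_right) (use less in auto)
  also have "\<dots> = A i0 * f ^ i0 + (\<Sum>i\<in>{Suc i0..d}. A i * f ^ i)"
    using i0 by (simp add: sum.atLeast_Suc_atMost)
  also have "(\<Sum>i\<in>{Suc i0..d}. A i * f ^ i) = (\<Sum>i\<in>{Suc i0..d}. f ^ i0 * (f * (A i * f ^ (i - Suc i0))))"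
  proof (intro sum.cong refl)
    fix i assume "i \<in> {Suc i0..d}"
    then have "f ^ i = f ^ i0 * (f * f ^ (i - Suc i0))"
      by (metis add_Suc_right atLeastAtMost_iff le_add_diff_inverse plus_1_eq_Suc add.commute power_Suc power_add)
    then show "A i * f ^ i = f ^ i0 * (f * (A i * f ^ (i - Suc i0)))" by (simp add: mult.left_commute)
  qed
  also have "A i0 * f ^ i0 + \<dots> = f ^ i0 * (A i0 + f * h)"
    by (simp add: h_def sum_distrib_left distrib_left mult.commute)
  \<comment> \<open>As \<open>f\<close> is not in the prime \<open>P\<close>, the power
    \<open>f ^ i0\<close> cancels. What remains lies in \<open>Q\<close>, and so does
    \<open>f * h\<close>; hence \<open>A i0\<close> is a nonzero element of
    \<open>K[u] \<inter> Q\<close>.\<close>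
  finally have "f ^ i0 * (A i0 + f * h) \<in> P" using A(3) by simp
  moreover have "f ^ i0 \<notin> P" using prm_power[OF P fp] f(2) by blast
  ultimately have "A i0 + f * h \<in> P"
    using prm_cancel[OF P, of "f ^ i0" "A i0 + f * h"] fp hp Ap[OF i0(1)] by (auto intro: pol_intros)
  then have "A i0 + f * h \<in> Q" using PQ by blast
  moreover have "f * h \<in> Q" using idl_mult'[OF prm_idl[OF Q] f(1) hp] .
  ultimately have "A i0 \<in> Q" using idl_diff[OF prm_idl[OF Q], of "A i0 + f * h" "f * h"] by simp
  then show False using indepD[OF u(1) A(1)[OF i0(1)]] i0(2) by blast
qed

lemma chain_indep_dim:
  assumes "prime_chain (poly_ring s) n C" "k \<le> n"
  shows "indep_dim s (C k) + k \<le> indep_dim s (C 0)"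
  using assms(2)
proof (induction k)
  case (Suc k)
  have "prm s (C k)" "prm s (C (Suc k))" "C k \<subset> C (Suc k)"
    using assms(1) Suc.prems by (auto simp: prime_chain_def primeideal_iff_prm)
  then show ?case using indep_dim_less[of s "C k" "C (Suc k)"] Suc by simp
qed simp

section \<open>Coefficient ideals of a prime\<close>

text \<open>Coefficients of \<open>f\<close> with respect to a splitting \<open>m = \<tau> (\<phi> m) + \<psi> m\<close> of the monomials.
  It covers both the homogeneous components and the coefficients with respect to one variable.\<close>

definition coef :: "(mon \<Rightarrow> nat) \<Rightarrow> (mon \<Rightarrow> mon) \<Rightarrow> nat \<Rightarrow> 'k::field mpoly \<Rightarrow> 'k mpoly" where
  "coef \<phi> \<psi> j f = (\<Sum>m\<in>{m \<in> keys f. \<phi> m = j}. single (\<psi> m) (lookup f m))"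

locale splitting =
  fixes s :: nat and \<phi> :: "mon \<Rightarrow> nat" and \<psi> :: "mon \<Rightarrow> mon" and \<tau> :: "nat \<Rightarrow> mon"
  assumes phi_add: "\<phi> (m + n) = \<phi> m + \<phi> n"
    and psi_add: "\<psi> (m + n) = \<psi> m + \<psi> n"
    and split: "m = \<tau> (\<phi> m) + \<psi> m"
    and tau_mons: "m \<in> mons {..<s} \<Longrightarrow> \<tau> (\<phi> m) \<in> mons {..<s}"
begin

lemma phi_zero: "\<phi> 0 = 0" using phi_add[of 0 0] by simp
lemma psi_zero: "\<psi> 0 = 0" using psi_add[of 0 0] by simp

lemma psi_mons: "m \<in> mons {..<s} \<Longrightarrow> \<psi> m \<in> mons {..<s}"
  using split[of m] by (metis mons_add_iff)

lemma coef_superset: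
  assumes "finite A" "keys f \<subseteq> A"
  shows "coef \<phi> \<psi> j f = (\<Sum>m\<in>A. if \<phi> m = j then single (\<psi> m) (lookup f m) else 0)"
proof -
  have "coef \<phi> \<psi> j f = (\<Sum>m\<in>keys f. if \<phi> m = j then single (\<psi> m) (lookup f m) else 0)"
    by (simp add: coef_def sum.inter_filter)
  also have "\<dots> = (\<Sum>m\<in>A. if \<phi> m = j then single (\<psi> m) (lookup f m) else 0)"
    using assms by (intro sum.mono_neutral_left) (auto simp: in_keys_iff)
  finally show ?thesis .
qed

lemma coef_add: "coef \<phi> \<psi> j (f + g) = coef \<phi> \<psi> j f + coef \<phi> \<psi> j g"
proof -
  let ?A = "keys f \<union> keys g"
  have "coef \<phi> \<psi> j (f + g) = (\<Sum>m\<in>?A. if \<phi> m = j then single (\<psi> m) (lookup (f + g) m) else 0)"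
    using keys_add[of f g] by (intro coef_superset) auto
  also have "\<dots> = (\<Sum>m\<in>?A. (if \<phi> m = j then single (\<psi> m) (lookup f m) else 0) + 
      (if \<phi> m = j then single (\<psi> m) (lookup g m) else 0))"
    by (intro sum.cong) (auto simp: lookup_add single_add)
  also have "\<dots> = coef \<phi> \<psi> j f + coef \<phi> \<psi> j g"
    using coef_superset[of ?A f j] coef_superset[of ?A g j] by (simp add: sum.distrib)
  finally show ?thesis .
qed

lemma coef_zero [simp]: "coef \<phi> \<psi> j 0 = 0" by (simp add: coef_def)

lemma coef_sum: "coef \<phi> \<psi> j (sum F A) = (\<Sum>a\<in>A. coef \<phi> \<psi> j (F a))"
  by (induction A rule: infinite_finite_induct) (auto simp: coef_add)

lemma coef_single: "coef \<phi> \<psi> j (single m a) = (if \<phi> m = j then single (\<psi> m) a else 0)"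
  using coef_superset[of "{m}" "single m a" j] by simp

lemma coef_one: "coef \<phi> \<psi> j 1 = (if j = 0 then 1 else 0)"
  using coef_single[of j 0 1] by (cases "j = 0") (simp_all add: phi_zero psi_zero)

lemma coef_expand: "coef \<phi> \<psi> j f = (\<Sum>m\<in>keys f. coef \<phi> \<psi> j (single m (lookup f m)))"
  using coef_sum[of j "\<lambda>m. single m (lookup f m)" "keys f"] poly_mapping_sum_single[of f] by simp

text \<open>The Cauchy product. Bilinearity reduces it to monomials, where additivity of
  \<open>\<phi>\<close> and \<open>\<psi>\<close> applies.\<close>

lemma coef_mult: "coef \<phi> \<psi> j (f * g) = (\<Sum>i\<le>j. coef \<phi> \<psi> i f * coef \<phi> \<psi> (j - i) g)"
proof -
  let ?f = "\<lambda>m. single m (lookup f m)" and ?g = "\<lambda>m. single m (lookup g m)"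
  have single: "coef \<phi> \<psi> j (?f m * ?g n) = (\<Sum>i\<le>j. coef \<phi> \<psi> i (?f m) * coef \<phi> \<psi> (j - i) (?g n))" for m n
  proof -
    have "(\<Sum>i\<le>j. coef \<phi> \<psi> i (?f m) * coef \<phi> \<psi> (j - i) (?g n)) = 
        (\<Sum>i\<le>j. if i = \<phi> m then (if \<phi> m + \<phi> n = j then single (\<psi> m + \<psi> n) (lookup f m * lookup g n) else 0) else 0)"
      by (intro sum.cong) (auto simp: coef_single mult_single)
    also have "\<dots> = (if \<phi> m + \<phi> n = j then single (\<psi> m + \<psi> n) (lookup f m * lookup g n) else 0)"
      by (simp add: sum.delta)
    also have "\<dots> = coef \<phi> \<psi> j (?f m * ?g n)"
      by (simp add: mult_single coef_single phi_add psi_add)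
    finally show ?thesis ..
  qed
  have "f * g = (\<Sum>m\<in>keys f. \<Sum>n\<in>keys g. ?f m * ?g n)"
    by (simp only: sum_product[symmetric] poly_mapping_sum_single[symmetric])
  then have "coef \<phi> \<psi> j (f * g) = (\<Sum>m\<in>keys f. \<Sum>n\<in>keys g. coef \<phi> \<psi> j (?f m * ?g n))"
    by (simp add: coef_sum)
  also have "\<dots> = (\<Sum>m\<in>keys f. \<Sum>n\<in>keys g. \<Sum>i\<le>j. coef \<phi> \<psi> i (?f m) * coef \<phi> \<psi> (j - i) (?g n))"
    by (simp add: single)
  also have "\<dots> = (\<Sum>m\<in>keys f. \<Sum>i\<le>j. \<Sum>n\<in>keys g. coef \<phi> \<psi> i (?f m) * coef \<phi> \<psi> (j - i) (?g n))"
    by (intro sum.cong refl sum.swap)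
  also have "\<dots> = (\<Sum>i\<le>j. \<Sum>m\<in>keys f. \<Sum>n\<in>keys g. coef \<phi> \<psi> i (?f m) * coef \<phi> \<psi> (j - i) (?g n))"
    by (rule sum.swap)
  also have "\<dots> = (\<Sum>i\<le>j. (\<Sum>m\<in>keys f. coef \<phi> \<psi> i (?f m)) * (\<Sum>n\<in>keys g. coef \<phi> \<psi> (j - i) (?g n)))"
    by (simp add: sum_product)
  also have "\<dots> = (\<Sum>i\<le>j. coef \<phi> \<psi> i f * coef \<phi> \<psi> (j - i) g)"
    by (simp add: coef_expand[symmetric])
  finally show ?thesis .
qed

lemma coef_pol: "f \<in> pol {..<s} \<Longrightarrow> coef \<phi> \<psi> j f \<in> pol {..<s}"
  unfolding coef_def by (intro pol_sum pol_single psi_mons) (auto simp: pol_def)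

lemma reconstruct: "f = (\<Sum>j\<in>\<phi> ` keys f. single (\<tau> j) 1 * coef \<phi> \<psi> j f)"
proof -
  have "f = (\<Sum>m\<in>keys f. single m (lookup f m))" by (rule poly_mapping_sum_single)
  also have "\<dots> = (\<Sum>j\<in>\<phi> ` keys f. \<Sum>m\<in>{m \<in> keys f. \<phi> m = j}. single m (lookup f m))"
    by (rule sum.image_gen) simp
  also have "\<dots> = (\<Sum>j\<in>\<phi> ` keys f. single (\<tau> j) 1 * coef \<phi> \<psi> j f)"
    unfolding coef_def sum_distrib_left mult_single
    by (intro sum.cong refl) (use split in auto)
  finally show ?thesis .
qed

text \<open>For the splitting by degree this is the largest graded ideal inside \<open>P\<close>;
  for the splitting by a variable \<open>y\<close> it is the ideal generated by the elements of
  \<open>P\<close> that are free of \<open>y\<close>.\<close>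

definition coef_ideal :: "'k::field mpoly set \<Rightarrow> 'k mpoly set" where
  "coef_ideal P = {f \<in> pol {..<s}. \<forall>j. coef \<phi> \<psi> j f \<in> P}"

lemma coef_ideal_idl:
  fixes P :: "'k::field mpoly set"
  assumes P: "idl s P"
  shows "idl s (coef_ideal P)"
  unfolding idl_def
proof (intro conjI ballI)
  fix f r :: "'k mpoly" assume f: "f \<in> coef_ideal P" and r: "r \<in> pol {..<s}"
  then have "coef \<phi> \<psi> j (r * f) \<in> P" for j
    unfolding coef_mult by (intro idl_sum[OF P] idl_mult[OF P] coef_pol) (auto simp: coef_ideal_def)
  then show "r * f \<in> coef_ideal P" using f r by (auto simp: coef_ideal_def intro: pol_mult)
qed (auto simp: coef_ideal_def coef_add intro: pol_add idl_add[OF P] idl_zero[OF P])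

text \<open>As in Gauss's lemma: take the lowest coefficients of \<open>f\<close> and
  \<open>g\<close> outside \<open>P\<close>. In the coefficient of \<open>f * g\<close> at the sum
  of their indices every other term lies in \<open>P\<close>.\<close>

lemma coef_ideal_prm:
  fixes P :: "'k::field mpoly set"
  assumes P: "prm s P"
  shows "prm s (coef_ideal P)"
  unfolding prm_def
proof (intro conjI ballI impI)
  note J = prm_idl[OF P]
  show "idl s (coef_ideal P)" by (rule coef_ideal_idl[OF J])
  have "coef \<phi> \<psi> 0 (1 :: 'k mpoly) = 1" by (simp add: coef_one)
  then show "1 \<notin> coef_ideal P" using P by (auto simp: coef_ideal_def prm_def intro!: exI[of _ 0])
  fix f g :: "'k mpoly"
  assume f: "f \<in> pol {..<s}" and g: "g \<in> pol {..<s}" and fg: "f * g \<in> coef_ideal P"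
  show "f \<in> coef_ideal P \<or> g \<in> coef_ideal P"
  proof (rule ccontr)
    assume neg: "\<not> ?thesis"
    define a where "a = (LEAST j. coef \<phi> \<psi> j f \<notin> P)"
    define b where "b = (LEAST j. coef \<phi> \<psi> j g \<notin> P)"
    have ex: "\<exists>j. coef \<phi> \<psi> j f \<notin> P" "\<exists>j. coef \<phi> \<psi> j g \<notin> P"
      using neg f g by (simp_all add: coef_ideal_def)
    have a: "coef \<phi> \<psi> a f \<notin> P" unfolding a_def by (rule LeastI_ex[OF ex(1)])
    have b: "coef \<phi> \<psi> b g \<notin> P" unfolding b_def by (rule LeastI_ex[OF ex(2)])
    have a': "coef \<phi> \<psi> j f \<in> P" if "j < a" for j using not_less_Least[OF that[unfolded a_def]] by simp
    have b': "coef \<phi> \<psi> j g \<in> P" if "j < b" for j using not_less_Least[OF that[unfolded b_def]] by simp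
    let ?t = "\<lambda>i. coef \<phi> \<psi> i f * coef \<phi> \<psi> (a + b - i) g"
    have "?t i \<in> P" if "i \<le> a + b" "i \<noteq> a" for i
    proof (cases "i < a")
      case True
      then show ?thesis using a' g by (intro idl_mult'[OF J] coef_pol)
    next
      case False
      then have "a + b - i < b" using that by simp
      then show ?thesis using b' f by (intro idl_mult[OF J] coef_pol)
    qed
    then have rest: "(\<Sum>i\<in>{..a + b} - {a}. ?t i) \<in> P" by (intro idl_sum[OF J]) auto
    have eq: "coef \<phi> \<psi> (a + b) (f * g) = ?t a + (\<Sum>i\<in>{..a + b} - {a}. ?t i)"
      unfolding coef_mult by (rule sum.remove) auto
    have "coef \<phi> \<psi> (a + b) (f * g) \<in> P" using fg by (simp add: coef_ideal_def)
    from idl_diff[OF J this rest] have "coef \<phi> \<psi> a f * coef \<phi> \<psi> b g \<in> P" by (simp add: eq)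
    then show False using prm_cancel[OF P coef_pol[OF f] coef_pol[OF g]] a b by blast
  qed
qed

lemma coef_ideal_subset:
  assumes P: "idl s P"
  shows "coef_ideal P \<subseteq> P"
proof
  fix f assume f: "f \<in> coef_ideal P"
  have "(\<Sum>j\<in>\<phi> ` keys f. single (\<tau> j) 1 * coef \<phi> \<psi> j f) \<in> P"
  proof (intro idl_sum[OF P] idl_mult[OF P] pol_single)
    fix j assume "j \<in> \<phi> ` keys f"
    then show "\<tau> j \<in> mons {..<s}" using tau_mons f by (auto simp: coef_ideal_def pol_def)
  qed (use f in \<open>auto simp: coef_ideal_def\<close>)
  then show "f \<in> P" using reconstruct[of f] by simp
qed

lemma coef_eq_zeroD: "(\<And>j. coef \<phi> \<psi> j f = 0) \<Longrightarrow> f = 0"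
  using reconstruct[of f] by simp

end

section \<open>Heights\<close>

lemma splitting_var:
  assumes "y < s"
  shows "splitting s (\<lambda>m. lookup m y) (\<lambda>m. m - single y (lookup m y)) (\<lambda>j. single y j)"
proof
  show "m = single y (lookup m y) + (m - single y (lookup m y))" for m :: mon
    using mon_split(1)[of m y] by (simp add: add.commute)
  show "m + n - single y (lookup (m + n) y) = m - single y (lookup m y) + (n - single y (lookup n y))" for m n :: mon
    by (rule poly_mapping_eqI) (auto simp: lookup_add lookup_minus lookup_single when_def)
qed (use assms in \<open>auto simp: lookup_add mons_def\<close>)

lemma prime_chain_snoc:
  assumes "prime_chain R n C" "primeideal P R" "C n \<subset> P"
  shows "prime_chain R (Suc n) (\<lambda>i. if i \<le> n then C i else P)"
  using assms unfolding prime_chain_def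
  by (auto simp: less_Suc_eq le_Suc_eq)

lemma prime_chain_cons:
  assumes "prime_chain R n C" "primeideal P R" "P \<subset> C 0"
  shows "prime_chain R (Suc n) (case_nat P C)"
  using assms unfolding prime_chain_def
  by (auto simp: less_Suc_eq_0_disj split: nat.split)

text \<open>Each step passes to the ideal generated by the elements of \<open>P\<close> free of one
  variable \<open>y\<close> in \<open>Y\<close>. It is strictly smaller, as the relation of
  \<open>y\<close> over \<open>K[u]\<close> is lost, while \<open>u\<close> stays independent and
  the relations of the other variables survive.\<close>

lemma chain_below:
  assumes "finite Y" "Y \<subseteq> {..<s}" "Y \<inter> u = {}" "prm s P" "indep s P u"
    and "\<And>y. y \<in> Y \<Longrightarrow> \<exists>g\<in>pol (insert y u) \<inter> P. g \<noteq> 0"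
  shows "\<exists>C. prime_chain (poly_ring s) (card Y) C \<and> C (card Y) = P"
  using assms
proof (induction Y arbitrary: P rule: finite_induct)
  case empty
  then show ?case by (intro exI[of _ "\<lambda>_. P"]) (simp add: prime_chain_def primeideal_iff_prm)
next
  case (insert y Y)
  have ys: "y < s" and yu: "y \<notin> u" using insert.prems by auto
  let ?\<phi> = "\<lambda>m::mon. lookup m y" and ?\<psi> = "\<lambda>m::mon. m - single y (lookup m y)"
  interpret splitting s ?\<phi> ?\<psi> "\<lambda>j. single y j" by (rule splitting_var[OF ys])
  let ?P = "coef_ideal P"
  have P': "prm s ?P" by (rule coef_ideal_prm[OF insert.prems(3)])
  have sub: "?P \<subseteq> P" by (rule coef_ideal_subset[OF prm_idl[OF insert.prems(3)]])
  \<comment> \<open>A polynomial free of \<open>y\<close> has itself as its only nonzero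
    coefficient.\<close>
  have keep: "g \<in> ?P" if "g \<in> pol v" "y \<notin> v" "g \<in> P" for g v
  proof -
    have key: "lookup m y = 0" if "m \<in> keys g" for m
    proof -
      have "y \<notin> keys m" using \<open>g \<in> pol v\<close> \<open>y \<notin> v\<close> that by (auto simp: pol_def mons_def)
      then show ?thesis by (simp add: in_keys_iff)
    qed
    have coef: "coef ?\<phi> ?\<psi> j g = (if j = 0 then g else 0)" for j
    proof (cases "j = 0")
      case True
      have "coef ?\<phi> ?\<psi> j g = (\<Sum>m\<in>keys g. single m (lookup g m))"
        unfolding coef_def using True by (intro sum.cong) (auto simp: key)
      then show ?thesis using True by (simp add: poly_mapping_sum_single[of g, symmetric])
    next
      case False
      have empty: "{m \<in> keys g. lookup m y = j} = {}" using key False by fastforce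
      show ?thesis unfolding coef_def empty using False by simp
    qed
    have "coef ?\<phi> ?\<psi> j g \<in> P" for j
      unfolding coef using \<open>g \<in> P\<close> idl_zero[OF prm_idl[OF insert.prems(3)]] by simp
    moreover have "g \<in> pol {..<s}" using idl_pol[OF prm_idl[OF insert.prems(3)] \<open>g \<in> P\<close>] .
    ultimately show ?thesis unfolding coef_ideal_def by (intro CollectI conjI allI)
  qed
  have "\<exists>C. prime_chain (poly_ring s) (card Y) C \<and> C (card Y) = ?P"
  proof (rule insert.IH[OF _ _ P'])
    show "indep s ?P u" by (rule indep_antimono[OF sub insert.prems(4)])
    fix z assume z: "z \<in> Y"
    then obtain g where "g \<in> pol (insert z u)" "g \<in> P" "g \<noteq> 0" using insert.prems(5)[of z] by blast
    moreover have "y \<notin> insert z u" using z insert.hyps yu by auto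
    ultimately show "\<exists>g\<in>pol (insert z u) \<inter> ?P. g \<noteq> 0" using keep by blast
  qed (use insert.prems in auto)
  then obtain C where C: "prime_chain (poly_ring s) (card Y) C" "C (card Y) = ?P" by blast
  have "?P \<noteq> P"
  proof
    assume eq: "?P = P"
    obtain g where g: "g \<in> pol (insert y u)" "g \<in> P" "g \<noteq> 0" using insert.prems(5)[of y] by blast
    \<comment> \<open>The coefficients of the relation of \<open>y\<close> lie in
      \<open>K[u]\<close> and in \<open>P\<close>, where only 0 is available.\<close>
    have "coef ?\<phi> ?\<psi> j g = 0" for j
    proof (rule indepD[OF insert.prems(4)])
      show "coef ?\<phi> ?\<psi> j g \<in> P" using g(2) eq by (auto simp: coef_ideal_def)
      show "coef ?\<phi> ?\<psi> j g \<in> pol u"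
        unfolding coef_def using g(1)
        by (intro pol_sum pol_single) (fastforce simp: pol_def mons_def mon_split)
    qed
    then show False using coef_eq_zeroD g(3) by blast
  qed
  then have "prime_chain (poly_ring s) (Suc (card Y)) (\<lambda>i. if i \<le> card Y then C i else P)"
    using C sub insert.prems(3) by (intro prime_chain_snoc) (auto simp: primeideal_iff_prm)
  then show ?case using insert.hyps by (intro exI[of _ "\<lambda>i. if i \<le> card Y then C i else P"]) simp
qed

text \<open>By maximality of \<open>u\<close>, every variable outside \<open>u\<close> satisfies a
  relation over \<open>K[u]\<close> modulo \<open>P\<close>, so all of them can be removed in
  turn.\<close>

lemma height_ge:
  assumes P: "prm s P"
  shows "enat (s - indep_dim s P) \<le> height (poly_ring s) P"
proof -
  obtain u where u: "indep s P u" "card u = indep_dim s P"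
    using indep_dim_witness[of s P] P by (auto simp: prm_def)
  have us: "u \<subseteq> {..<s}" using u by (simp add: indep_def)
  have "\<exists>C. prime_chain (poly_ring s) (card ({..<s} - u)) C \<and> C (card ({..<s} - u)) = P"
  proof (rule chain_below[OF _ _ _ P u(1)])
    fix y assume y: "y \<in> {..<s} - u"
    have "\<not> indep s P (insert y u)"
    proof
      assume "indep s P (insert y u)"
      from card_le_indep_dim[OF this] show False using u y indep_finite[OF u(1)] by simp
    qed
    then show "\<exists>g\<in>pol (insert y u) \<inter> P. g \<noteq> 0" using y us by (auto simp: indep_def)
  qed auto
  moreover have "card ({..<s} - u) = s - indep_dim s P" using us u by (simp add: card_Diff_subset indep_finite)
  ultimately show ?thesis unfolding height_def by (intro Sup_upper) auto
qed

lemma height_le: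
  assumes P: "prm s P"
  shows "height (poly_ring s) P \<le> enat (s - indep_dim s P)"
  unfolding height_def
proof (rule Sup_least, clarify)
  fix n C assume C: "prime_chain (poly_ring s) n C" "P = C n"
  have "prm s (C 0)" using C(1) by (auto simp: prime_chain_def primeideal_iff_prm)
  then have "indep_dim s (C 0) \<le> s" using indep_dim_le by (auto simp: prm_def)
  then show "enat n \<le> enat (s - indep_dim s (C n))" using chain_indep_dim[OF C(1), of n] by simp
qed

lemma height_eq_indep_dim:
  fixes P Q :: "'k::field mpoly set"
  assumes "prm s P" "prm s Q" "height (poly_ring s) P = height (poly_ring s) Q"
  shows "indep_dim s P = indep_dim s Q"
proof -
  have "height (poly_ring s) P = enat (s - indep_dim s P)" if "prm s P" for P :: "'k mpoly set"
    using height_ge[OF that] height_le[OF that] by (rule order_antisym[rotated])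
  then have "s - indep_dim s P = s - indep_dim s Q" using assms by simp
  \<comment> \<open>These bounds undo the truncated subtraction.\<close>
  moreover have "indep_dim s P \<le> s" "indep_dim s Q \<le> s" using assms indep_dim_le by (auto simp: prm_def)
  ultimately show ?thesis by simp
qed

section \<open>Graded primes\<close>

lemma splitting_deg: "splitting s mon_deg (\<lambda>m. m) (\<lambda>_. 0)"
  by standard (auto simp: mon_deg_add)

lemma coef_deg: "coef mon_deg (\<lambda>m. m) d f = homog_component d f"
  by (simp add: coef_def homog_component_def)

lemma homog_component_mult:
  "homog_component d (f * g) = (\<Sum>i\<le>d. homog_component i f * homog_component (d - i) g)"
  using splitting.coef_mult[OF splitting_deg, of d f g] by (simp add: coef_deg)

lemma homog_component_homog:
  assumes "g \<in> homog_part s e"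
  shows "homog_component d g = (if d = e then g else 0)"
  using assms by (intro poly_mapping_eqI) (auto simp: lookup_homog_component homog_part_eq when_def in_keys_iff)

lemma homog_component_mult_homog:
  assumes "a \<in> homog_part s e"
  shows "homog_component d (f * a) = (if e \<le> d then homog_component (d - e) f * a else 0)"
proof -
  have "homog_component d (f * a) = (\<Sum>i\<le>d. if i = d - e \<and> e \<le> d then homog_component (d - e) f * a else 0)"
    unfolding homog_component_mult using homog_component_homog[OF assms]
    by (intro sum.cong) auto
  then show ?thesis by (cases "e \<le> d") (auto simp: sum.delta)
qed

lemma homog_component_in_homog_part: "f \<in> pol {..<s} \<Longrightarrow> homog_component d f \<in> homog_part s d"
  by (auto simp: homog_part_eq keys_homog_component homog_component_pol)

lemma graded_idl_insert:
  assumes "graded J" "a \<in> homog_part s e" "idl s J"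
  shows "graded (idl_insert s a J)"
  unfolding graded_def
proof (intro ballI allI)
  fix f d assume "f \<in> idl_insert s a J"
  then obtain x r where f: "f = x + r * a" "x \<in> J" "r \<in> pol {..<s}" by (auto simp: idl_insert_def)
  let ?r = "if e \<le> d then homog_component (d - e) r else 0"
  have "homog_component d f = homog_component d x + ?r * a"
    by (simp add: f homog_component_add homog_component_mult_homog[OF assms(2)])
  moreover have "?r \<in> pol {..<s}" using f(3) homog_component_pol by auto
  moreover have "homog_component d x \<in> J" using assms(1) f(2) by (simp add: graded_def)
  ultimately show "homog_component d f \<in> idl_insert s a J" using idl_insertI by metis
qed

text \<open>The largest graded ideal inside a prime \<open>Q\<close> is again prime. It still
  contains the graded ideal \<open>J\<close>, and being smaller than \<open>Q\<close> it keeps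
  \<open>u\<close> independent.\<close>

lemma graded_prime_above:
  assumes J: "idl s J" "graded J" and u: "indep s J u"
  obtains P where "prm s P" "graded P" "J \<subseteq> P" "indep s P u"
proof -
  obtain Q where Q: "prm s Q" "J \<subseteq> Q" "indep s Q u" using indep_prime[OF J(1) u] .
  interpret splitting s mon_deg "\<lambda>m. m" "\<lambda>_. 0" by (rule splitting_deg)
  let ?P = "coef_ideal Q"
  have "?P \<subseteq> Q" by (rule coef_ideal_subset[OF prm_idl[OF Q(1)]])
  then have "indep s ?P u" using Q(3) by (rule indep_antimono)
  moreover have "prm s ?P" by (rule coef_ideal_prm[OF Q(1)])
  moreover have "graded ?P"
    unfolding graded_def
  proof (intro ballI allI)
    fix f d assume f: "f \<in> ?P"
    then have "homog_component d f \<in> homog_part s d" 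
      by (intro homog_component_in_homog_part) (auto simp: coef_ideal_def)
    from homog_component_homog[OF this] show "homog_component d f \<in> ?P"
      using f idl_zero[OF prm_idl[OF Q(1)]] by (auto simp: coef_ideal_def coef_deg homog_component_pol)
  qed
  moreover have "J \<subseteq> ?P"
    using J Q(2) idl_pol[OF J(1)] by (auto simp: coef_ideal_def coef_deg graded_def)
  ultimately show ?thesis using that by blast
qed

text \<open>Reduction modulo \<open>(P, x)\<close> leaves, besides standard monomials and an element
  of \<open>P\<close>, a multiple \<open>h * x\<close> with \<open>h\<close> of degree
  \<open>d - 1\<close>, to which the same applies. So the dimension of \<open>S_d\<close> modulo
  \<open>P\<close> is at most the number of standard monomials of \<open>(P, x)\<close> up to degree
  \<open>d\<close>.\<close>

lemma variable_section_span:
  fixes P :: "'k::field mpoly set"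
  assumes P: "idl s P" "graded P" and y: "y < s"
  defines "x \<equiv> single (single y 1) 1 :: 'k mpoly"
  assumes g: "g \<in> homog_part s d"
  shows "\<exists>r. g - r \<in> P \<and> 
    keys r \<subseteq> (\<lambda>b. b + single y (d - mon_deg b)) ` {b \<in> std s (idl_insert s x P). mon_deg b \<le> d}"
  using g
proof (induction d arbitrary: g rule: less_induct)
  case (less d)
  note g = less.prems
  let ?J = "idl_insert s x P"
  let ?B = "\<lambda>d. (\<lambda>b. b + single y (d - mon_deg b)) ` {b \<in> std s ?J. mon_deg b \<le> d}"
  have xp: "x \<in> pol {..<s}" unfolding x_def using y by (intro pol_single single_mons) auto
  have xh: "x \<in> homog_part s 1" using xp by (simp add: homog_part_eq) (simp add: x_def)
  note J = idl_idl_insert[OF P(1) xp] graded_idl_insert[OF P(2) xh P(1)]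
  obtain r0 where r0: "keys r0 \<subseteq> {m \<in> std s ?J. mon_deg m = d}" "g - r0 \<in> ?J"
    using normal_form_homog[OF J g] by blast
  obtain p h where ph: "g - r0 = p + h * x" "p \<in> P" "h \<in> pol {..<s}" using r0(2) by (auto simp: idl_insert_def)
  have "r0 \<in> homog_part s d" using r0(1) by (auto simp: homog_part_eq pol_def std_def)
  then have "homog_component d (g - r0) = g - r0"
    using homog_component_homog[OF g, of d] homog_component_homog[of r0 s d d] by (simp add: homog_component_diff)
  \<comment> \<open>Taking the component of degree \<open>d\<close> replaces \<open>p\<close> and
    \<open>h\<close> by homogeneous elements, as the induction requires.\<close>
  then have eq: "g - r0 = homog_component d p + (if 1 \<le> d then homog_component (d - 1) h * x else 0)"
    unfolding ph(1) homog_component_add homog_component_mult_homog[OF xh] by simp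
  have pP: "homog_component d p \<in> P" using P(2) ph(2) by (simp add: graded_def)
  have r0B: "keys r0 \<subseteq> ?B d"
  proof
    fix m assume "m \<in> keys r0"
    then have "m = m + single y (d - mon_deg m)" "m \<in> {b \<in> std s ?J. mon_deg b \<le> d}" using r0(1) by auto
    then show "m \<in> ?B d" by blast
  qed
  show ?case
  proof (cases d)
    case 0
    then have "g - r0 \<in> P" using eq pP by simp
    then show ?thesis using r0B by blast
  next
    case (Suc e)
    let ?h = "homog_component e h"
    have "?h \<in> homog_part s e" using ph(3) by (rule homog_component_in_homog_part)
    then obtain r where r: "?h - r \<in> P" "keys r \<subseteq> ?B e" using less.IH[of e ?h] Suc by auto
    have "g - (r0 + r * x) = homog_component d p + (?h - r) * x"
      using eq Suc by (simp add: algebra_simps)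
    moreover have "\<dots> \<in> P" using pP idl_mult'[OF P(1) r(1) xp] by (rule idl_add[OF P(1)])
    ultimately have "g - (r0 + r * x) \<in> P" by simp
    moreover have "keys (r0 + r * x) \<subseteq> ?B d"
    proof -
      have "keys (r * x) \<subseteq> ?B d"
      proof
        fix m assume "m \<in> keys (r * x)"
        then have "m \<in> (+) (single y 1) ` keys r"
          unfolding x_def mult.commute[of r] by (simp add: keys_single_mult)
        then obtain b where b: "m = single y 1 + (b + single y (e - mon_deg b))" "b \<in> std s ?J" "mon_deg b \<le> e"
          using r(2) by blast
        have "single y 1 + single y (e - mon_deg b) = single y (d - mon_deg b)"
          using b(3) Suc by (simp add: single_add[symmetric] Suc_diff_le)
        then have "m = b + single y (d - mon_deg b)" using b(1) by (metis add.left_commute)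
        then show "m \<in> ?B d" using b Suc by auto
      qed
      then show ?thesis using r0B keys_add[of r0 "r * x"] by blast
    qed
    ultimately show ?thesis by blast
  qed
qed

text \<open>The variable \<open>x\<close> is taken from a largest independent set \<open>u\<close>.
  If all independent sets modulo \<open>(P, x)\<close> had fewer than \<open>k\<close> elements, the
  forms of degree \<open>d\<close> modulo \<open>P\<close> would grow only like
  \<open>d^(k-1)\<close>; but the monomials in \<open>u\<close> of degree \<open>d\<close> are
  linearly independent modulo \<open>P\<close> and grow like \<open>d^k\<close>.\<close>

lemma graded_prime_step:
  fixes P :: "'k::field mpoly set"
  assumes P: "prm s P" "graded P" and k: "indep_dim s P = Suc k"
  obtains Q where "prm s Q" "graded Q" "P \<subset> Q" "k \<le> indep_dim s Q"
proof -
  note J = prm_idl[OF P(1)]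
  obtain u where u: "indep s P u" "card u = Suc k"
    using indep_dim_witness[of s P] P k by (auto simp: prm_def)
  then obtain y where yu: "y \<in> u" by fastforce
  have us: "u \<subseteq> {..<s}" using u by (simp add: indep_def)
  then have y: "y < s" using yu by auto
  define x where "x = (single (single y 1) 1 :: 'k mpoly)"
  have xu: "x \<in> pol u" unfolding x_def using yu by (intro pol_single single_mons)
  have xp: "x \<in> pol {..<s}" using xu pol_mono[OF us] by blast
  have xh: "x \<in> homog_part s 1" using xp by (simp add: homog_part_eq) (simp add: x_def)
  let ?J = "idl_insert s x P"
  note J' = idl_idl_insert[OF J xp] graded_idl_insert[OF P(2) xh J]
  \<comment> \<open>For \<open>k = 0\<close> the negation says that no set is independent, so
    refuting it also shows that \<open>(P, x)\<close> is proper.\<close>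
  have "\<exists>u'. indep s ?J u' \<and> k \<le> card u'"
  proof (rule ccontr)
    assume neg: "\<not> ?thesis"
    have "\<exists>c. \<forall>n. card {m \<in> std s ?J. mon_deg m \<le> n} * (n + 1) \<le> c * (n + 1) ^ k"
      by (rule std_card_bound[OF J'(1)]) (use neg in \<open>auto simp: not_le\<close>)
    then obtain c where c: "\<And>n. card {m \<in> std s ?J. mon_deg m \<le> n} * (n + 1) \<le> c * (n + 1) ^ k" by blast
    define w where "w = u - {y}"
    have w: "finite w" "card w = k" "y \<notin> w" "insert y w = u" 
      using u yu indep_finite[OF u(1)] by (auto simp: w_def)
    \<comment> \<open>A box of side \<open>e\<close> in the \<open>k\<close> variables of
      \<open>w\<close> has degrees at most \<open>k * e \<le> d\<close>. As
      \<open>d + 1 \<le> Suc k * (e + 1)\<close>, the two counts combine to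
      \<open>(e + 1) ^ k * (d + 1) \<le> (e + 1) ^ k * e\<close>, which contradicts
      \<open>e \<le> d\<close>.\<close>
    define e where "e = c * Suc k ^ k"
    define d where "d = Suc k * e"
    define X where "X = {m \<in> mons u. mon_deg m = d}"
    define B where "B = (\<lambda>b. b + single y (d - mon_deg b)) ` {b \<in> std s ?J. mon_deg b \<le> d}"
    have finS: "finite {b \<in> std s ?J. mon_deg b \<le> d}"
      by (rule finite_subset[OF _ finite_mons_deg_le[of "{..<s}" d]]) (auto simp: std_def)
    have finB: "finite B" unfolding B_def using finS by simp
    have finX: "finite X" unfolding X_def using indep_finite[OF u(1)] by (intro finite_mons_deg) auto
    \<comment> \<open>Otherwise the monomials in \<open>X\<close> would be linearly dependent modulo
      \<open>P\<close>, giving a nonzero element of \<open>K[u] \<inter> P\<close>.\<close>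
    have "card X \<le> card B"
    proof (rule ccontr)
      assume "\<not> ?thesis"
      then have less: "card B < card X" by simp
      let ?F = "\<lambda>m. single m 1 :: 'k mpoly"
      have "\<forall>m\<in>X. \<exists>r. ?F m - r \<in> P \<and> keys r \<subseteq> B"
      proof
        fix m assume "m \<in> X"
        then have "?F m \<in> homog_part s d" using mons_mono[OF us] by (auto simp: X_def homog_part_eq intro: pol_single)
        then show "\<exists>r. ?F m - r \<in> P \<and> keys r \<subseteq> B"
          using variable_section_span[OF J P(2) y] by (simp add: B_def x_def)
      qed
      then obtain r where r: "\<And>m. m \<in> X \<Longrightarrow> ?F m - r m \<in> P" "\<And>m. m \<in> X \<Longrightarrow> keys (r m) \<subseteq> B" by metis
      have "\<exists>a. (\<exists>m\<in>X. a m \<noteq> 0) \<and> (\<Sum>m\<in>X. single 0 (a m) * ?F m) \<in> P"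
        by (rule linear_dependence[OF J finX finB less]) (fact r)+
      then obtain a where a: "\<exists>m\<in>X. a m \<noteq> 0" "(\<Sum>m\<in>X. single m (a m)) \<in> P" by (auto simp: mult_single)
      have "(\<Sum>m\<in>X. single m (a m)) \<in> pol u" by (intro pol_sum pol_single) (auto simp: X_def)
      from indepD[OF u(1) this a(2)] have "lookup (\<Sum>m\<in>X. single m (a m)) m = 0" for m by simp
      moreover have "lookup (\<Sum>m\<in>X. single m (a m)) m = a m" if "m \<in> X" for m
        using that finX by (simp add: lookup_sum lookup_single when_def)
      ultimately show False using a(1) by auto
    qed
    also have "card B \<le> card {b \<in> std s ?J. mon_deg b \<le> d}" unfolding B_def using finS by (rule card_image_le)
    finally have X1: "card X * (d + 1) \<le> c * (d + 1) ^ k"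
      using c[of d] mult_le_mono1 order_trans by blast
    have "(e + 1) ^ k = card {m \<in> mons w. \<forall>i. lookup m i \<le> e}"
      using card_mons_box[OF w(1), of e] w(2) by simp
    \<comment> \<open>Filling up with powers of \<open>y\<close> brings the monomials of the box to
      degree \<open>d\<close>, injectively because \<open>y\<close> is not in
      \<open>w\<close>.\<close>
    also have "\<dots> \<le> card X"
    proof (rule card_inj_on_le[OF _ _ finX])
      let ?f = "\<lambda>b. b + single y (d - mon_deg b)"
      show "inj_on ?f {m \<in> mons w. \<forall>i. lookup m i \<le> e}"
        using mon_add_single_eq_iff[of _ w _ y] w(3) by (auto intro!: inj_onI)
      show "?f ` {m \<in> mons w. \<forall>i. lookup m i \<le> e} \<subseteq> X"
      proof
        fix m assume "m \<in> ?f ` {m \<in> mons w. \<forall>i. lookup m i \<le> e}"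
        then obtain b where b: "m = ?f b" "b \<in> mons w" "\<And>i. lookup b i \<le> e" by auto
        have "mon_deg b \<le> k * e" using mon_deg_box[OF w(1) b(2,3)] w(2) by simp
        then have "mon_deg b \<le> d" by (simp add: d_def)
        moreover have "m \<in> mons u" unfolding b(1) w(4)[symmetric] mons_insert using b(2) by blast
        ultimately show "m \<in> X" by (simp add: X_def b(1) mon_deg_add)
      qed
    qed
    finally have "(e + 1) ^ k * (d + 1) \<le> c * (d + 1) ^ k" using X1 mult_le_mono1 order_trans by blast
    also have "\<dots> \<le> c * (Suc k * (e + 1)) ^ k"
      by (intro mult_le_mono2 power_mono) (auto simp: d_def)
    also have "\<dots> = (e + 1) ^ k * e"
      unfolding power_mult_distrib e_def by (simp only: mult.assoc mult.commute mult.left_commute)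
    finally have "d + 1 \<le> e" by (simp only: mult_le_cancel1) simp
    then show False by (simp add: d_def)
  qed
  then obtain u' where u': "indep s ?J u'" "k \<le> card u'" by blast
  obtain Q where Q: "prm s Q" "graded Q" "?J \<subseteq> Q" "indep s Q u'"
    using graded_prime_above[OF J' u'(1)] .
  have "x \<notin> P"
  proof
    assume "x \<in> P"
    from indepD[OF u(1) xu this] have "lookup x (single y 1) = 0" by simp
    then show False by (simp add: x_def)
  qed
  then have "P \<subset> Q" using idl_insert_super[OF J, of x] idl_insert_mem[OF J, of x] Q(3) by blast
  moreover have "k \<le> indep_dim s Q" using card_le_indep_dim[OF Q(4)] u'(2) by simp
  ultimately show ?thesis using that Q by blast
qed

lemma chain_above:
  assumes "prm s P" "graded P" "n \<le> indep_dim s P"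
  shows "\<exists>C. prime_chain (poly_ring s) n C \<and> C 0 = P"
  using assms
proof (induction n arbitrary: P)
  case 0
  then show ?case by (intro exI[of _ "\<lambda>_. P"]) (simp add: prime_chain_def primeideal_iff_prm)
next
  case (Suc n)
  then obtain k where k: "indep_dim s P = Suc k" by (metis Suc_le_D)
  obtain Q where Q: "prm s Q" "graded Q" "P \<subset> Q" "k \<le> indep_dim s Q"
    using graded_prime_step[OF Suc.prems(1,2) k] .
  then have "n \<le> indep_dim s Q" using Suc.prems(3) k by simp
  from Suc.IH[OF Q(1,2) this] obtain C where C: "prime_chain (poly_ring s) n C" "C 0 = Q" by blast
  have "prime_chain (poly_ring s) (Suc n) (case_nat P C)"
    by (rule prime_chain_cons[OF C(1)]) (use Q C Suc.prems in \<open>auto simp: primeideal_iff_prm\<close>)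
  then show ?case by (intro exI[of _ "case_nat P C"]) simp
qed

section \<open>The quotient ring\<close>

definition cls :: "nat \<Rightarrow> 'k::field mpoly set \<Rightarrow> 'k mpoly \<Rightarrow> 'k mpoly set" where
  "cls s J f = J +>\<^bsub>poly_ring s\<^esub> f"

context
  fixes s :: nat and J :: "'k::field mpoly set"
  assumes J: "idl s J"
begin

lemma ideal_J: "ideal J (poly_ring s)" using J by (simp add: ideal_iff_idl)

lemma cring_quot: "cring (poly_ring s Quot J)"
  by (rule ideal.quotient_is_cring[OF ideal_J cring_poly_ring])

lemma hom_quot: "cls s J \<in> ring_hom (poly_ring s) (poly_ring s Quot J)"
  using ideal.rcos_ring_hom[OF ideal_J] by (simp add: cls_def[abs_def])

lemma cls_carrier: "f \<in> pol {..<s} \<Longrightarrow> cls s J f \<in> carrier (poly_ring s Quot J)"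
  using ring_hom_memE(1)[OF hom_quot, of f] by (simp add: carrier_poly_ring)

lemma cls_mult: "f \<in> pol {..<s} \<Longrightarrow> g \<in> pol {..<s} \<Longrightarrow> 
  cls s J f \<otimes>\<^bsub>poly_ring s Quot J\<^esub> cls s J g = cls s J (f * g)"
  using ring_hom_memE(2)[OF hom_quot, of f g] by (simp add: carrier_poly_ring)

lemma cls_add: "f \<in> pol {..<s} \<Longrightarrow> g \<in> pol {..<s} \<Longrightarrow> 
  cls s J f \<oplus>\<^bsub>poly_ring s Quot J\<^esub> cls s J g = cls s J (f + g)"
  using ring_hom_memE(3)[OF hom_quot, of f g] by (simp add: carrier_poly_ring)

lemma cls_one: "\<one>\<^bsub>poly_ring s Quot J\<^esub> = cls s J 1"
  using ring_hom_memE(4)[OF hom_quot] by simp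

lemma cls_zero: "\<zero>\<^bsub>poly_ring s Quot J\<^esub> = cls s J 0"
proof -
  have "cls s J 0 = J"
    unfolding cls_def a_r_coset_def' using idl_zero[OF J] by auto
  then show ?thesis by (simp add: FactRing_def)
qed

lemma quot_carrierE:
  assumes "x \<in> carrier (poly_ring s Quot J)"
  obtains f where "f \<in> pol {..<s}" "x = cls s J f"
  using assms unfolding FactRing_def A_RCOSETS_def' cls_def by (auto simp: carrier_poly_ring)

lemma cls_eq_iff:
  assumes "f \<in> pol {..<s}" "g \<in> pol {..<s}"
  shows "cls s J f = cls s J g \<longleftrightarrow> f - g \<in> J"
proof -
  have "ring (poly_ring s :: 'k mpoly ring)" using cring_poly_ring by (rule cring.axioms)
  from ring.quotient_eq_iff_same_a_r_cos[OF this ideal_J, of f g]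
  have "f \<ominus>\<^bsub>poly_ring s\<^esub> g \<in> J \<longleftrightarrow> cls s J f = cls s J g"
    using assms by (simp add: carrier_poly_ring cls_def)
  then show ?thesis using minus_poly_ring[OF assms(2)] by (simp add: a_minus_def)
qed

lemma cls_eq_zero_iff: "f \<in> pol {..<s} \<Longrightarrow> cls s J f = \<zero>\<^bsub>poly_ring s Quot J\<^esub> \<longleftrightarrow> f \<in> J"
  using cls_eq_iff[of f 0] by (simp add: cls_zero)

lemma prime_vimage:
  assumes p: "primeideal p (poly_ring s Quot J)"
  shows "prm s {f \<in> pol {..<s}. cls s J f \<in> p}"
proof -
  interpret hom: ring_hom_ring "poly_ring s" "poly_ring s Quot J" "cls s J"
    using cring.axioms(1)[OF cring_poly_ring] cring.axioms(1)[OF cring_quot] hom_quot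
    by (rule ring_hom_ringI2)
  note I = primeideal.axioms(1)[OF p]
  have "idl s {f \<in> pol {..<s}. cls s J f \<in> p}"
    using hom.ideal_vimage[OF I] by (simp add: ideal_iff_idl carrier_poly_ring)
  moreover have "cls s J 1 \<notin> p"
    using ideal.one_imp_carrier[OF I] primeideal.I_notcarr[OF p] by (auto simp: cls_one)
  moreover have "f \<in> pol {..<s} \<Longrightarrow> g \<in> pol {..<s} \<Longrightarrow> cls s J (f * g) \<in> p \<Longrightarrow> cls s J f \<in> p \<or> cls s J g \<in> p" for f g
    using primeideal.I_prime[OF p, of "cls s J f" "cls s J g"] by (simp add: cls_carrier cls_mult)
  ultimately show ?thesis unfolding prm_def by auto
qed

lemma cls_image_iff:
  assumes P: "idl s P" "J \<subseteq> P" and f: "f \<in> pol {..<s}"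
  shows "cls s J f \<in> cls s J ` P \<longleftrightarrow> f \<in> P"
proof
  assume "cls s J f \<in> cls s J ` P"
  then obtain g where g: "g \<in> P" "cls s J f = cls s J g" by blast
  then have "f - g \<in> P" using cls_eq_iff[OF f idl_pol[OF P(1)]] P(2) by blast
  then show "f \<in> P" using idl_mem_cong[OF P(1)] g(1) by blast
qed simp

lemma prime_image:
  assumes P: "prm s P" "J \<subseteq> P"
  shows "primeideal (cls s J ` P) (poly_ring s Quot J)"
proof (rule primeidealI[OF _ cring_quot])
  note I = prm_idl[OF P(1)]
  have "ring (poly_ring s :: 'k mpoly ring)" using cring_poly_ring by (rule cring.axioms)
  from ring.ring_ideal_imp_quot_ideal[OF this ideal_J, of P]
  show "ideal (cls s J ` P) (poly_ring s Quot J)"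
    using I by (simp add: ideal_iff_idl cls_def[abs_def])
  have "cls s J 1 \<notin> cls s J ` P" using cls_image_iff[OF I P(2) pol_one] P(1) by (simp add: prm_def)
  then show "carrier (poly_ring s Quot J) \<noteq> cls s J ` P" using cls_carrier[OF pol_one] by metis
  fix a b
  assume ab: "a \<in> carrier (poly_ring s Quot J)" "b \<in> carrier (poly_ring s Quot J)"
    "a \<otimes>\<^bsub>poly_ring s Quot J\<^esub> b \<in> cls s J ` P"
  obtain f g where fg: "f \<in> pol {..<s}" "a = cls s J f" "g \<in> pol {..<s}" "b = cls s J g"
    using quot_carrierE[OF ab(1)] quot_carrierE[OF ab(2)] by metis
  then have "f * g \<in> P" using ab(3) cls_mult cls_image_iff[OF I P(2)] pol_mult by metis
  then show "a \<in> cls s J ` P \<or> b \<in> cls s J ` P" using P(1) fg by (auto simp: prm_def)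
qed

text \<open>Preimages and images under \<open>cls s J\<close>. As chains increase, the condition on
  \<open>C 0\<close> puts every member above \<open>J\<close>.\<close>

lemma chain_quot_iff:
  "(\<exists>C. prime_chain (poly_ring s Quot J) n C) \<longleftrightarrow> (\<exists>C. prime_chain (poly_ring s) n C \<and> J \<subseteq> C 0)"
proof
  assume "\<exists>C. prime_chain (poly_ring s Quot J) n C"
  then obtain C where C: "prime_chain (poly_ring s Quot J) n C" by blast
  let ?D = "\<lambda>i. {f \<in> pol {..<s}. cls s J f \<in> C i}"
  have ideal: "ideal (C i) (poly_ring s Quot J)" if "i \<le> n" for i
    using C that primeideal.axioms(1) by (auto simp: prime_chain_def)
  have "prime_chain (poly_ring s) n ?D"
    unfolding prime_chain_def
  proof (intro conjI allI impI)
    show "primeideal (?D i) (poly_ring s)" if "i \<le> n" for i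
      unfolding primeideal_iff_prm using C that by (intro prime_vimage) (simp add: prime_chain_def)
    show "?D i \<subset> ?D (Suc i)" if "i < n" for i
    proof -
      have sub: "C i \<subset> C (Suc i)" using C that by (simp add: prime_chain_def)
      then obtain x where x: "x \<in> C (Suc i)" "x \<notin> C i" by blast
      have "x \<in> carrier (poly_ring s Quot J)"
        using additive_subgroup.a_Hcarr[OF ideal.axioms(1)[OF ideal], of "Suc i" x] x that by simp
      then obtain f where "f \<in> pol {..<s}" "x = cls s J f" by (rule quot_carrierE)
      then have "f \<in> ?D (Suc i)" "f \<notin> ?D i" using x by simp_all
      moreover have "?D i \<subseteq> ?D (Suc i)" using sub by blast
      ultimately show ?thesis by blast
    qed
  qed
  moreover have "J \<subseteq> ?D 0"
  proof
    fix f assume f: "f \<in> J"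
    then have "cls s J f = \<zero>\<^bsub>poly_ring s Quot J\<^esub>" using cls_eq_zero_iff idl_pol[OF J] by blast
    then show "f \<in> ?D 0"
      using additive_subgroup.zero_closed[OF ideal.axioms(1)[OF ideal[of 0]]] idl_pol[OF J f] by simp
  qed
  ultimately show "\<exists>C. prime_chain (poly_ring s) n C \<and> J \<subseteq> C 0" by blast
next
  assume "\<exists>C. prime_chain (poly_ring s) n C \<and> J \<subseteq> C 0"
  then obtain C where C: "prime_chain (poly_ring s) n C" "J \<subseteq> C 0" by blast
  have JC: "J \<subseteq> C i" if "i \<le> n" for i
    using that
  proof (induction i)
    case (Suc i)
    then have "C i \<subset> C (Suc i)" using C(1) by (simp add: prime_chain_def)
    then show ?case using Suc by simp
  qed (rule C)
  have P: "prm s (C i)" if "i \<le> n" for i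
    using C(1) that by (simp add: prime_chain_def primeideal_iff_prm)
  have "prime_chain (poly_ring s Quot J) n (\<lambda>i. cls s J ` C i)"
    unfolding prime_chain_def
  proof (intro conjI allI impI)
    show "primeideal (cls s J ` C i) (poly_ring s Quot J)" if "i \<le> n" for i
      by (rule prime_image[OF P[OF that] JC[OF that]])
    show "cls s J ` C i \<subset> cls s J ` C (Suc i)" if "i < n" for i
    proof -
      have sub: "C i \<subset> C (Suc i)" using C(1) that by (simp add: prime_chain_def)
      then obtain f where f: "f \<in> C (Suc i)" "f \<notin> C i" by blast
      have "f \<in> pol {..<s}" using idl_pol[OF prm_idl[OF P[of "Suc i"]] f(1)] that by simp
      then have "cls s J f \<notin> cls s J ` C i"
        using cls_image_iff[OF prm_idl[OF P[of i]] JC[of i]] that f(2) by simp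
      then show ?thesis using sub f(1) by blast
    qed
  qed
  then show "\<exists>C. prime_chain (poly_ring s Quot J) n C" by blast
qed

text \<open>A chain above \<open>J\<close> starts at a prime of dimension at most that of
  \<open>J\<close>, and each step lowers it. Conversely, a graded prime above \<open>J\<close> that
  keeps a largest independent set is the bottom of a chain of that length.\<close>

lemma krull_dim_quot:
  assumes J1: "1 \<notin> J" and gr: "graded J"
  shows "krull_dim (poly_ring s Quot J) = enat (indep_dim s J)"
proof (rule antisym)
  show "krull_dim (poly_ring s Quot J) \<le> enat (indep_dim s J)"
    unfolding krull_dim_def chain_quot_iff
  proof (rule Sup_least, clarify)
    fix n C assume C: "prime_chain (poly_ring s) n C" "J \<subseteq> C 0"
    have P: "prm s (C 0)" using C(1) by (simp add: prime_chain_def primeideal_iff_prm)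
    then have "indep_dim s (C 0) \<le> indep_dim s J" using C(2) by (intro indep_dim_mono) (auto simp: prm_def)
    then show "enat n \<le> enat (indep_dim s J)" using chain_indep_dim[OF C(1), of n] by simp
  qed
  obtain u where u: "indep s J u" "card u = indep_dim s J" using indep_dim_witness[OF J J1] .
  obtain P where P: "prm s P" "graded P" "J \<subseteq> P" "indep s P u"
    using graded_prime_above[OF J gr u(1)] .
  have "indep_dim s J \<le> indep_dim s P" using card_le_indep_dim[OF P(4)] u(2) by simp
  from chain_above[OF P(1,2) this] obtain C where "prime_chain (poly_ring s) (indep_dim s J) C" "C 0 = P" by blast
  then show "enat (indep_dim s J) \<le> krull_dim (poly_ring s Quot J)"
    unfolding krull_dim_def chain_quot_iff using P(3) by (intro Sup_upper) auto
qed

section \<open>The Hilbert function\<close>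

lemma scalars_eq: "scalars s J = range (\<lambda>c. cls s J (single 0 c))"
  by (simp add: scalars_def cls_def)

lemma subfield_scalars:
  assumes J1: "1 \<notin> J"
  shows "subfield (scalars s J) (poly_ring s Quot J)"
proof -
  interpret Q: cring "poly_ring s Quot J" by (rule cring_quot)
  let ?c = "\<lambda>c. cls s J (single 0 c)"
  have add: "?c a \<oplus>\<^bsub>poly_ring s Quot J\<^esub> ?c b = ?c (a + b)" for a b
    by (simp add: cls_add single_add)
  have mult: "?c a \<otimes>\<^bsub>poly_ring s Quot J\<^esub> ?c b = ?c (a * b)" for a b
    by (simp add: cls_mult mult_single)
  have one: "\<one>\<^bsub>poly_ring s Quot J\<^esub> = ?c 1" by (simp add: cls_one)
  have zero: "?c a = \<zero>\<^bsub>poly_ring s Quot J\<^esub> \<longleftrightarrow> a = 0" for a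
    using const_in_idl[OF J J1] idl_zero[OF J] by (auto simp: cls_eq_zero_iff)
  have carr: "?c a \<in> carrier (poly_ring s Quot J)" for a by (intro cls_carrier) simp
  have neg: "\<ominus>\<^bsub>poly_ring s Quot J\<^esub> ?c a = ?c (- a)" for a
    using carr zero[of 0] by (intro Q.minus_equality) (simp_all add: add)
  have "subring (scalars s J) (poly_ring s Quot J)"
    unfolding scalars_eq
  proof (rule Q.subringI)
    show "\<one>\<^bsub>poly_ring s Quot J\<^esub> \<in> range ?c" unfolding one by (rule rangeI)
  qed (use carr in \<open>auto simp: add mult neg\<close>)
  then have sub: "subcring (scalars s J) (poly_ring s Quot J)" by (rule Q.subcringI')
  have "Units ((poly_ring s Quot J)\<lparr>carrier := scalars s J\<rparr>) = scalars s J - {\<zero>\<^bsub>poly_ring s Quot J\<^esub>}"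
  proof (intro equalityI subsetI)
    fix x assume "x \<in> Units ((poly_ring s Quot J)\<lparr>carrier := scalars s J\<rparr>)"
    then obtain a b where ab: "x = ?c a" "?c (b * a) = ?c 1"
      by (auto simp: Units_def scalars_eq mult one)
    have "a \<noteq> 0"
    proof
      assume "a = 0"
      then have "?c 1 = \<zero>\<^bsub>poly_ring s Quot J\<^esub>" using ab(2) by (simp add: cls_zero)
      then show False by (simp only: zero) simp
    qed
    then show "x \<in> scalars s J - {\<zero>\<^bsub>poly_ring s Quot J\<^esub>}" using ab(1) zero by (auto simp: scalars_eq)
  next
    fix x assume "x \<in> scalars s J - {\<zero>\<^bsub>poly_ring s Quot J\<^esub>}"
    then obtain a where a: "x = ?c a" "a \<noteq> 0" using zero by (auto simp: scalars_eq)
    then have "?c (inverse a) \<otimes>\<^bsub>poly_ring s Quot J\<^esub> x = ?c 1" "x \<otimes>\<^bsub>poly_ring s Quot J\<^esub> ?c (inverse a) = ?c 1"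
      by (simp_all only: a(1) mult) (use a(2) in simp_all)
    then show "x \<in> Units ((poly_ring s Quot J)\<lparr>carrier := scalars s J\<rparr>)"
      using a(1) by (auto simp: Units_def scalars_eq one)
  qed
  with sub show ?thesis by (rule Q.subfieldI)
qed

text \<open>\<open>zip\<close> stops at the shorter list, exactly as \<open>combine\<close> does, so
  the formula also covers lists of different lengths.\<close>

lemma combine_cls:
  assumes "set L \<subseteq> mons {..<s}"
  shows "ring.combine (poly_ring s Quot J) (map (\<lambda>c. cls s J (single 0 c)) cs) (map (\<lambda>m. cls s J (single m 1)) L)
    = cls s J (\<Sum>(c, m)\<leftarrow>zip cs L. single m c)"
  using assms
proof (induction cs arbitrary: L)
  case Nil
  interpret Q: cring "poly_ring s Quot J" by (rule cring_quot)
  show ?case by (simp add: cls_zero)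
next
  case (Cons c cs)
  interpret Q: cring "poly_ring s Quot J" by (rule cring_quot)
  show ?case
  proof (cases L)
    case Nil
    then show ?thesis by (simp add: cls_zero)
  next
    case (Cons m L')
    have "(\<Sum>(c, m)\<leftarrow>zip cs L'. single m c) \<in> pol {..<s}"
      using Cons.prems Cons
    proof (induction cs arbitrary: L L' m)
      case (Cons c cs)
      show ?case
      proof (cases L')
        case (Cons m' L'')
        then show ?thesis using Cons.IH[of L' m' L''] Cons.prems by (auto intro!: pol_add pol_single)
      qed simp
    qed simp
    then show ?thesis
      using Cons.IH[of L'] Cons.prems Cons by (simp add: cls_mult cls_add mult_single pol_single)
  qed
qed

end

section \<open>The standard monomials of degree \<open>d\<close> as a basis\<close>

lemma keys_zip_sum: "keys (\<Sum>(c, m)\<leftarrow>zip cs L. single m c) \<subseteq> set L"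
proof (induction cs L rule: list_induct2')
  case (4 c cs m L)
  have "keys (\<Sum>(c, m)\<leftarrow>zip (c # cs) (m # L). single m c) \<subseteq> keys (single m c) \<union> keys (\<Sum>(c, m)\<leftarrow>zip cs L. single m c)"
    unfolding zip_Cons_Cons list.map sum_list.Cons prod.case by (rule keys_add)
  then show ?case using 4 by (auto split: if_splits)
qed simp_all

lemma lookup_zip_sum:
  assumes "distinct L" "i < length cs" "i < length L"
  shows "lookup (\<Sum>(c, m)\<leftarrow>zip cs L. single m c) (L ! i) = cs ! i"
  using assms
proof (induction cs L arbitrary: i rule: list_induct2')
  case (4 c cs m L)
  show ?case
  proof (cases i)
    case 0
    have "m \<notin> keys (\<Sum>(c, m)\<leftarrow>zip cs L. single m c)" using keys_zip_sum[of cs L] 4 by auto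
    then show ?thesis using 0 by (simp add: lookup_add in_keys_iff)
  next
    case (Suc j)
    then have "m \<noteq> L ! j" using 4 by auto
    then show ?thesis using Suc 4 by (simp add: lookup_add lookup_single)
  qed
qed simp_all

text \<open>Gradedness lets a form be reduced within its degree, so the standard monomials of degree
  \<open>d\<close> span the image of \<open>S_d\<close>; they are independent because a combination
  of them lying in \<open>J\<close> vanishes.\<close>

lemma hilbert_fun_eq_mon_count:
  fixes J :: "'k::field mpoly set"
  assumes J: "idl s J" and gr: "graded J" and J1: "1 \<notin> J"
  shows "hilbert_fun s J d = mon_count (std s J) d"
proof -
  let ?R = "poly_ring s Quot J" and ?K = "scalars s J"
  interpret Q: cring ?R by (rule cring_quot[OF J])
  note K = subfield_scalars[OF J J1]
  let ?S = "{m \<in> std s J. mon_deg m = d}"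
  have "finite ?S" by (rule finite_mons_deg[of "{..<s}"]) (auto simp: std_def)
  then obtain L where L: "set L = ?S" "distinct L" using finite_distinct_list by blast
  have Ls: "set L \<subseteq> mons {..<s}" using L by (auto simp: std_def)
  let ?c = "\<lambda>c. cls s J (single 0 c)"
  let ?p = "\<lambda>cs. \<Sum>(c, m)\<leftarrow>zip cs L. single m c :: 'k mpoly"
  define Us where "Us = map (\<lambda>m. cls s J (single m 1)) L"
  have comb: "Q.combine (map ?c cs) Us = cls s J (?p cs)" for cs
    unfolding Us_def by (rule combine_cls[OF J Ls])
  have kp: "keys (?p cs) \<subseteq> ?S" for cs using keys_zip_sum[of cs L] L(1) by simp
  have pp: "?p cs \<in> pol {..<s}" for cs using kp[of cs] by (auto simp: pol_def std_def)
  have carr: "set Us \<subseteq> carrier ?R" using Ls by (auto simp: Us_def intro!: cls_carrier[OF J] pol_single)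
  have ex: "\<exists>cs. Ks = map ?c cs" if "set Ks \<subseteq> ?K" for Ks
    using that unfolding scalars_eq[OF J] by (simp add: ex_map_conv image_iff subset_iff)
  have zero: "?c 0 = \<zero>\<^bsub>?R\<^esub>" by (simp add: cls_zero[OF J])
  have indep: "Q.independent ?K Us"
  proof (rule Q.trivial_combine_imp_independent[OF K carr])
    fix Ks assume Ks: "set Ks \<subseteq> ?K" "Q.combine Ks Us = \<zero>\<^bsub>?R\<^esub>"
    then obtain cs where cs: "Ks = map ?c cs" using ex by blast
    then have "?p cs \<in> J" using Ks(2) pp cls_eq_zero_iff[OF J] by (simp add: comb)
    then have "?p cs = 0" using kp by (intro std_indep[of _ s J]) auto
    then have "cs ! i = 0" if "i < length cs" "i < length L" for i
      using lookup_zip_sum[OF L(2) that] by simp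
    \<comment> \<open>\<open>combine\<close> ignores coefficients beyond the length of
      \<open>Us\<close>, so only the initial ones are forced to vanish.\<close>
    then show "set (take (length Us) Ks) \<subseteq> {\<zero>\<^bsub>?R\<^esub>}"
      using zero by (auto simp: in_set_conv_nth cs Us_def)
  qed
  have span: "Q.Span ?K Us = cls s J ` homog_part s d"
  proof (intro equalityI subsetI)
    fix x assume "x \<in> Q.Span ?K Us"
    then obtain Ks where "set Ks \<subseteq> ?K" "x = Q.combine Ks Us"
      using Q.Span_eq_combine_set[OF K carr] by blast
    then obtain cs where "x = cls s J (?p cs)" using ex comb by metis
    moreover have "?p cs \<in> homog_part s d" using pp[of cs] kp[of cs] by (auto simp: homog_part_eq)
    ultimately show "x \<in> cls s J ` homog_part s d" by blast
  next
    fix x assume "x \<in> cls s J ` homog_part s d"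
    then obtain f where f: "f \<in> homog_part s d" "x = cls s J f" by blast
    obtain r where r: "keys r \<subseteq> ?S" "f - r \<in> J" using normal_form_homog[OF J gr f(1)] by blast
    have "r \<in> pol {..<s}" using r(1) by (auto simp: pol_def std_def)
    then have "x = cls s J r" using f r(2) cls_eq_iff[OF J] by (simp add: homog_part_eq)
    moreover have "?p (map (lookup r) L) = r"
    proof (rule poly_mapping_eqI)
      fix m
      show "lookup (?p (map (lookup r) L)) m = lookup r m"
      proof (cases "m \<in> set L")
        case True
        then obtain i where "i < length L" "m = L ! i" by (metis in_set_conv_nth)
        then show ?thesis using lookup_zip_sum[OF L(2), of i "map (lookup r) L"] by simp
      next
        case False
        then have "m \<notin> keys (?p (map (lookup r) L))" "m \<notin> keys r" using keys_zip_sum[of _ L] r(1) L(1) by auto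
        then show ?thesis by (simp add: in_keys_iff)
      qed
    qed
    ultimately have "x = Q.combine (map ?c (map (lookup r) L)) Us" by (simp only: comb)
    moreover have "set (map ?c (map (lookup r) L)) \<subseteq> ?K" by (auto simp: scalars_eq[OF J])
    ultimately show "x \<in> Q.Span ?K Us" using Q.Span_eq_combine_set[OF K carr] by blast
  qed
  have "Q.dimension (length L) ?K (cls s J ` homog_part s d)"
    using Q.dimension_independent[OF indep] span by (simp add: Us_def)
  then have "Q.dim ?K (cls s J ` homog_part s d) = length L"
    using Q.dimI[OF K] by (simp add: over_def)
  then show ?thesis using L distinct_card[OF L(2)] by (simp add: hilbert_fun_def cls_def[abs_def] mon_count_def)
qed

text \<open>The monomials of degree \<open>d\<close> in \<open>u\<close> are linearly independent
  modulo \<open>J\<close>, so there are at least as many standard ones; two variables alone already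
  provide \<open>d + 1\<close>.\<close>

lemma mon_count_ge:
  assumes J: "idl s J" "graded J" and u: "indep s J u" "2 \<le> card u"
  shows "d + 1 \<le> mon_count (std s J) d"
proof (rule ccontr)
  assume neg: "\<not> ?thesis"
  have fin: "finite u" by (rule indep_finite[OF u(1)])
  have us: "u \<subseteq> {..<s}" using u by (simp add: indep_def)
  let ?X = "{m \<in> mons u. mon_deg m = d}" and ?B = "{m \<in> std s J. mon_deg m = d}"
  have finX: "finite ?X" by (rule finite_mons_deg[OF fin]) simp
  have finB: "finite ?B" by (rule finite_mons_deg[of "{..<s}"]) (auto simp: std_def)
  have "d + 1 \<le> (d + 1) choose d" by simp
  also have "\<dots> \<le> (card u + d - 1) choose d" using u(2) by (intro binomial_right_mono) simp
  finally have "card ?B < card ?X" using neg by (simp add: mon_count_def card_mons_deg[OF fin])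
  let ?F = "\<lambda>m. single m 1 :: 'a mpoly"
  have "\<forall>m\<in>?X. \<exists>r. ?F m - r \<in> J \<and> keys r \<subseteq> ?B"
  proof
    fix m assume "m \<in> ?X"
    then have "?F m \<in> homog_part s d" using mons_mono[OF us] by (auto simp: homog_part_eq intro: pol_single)
    then show "\<exists>r. ?F m - r \<in> J \<and> keys r \<subseteq> ?B" using normal_form_homog[OF J] by blast
  qed
  from bchoice[OF this] obtain r where "\<forall>m\<in>?X. ?F m - r m \<in> J \<and> keys (r m) \<subseteq> ?B" by (rule exE)
  then have r: "\<And>m. m \<in> ?X \<Longrightarrow> ?F m - r m \<in> J" "\<And>m. m \<in> ?X \<Longrightarrow> keys (r m) \<subseteq> ?B" by simp_all
  have "\<exists>a. (\<exists>m\<in>?X. a m \<noteq> 0) \<and> (\<Sum>m\<in>?X. single 0 (a m) * ?F m) \<in> J"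
    by (rule linear_dependence[OF J(1) finX finB \<open>card ?B < card ?X\<close>]) (fact r)+
  then obtain a where a: "\<exists>m\<in>?X. a m \<noteq> 0" "(\<Sum>m\<in>?X. single m (a m)) \<in> J" by (auto simp: mult_single)
  have "(\<Sum>m\<in>?X. single m (a m)) \<in> pol u" by (intro pol_sum pol_single) auto
  from indepD[OF u(1) this a(2)] have "lookup (\<Sum>m\<in>?X. single m (a m)) m = 0" for m by simp
  moreover have "lookup (\<Sum>m\<in>?X. single m (a m)) m = a m" if "m \<in> ?X" for m
    using that finX by (simp add: lookup_sum lookup_single when_def)
  ultimately show False using a(1) by auto
qed

section \<open>The degree\<close>

lemma mon_count_limit:
  assumes J: "idl s J" and k: "2 \<le> indep_dim s J"
  shows "\<exists>n::nat. (\<lambda>d. real (mon_count (std s J) d) / real d ^ (indep_dim s J - 1)) \<longlonglongrightarrow> real n / fact (indep_dim s J - 1)"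
  by (rule conic_mon_count_limit[OF conic_std[OF J] k cone_std_card[OF J]])

text \<open>\<open>lim\<close> has the intended value only once convergence is known. The factor
  \<open>fact (k - 1)\<close> in the degree clears the denominator, leaving a natural
  number.\<close>

lemma degree_quot_limit:
  assumes J: "idl s J" "graded J" "1 \<notin> J" and k: "2 \<le> indep_dim s J"
  obtains n :: nat where "degree_quot s J = real n"
    "(\<lambda>d. real (mon_count (std s J) d) / real d ^ (indep_dim s J - 1)) \<longlonglongrightarrow> real n / fact (indep_dim s J - 1)"
proof -
  obtain n :: nat where n: "(\<lambda>d. real (mon_count (std s J) d) / real d ^ (indep_dim s J - 1)) \<longlonglongrightarrow> real n / fact (indep_dim s J - 1)"
    using mon_count_limit[OF J(1) k] by blast
  then have "degree_quot s J = real n"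
    using k limI[OF n] by (simp add: degree_quot_def krull_dim_quot[OF J(1,3,2)] hilbert_fun_eq_mon_count[OF J] Let_def)
  with n that show ?thesis by blast
qed

text \<open>A larger ideal has fewer standard monomials. Equal dimensions ensure that both counts
  are normalised by the same power of \<open>d\<close>.\<close>

lemma degree_quot_mono:
  assumes I: "idl s I" "graded I" "1 \<notin> I" and J: "idl s J" "graded J" "1 \<notin> J"
    and sub: "I \<subseteq> J" and dim: "indep_dim s J = indep_dim s I" "2 \<le> indep_dim s I"
  shows "degree_quot s J \<le> degree_quot s I"
proof -
  obtain a :: nat where a: "degree_quot s I = real a"
    "(\<lambda>d. real (mon_count (std s I) d) / real d ^ (indep_dim s I - 1)) \<longlonglongrightarrow> real a / fact (indep_dim s I - 1)"
    using degree_quot_limit[OF I dim(2)] .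
  obtain b :: nat where b: "degree_quot s J = real b"
    "(\<lambda>d. real (mon_count (std s J) d) / real d ^ (indep_dim s I - 1)) \<longlonglongrightarrow> real b / fact (indep_dim s I - 1)"
    using degree_quot_limit[OF J] dim by metis
  have "mon_count (std s J) d \<le> mon_count (std s I) d" for d
    unfolding mon_count_def
  proof (rule card_mono)
    show "finite {m \<in> std s I. mon_deg m = d}" by (rule finite_mons_deg[of "{..<s}"]) (auto simp: std_def)
    show "{m \<in> std s J. mon_deg m = d} \<subseteq> {m \<in> std s I. mon_deg m = d}"
      using sub by (auto simp: std_def lead_mons_def)
  qed
  then have "real b / fact (indep_dim s I - 1) \<le> real a / fact (indep_dim s I - 1)"
    by (intro LIMSEQ_le[OF b(2) a(2)] exI[of _ 0] allI impI divide_right_mono) simp_all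
  then have "real b \<le> real a" using fact_gt_zero[of "indep_dim s I - 1"] by (simp add: divide_le_cancel)
  then show ?thesis using a b by simp
qed

section \<open>Associated primes\<close>

lemma colon_eq: "colon (poly_ring s) I f = {g \<in> pol {..<s}. g * f \<in> I}"
  by (simp add: colon_def carrier_poly_ring)

lemma colon_idl:
  assumes I: "idl s I" and f: "f \<in> pol {..<s}"
  shows "idl s (colon (poly_ring s) I f)"
  unfolding idl_def colon_eq
  using idl_zero[OF I] idl_add[OF I] idl_mult[OF I]
  by (auto simp: distrib_right mult.assoc intro: pol_add pol_mult)

text \<open>With \<open>Good\<close> meaning proper this yields an associated prime containing a given zero divisor, with
  \<open>Good\<close> meaning that \<open>u\<close> is independent it yields one of full dimension.\<close>

lemma maximal_colon_prime:
  fixes I :: "'k::field mpoly set"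
  assumes I: "idl s I" and h: "h \<in> pol {..<s}" "Good (colon (poly_ring s) I h)"
    and proper: "1 \<notin> colon (poly_ring s) I h"
    and max: "\<And>h'. h' \<in> pol {..<s} \<Longrightarrow> Good (colon (poly_ring s) I h') \<Longrightarrow>
      colon (poly_ring s) I h \<subseteq> colon (poly_ring s) I h' \<Longrightarrow> colon (poly_ring s) I h' = colon (poly_ring s) I h"
    and cut: "\<And>a. a \<in> pol {..<s} \<Longrightarrow> a \<notin> colon (poly_ring s) I h \<Longrightarrow> \<not> Good (colon (poly_ring s) I (a * h)) \<Longrightarrow>
      \<exists>t\<in>pol {..<s}. Good (colon (poly_ring s) I (t * h)) \<and> t * (a * h) \<in> I"
  shows "colon (poly_ring s) I h \<in> associated_primes (poly_ring s) I"
proof -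
  let ?C = "colon (poly_ring s) I"
  have sub: "?C h \<subseteq> ?C (a * h)" if "a \<in> pol {..<s}" for a
  proof
    fix x assume x: "x \<in> ?C h"
    then have "a * (x * h) \<in> I" using idl_mult[OF I _ that] by (simp add: colon_eq)
    then show "x \<in> ?C (a * h)" using x by (simp add: colon_eq mult.left_commute)
  qed
  have "prm s (?C h)"
    unfolding prm_def
  proof (intro conjI ballI impI proper colon_idl[OF I h(1)])
    fix a b assume ab: "a \<in> pol {..<s}" "b \<in> pol {..<s}" "a * b \<in> ?C h"
    show "a \<in> ?C h \<or> b \<in> ?C h"
    proof (rule ccontr)
      assume neg: "\<not> ?thesis"
      \<comment> \<open>Each case yields a colon ideal above \<open>?C h\<close>, equal to it by
        maximality: for a good \<open>a * h\<close> it contains \<open>b\<close>, otherwise the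
        multiplier \<open>t\<close> gives one containing \<open>a\<close>.\<close>
      show False
      proof (cases "Good (?C (a * h))")
        case True
        then have "?C (a * h) = ?C h" using max[OF pol_mult[OF ab(1) h(1)] True sub[OF ab(1)]] by simp
        moreover have "b \<in> ?C (a * h)" using ab by (simp add: colon_eq mult.assoc mult.left_commute)
        ultimately show False using neg by simp
      next
        case False
        then obtain t where t: "t \<in> pol {..<s}" "Good (?C (t * h))" "t * (a * h) \<in> I"
          using cut[OF ab(1)] neg by blast
        then have "?C (t * h) = ?C h" using max[OF pol_mult[OF t(1) h(1)] t(2) sub[OF t(1)]] by simp
        moreover have "a \<in> ?C (t * h)" using ab(1) t(3) by (simp add: colon_eq mult.left_commute)
        ultimately show False using neg by simp
      qed
    qed
  qed
  then show ?thesis using h(1) by (auto simp: associated_primes_def primeideal_iff_prm carrier_poly_ring)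
qed

lemma exists_maximal_colon:
  assumes I: "idl s I" and h: "h0 \<in> pol {..<s}" "Good (colon (poly_ring s) I h0)"
  shows "\<exists>h\<in>pol {..<s}. Good (colon (poly_ring s) I h) \<and> colon (poly_ring s) I h0 \<subseteq> colon (poly_ring s) I h \<and>
    (\<forall>h'\<in>pol {..<s}. Good (colon (poly_ring s) I h') \<longrightarrow>
      colon (poly_ring s) I h \<subseteq> colon (poly_ring s) I h' \<longrightarrow> colon (poly_ring s) I h' = colon (poly_ring s) I h)"
proof -
  let ?C = "colon (poly_ring s) I"
  let ?F = "?C ` {h \<in> pol {..<s}. Good (?C h)}"
  have "\<exists>J\<in>?F. ?C h0 \<subseteq> J \<and> (\<forall>J'\<in>?F. J \<subseteq> J' \<longrightarrow> J' = J)"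
  proof (rule noetherian_above)
    show "?C h0 \<in> ?F" using h by simp
    show "idl s J" if "J \<in> ?F" for J using that colon_idl[OF I] by auto
  qed
  then obtain J where J: "J \<in> ?F" "?C h0 \<subseteq> J \<and> (\<forall>J'\<in>?F. J \<subseteq> J' \<longrightarrow> J' = J)" by (rule bexE)
  from J(1) obtain h where h': "J = ?C h" "h \<in> pol {..<s}" "Good (?C h)" by auto
  show ?thesis
  proof (intro bexI[OF _ h'(2)] conjI ballI impI h'(3))
    show "?C h0 \<subseteq> ?C h" using J(2) h'(1) by simp
    show "?C g = ?C h" if "g \<in> pol {..<s}" "Good (?C g)" "?C h \<subseteq> ?C g" for g
      using J(2) that h'(1) by simp
  qed
qed

lemma associated_prime_of_zero_divisor:
  assumes I: "idl s I" and f: "f \<in> pol {..<s}" and g: "g \<in> pol {..<s}" "g \<notin> I" "g * f \<in> I"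
  obtains P where "P \<in> associated_primes (poly_ring s) I" "f \<in> P"
proof -
  let ?C = "colon (poly_ring s) I"
  let ?Good = "\<lambda>J::'a mpoly set. 1 \<notin> J"
  have "?Good (?C g)" using g by (simp add: colon_eq)
  from exists_maximal_colon[where Good = ?Good, OF I g(1) this] obtain h where h0: "h \<in> pol {..<s}"
    "?Good (?C h) \<and> ?C g \<subseteq> ?C h \<and> (\<forall>h'\<in>pol {..<s}. ?Good (?C h') \<longrightarrow> ?C h \<subseteq> ?C h' \<longrightarrow> ?C h' = ?C h)"
    by (rule bexE)
  then have h: "h \<in> pol {..<s}" "?Good (?C h)" "?C g \<subseteq> ?C h" by simp_all
  have max: "?C h' = ?C h" if "h' \<in> pol {..<s}" "?Good (?C h')" "?C h \<subseteq> ?C h'" for h'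
    using h0 that by simp
  have "?C h \<in> associated_primes (poly_ring s) I"
  proof (rule maximal_colon_prime[OF I h(1), of ?Good, OF h(2) h(2) max])
    \<comment> \<open>If \<open>?C (a * h)\<close> contains 1, then \<open>a * h\<close> is in
      \<open>I\<close> and \<open>a\<close> is in \<open>?C h\<close>, so the assumptions are
      contradictory.\<close>
    fix a assume "a \<in> pol {..<s}" "a \<notin> ?C h" "\<not> ?Good (?C (a * h))"
    then show "\<exists>t\<in>pol {..<s}. ?Good (?C (t * h)) \<and> t * (a * h) \<in> I"
      by (simp add: colon_eq)
  qed
  moreover have "f \<in> ?C h" using h(3) f g(3) by (auto simp: colon_eq mult.commute)
  ultimately show ?thesis using that by blast
qed

text \<open>If \<open>u\<close> becomes dependent for \<open>a * h\<close>, some nonzero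
  \<open>t\<close> in \<open>K[u]\<close> has \<open>t * (a * h)\<close> in \<open>I\<close>.
  Multiplying \<open>h\<close> by such a \<open>t\<close> keeps \<open>u\<close> independent: if
  \<open>r\<close> in \<open>K[u]\<close> kills \<open>t * h\<close> modulo \<open>I\<close>, then
  \<open>r * t\<close> lies in \<open>(I : h) \<inter> K[u]\<close> and is zero.\<close>

lemma associated_prime_indep:
  assumes I: "idl s I" and u: "indep s I u"
  obtains P where "P \<in> associated_primes (poly_ring s) I" "indep s P u"
proof -
  let ?C = "colon (poly_ring s) I"
  let ?Good = "\<lambda>J::'a mpoly set. indep s J u"
  have us: "pol u \<subseteq> (pol {..<s} :: 'a mpoly set)" using u pol_mono by (auto simp: indep_def)
  have "?C 1 = I" using idl_pol[OF I] by (auto simp: colon_eq)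
  then have "?Good (?C 1)" using u by simp
  from exists_maximal_colon[where Good = ?Good, OF I pol_one this] obtain h where h0: "h \<in> pol {..<s}"
    "?Good (?C h) \<and> ?C 1 \<subseteq> ?C h \<and> (\<forall>h'\<in>pol {..<s}. ?Good (?C h') \<longrightarrow> ?C h \<subseteq> ?C h' \<longrightarrow> ?C h' = ?C h)"
    by (rule bexE)
  then have h: "h \<in> pol {..<s}" "?Good (?C h)" "?C 1 \<subseteq> ?C h" by simp_all
  have max: "?C h' = ?C h" if "h' \<in> pol {..<s}" "?Good (?C h')" "?C h \<subseteq> ?C h'" for h'
    using h0 that by simp
  have "1 \<notin> ?C h" using indepD[OF h(2) pol_one] by auto
  have "?C h \<in> associated_primes (poly_ring s) I"
  proof (rule maximal_colon_prime[OF I h(1), of ?Good, OF h(2) \<open>1 \<notin> ?C h\<close> max])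
    fix a assume a: "a \<in> pol {..<s}" "\<not> ?Good (?C (a * h))"
    then obtain t where t: "t \<in> pol u" "t * (a * h) \<in> I" "t \<noteq> 0"
      using u by (auto simp: indep_def colon_eq)
    have "?Good (?C (t * h))"
      unfolding indep_def
    proof (intro conjI subsetI)
      show "x \<in> {..<s}" if "x \<in> u" for x using u that by (auto simp: indep_def)
      fix r assume r: "r \<in> pol u \<inter> ?C (t * h)"
      then have "r * t \<in> ?C h" using t(1) us by (auto simp: colon_eq mult.assoc intro: pol_mult)
      then have "r * t = 0" using r t(1) by (intro indepD[OF h(2)]) (auto intro: pol_mult)
      then show "r \<in> {0}" using t(3) by simp
    qed
    then show "\<exists>t\<in>pol {..<s}. ?Good (?C (t * h)) \<and> t * (a * h) \<in> I" using t us by blast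
  qed
  then show ?thesis using that h(2) by blast
qed

text \<open>\<open>P\<close> is an associated prime containing \<open>f\<close>, and
  \<open>Q\<close> one that keeps a largest independent set of \<open>I\<close>. Equal heights give
  \<open>P\<close> at least the dimension of \<open>I\<close>, and the inclusions
  \<open>I \<subseteq> (I, f) \<subseteq> P\<close> squeeze that of \<open>(I, f)\<close>.\<close>

lemma unmixed_zero_divisor_indep_dim:
  assumes I: "idl s I" "1 \<notin> I" and um: "unmixed (poly_ring s) I"
    and f: "f \<in> pol {..<s}" "f \<notin> I" "colon (poly_ring s) I f \<noteq> I"
  shows "1 \<notin> idl_insert s f I" "indep_dim s (idl_insert s f I) = indep_dim s I"
proof -
  have "I \<subseteq> colon (poly_ring s) I f" using idl_pol[OF I(1)] idl_mult'[OF I(1) _ f(1)] by (auto simp: colon_eq)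
  then obtain g where g: "g \<in> pol {..<s}" "g \<notin> I" "g * f \<in> I" using f(3) by (auto simp: colon_eq)
  obtain P where P: "P \<in> associated_primes (poly_ring s) I" "f \<in> P"
    using associated_prime_of_zero_divisor[OF I(1) f(1) g] .
  obtain u where u: "indep s I u" "card u = indep_dim s I" using indep_dim_witness[OF I] .
  obtain Q where Q: "Q \<in> associated_primes (poly_ring s) I" "indep s Q u"
    using associated_prime_indep[OF I(1) u(1)] .
  have prm: "prm s P" "prm s Q" using P Q by (auto simp: associated_primes_def primeideal_iff_prm)
  have "height (poly_ring s) P = height (poly_ring s) Q" using um P(1) Q(1) unfolding unmixed_def by metis
  then have "indep_dim s P = indep_dim s Q" by (rule height_eq_indep_dim[OF prm])
  moreover have "indep_dim s I \<le> indep_dim s Q" using card_le_indep_dim[OF Q(2)] u(2) by simp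
  ultimately have le: "indep_dim s I \<le> indep_dim s P" by simp
  have "I \<subseteq> P"
  proof -
    obtain h where "h \<in> pol {..<s}" "P = colon (poly_ring s) I h"
      using P(1) by (auto simp: associated_primes_def carrier_poly_ring)
    then show ?thesis using idl_pol[OF I(1)] idl_mult'[OF I(1)] by (auto simp: colon_eq)
  qed
  then have sub: "idl_insert s f I \<subseteq> P"
    using P(2) idl_add[OF prm_idl[OF prm(1)]] idl_mult[OF prm_idl[OF prm(1)]] by (auto simp: idl_insert_def)
  then show proper: "1 \<notin> idl_insert s f I" using prm(1) by (auto simp: prm_def)
  have "indep_dim s P \<le> indep_dim s (idl_insert s f I)"
    using sub prm(1) by (intro indep_dim_mono) (auto simp: prm_def)
  moreover have "indep_dim s (idl_insert s f I) \<le> indep_dim s I"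
    by (rule indep_dim_mono[OF idl_idl_insert[OF I(1) f(1)] proper idl_insert_super[OF I(1)]])
  ultimately show "indep_dim s (idl_insert s f I) = indep_dim s I" using le by simp
qed

theorem proposition4p21:
  fixes s :: nat and I :: "'k::field mpoly set"
  assumes "graded_ideal s I"
    and "I \<noteq> {\<zero>\<^bsub>poly_ring s\<^esub>}"
    and "unmixed (poly_ring s) I"
    and "krull_dim (poly_ring s Quot I) \<ge> 2"
  shows "\<exists>d\<ge>1. min_dist_fun s I d > degree_quot s I - real (hilbert_fun s I d) + 1"
proof -
  have I: "idl s I" and gr: "graded I"
    using assms(1) by (auto simp: graded_ideal_def graded_def ideal_iff_idl)
  have I1: "1 \<notin> I" using assms(3) idl_eq_pol[OF I] by (auto simp: unmixed_def carrier_poly_ring)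
  have "enat 2 \<le> enat (indep_dim s I)"
    using assms(4) unfolding krull_dim_quot[OF I I1 gr] by (simp add: numeral_eq_enat)
  then have k: "2 \<le> indep_dim s I" by simp
  obtain u where u: "indep s I u" "card u = indep_dim s I" using indep_dim_witness[OF I I1] .
  obtain n :: nat where n: "degree_quot s I = real n" using degree_quot_limit[OF I gr I1 k] .
  \<comment> \<open>Then the Hilbert function is at least \<open>n + 2\<close> at \<open>d\<close>,
    so the right-hand side is at most -1, while the minimum distance is nonnegative once the degrees
    under the maximum are at most \<open>n\<close>.\<close>
  define d where "d = n + 1"
  have "d + 1 \<le> mon_count (std s I) d" using mon_count_ge[OF I gr u(1)] u(2) k by simp
  then have H: "real n + 2 \<le> real (hilbert_fun s I d)" by (simp add: hilbert_fun_eq_mon_count[OF I gr I1] d_def)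
  \<comment> \<open>There may be infinitely many forms \<open>f\<close>, and \<open>Max\<close> is
    meaningful only on a finite set; the degrees take values among the naturals up to
    \<open>n\<close>.\<close>
  have deg: "degree_quot s (Idl\<^bsub>poly_ring s\<^esub> (insert f I)) \<in> real ` {..n}" if "f \<in> zero_divisor_forms s I d" for f
  proof -
    have f: "f \<in> homog_part s d" "f \<in> pol {..<s}" "f \<notin> I" "colon (poly_ring s) I f \<noteq> I"
      using that by (auto simp: zero_divisor_forms_def homog_part_eq)
    let ?J = "idl_insert s f I"
    note J = idl_idl_insert[OF I f(2)] graded_idl_insert[OF gr f(1) I]
      unmixed_zero_divisor_indep_dim[OF I I1 assms(3) f(2-4)]
    obtain m :: nat where m: "degree_quot s ?J = real m"
      using degree_quot_limit[OF J(1,2,3)] J(4) k by metis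
    have "degree_quot s ?J \<le> degree_quot s I"
      by (rule degree_quot_mono[OF I gr I1 J(1,2,3) idl_insert_super[OF I] J(4) k])
    then have "m \<le> n" using m n by simp
    then show ?thesis using m by (simp add: genideal_insert[OF I f(2)])
  qed
  have "degree_quot s I - real (hilbert_fun s I d) + 1 < min_dist_fun s I d"
  proof (cases "zero_divisor_forms s I d = {}")
    case True
    then show ?thesis using H by (simp add: min_dist_fun_def)
  next
    case False
    let ?D = "(\<lambda>f. degree_quot s (Idl\<^bsub>poly_ring s\<^esub> (insert f I))) ` zero_divisor_forms s I d"
    have sub: "?D \<subseteq> real ` {..n}" using deg by blast
    then have "finite ?D" by (rule finite_subset) simp
    then have "Max ?D \<in> ?D" using False by (intro Max_in) auto
    then have "Max ?D \<le> real n" using sub by auto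
    then show ?thesis using H False by (simp add: min_dist_fun_def)
  qed
  then show ?thesis by (intro exI[of _ d]) (simp add: d_def)
qed

end
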